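(* Assume that $f_i$ is convex and $L$-smooth for all $i=1,\dots,n$ and $f$ is $\mu$-quasi strongly convex, $\mu\ge0$. Consider EC-SGD-DIANA with $$0<\gamma\le\min\left\{\frac1{4L},\frac{\delta\sqrt{1-\alpha}}{8L\sqrt{6(3-\alpha)}}\right\},\qquad 0<\alpha\le\frac1{\omega+1}.$$ Then EC-SGD-DIANA satisfies the parametric assumption of the context with $A=2L$, $\widetilde A=0$, $A'=L$, $B_1=2$, $B_1'=B_2'=B_2=\widetilde B_1=\widetilde B_2=0$, $\widetilde D_1=\frac1n\sum_{i=1}^n\widetilde D_{1,i}$, $\sigma_{1,k}^2=\sigma_k^2=\frac1n\sum_{i=1}^n\|h_i^k-\nabla f_i(x^* )\|^2$, $\sigma_{2,k}^2\equiv0$, $\rho_1=\alpha$, $\rho_2=1$, $C_1=L\alpha$, $C_2=0$, $D_1=0$, $D_2=\alpha^2(\omega+1)\widetilde D_1$, $D_1'=\frac{\widetilde D_1}n$, $G=0$, $$F_1=\frac{96L\gamma^2}{\delta^2\alpha\left(1-\min\{\frac{\gamma\mu}2,\frac\alpha4\}\right)},\quad F_2=0,\quad D_3=\frac{6L\gamma}\delta\left(\frac{4\alpha(\omega+1)}\delta+1\right)\widetilde D_1.$$ Moreover, for all $K\ge0$ $$\mathbf E[f(\bar x^K)-f(x^* )]\le\left(1-\min\left\{\frac{\gamma\mu}2,\frac\alpha4\right\}\right)^K\frac{4(\|x^0-x^*\|^2+\gamma F_1\sigma_0^2)}\gamma+4\gamma(D_1'+D_3)$$ when $\mu>0$, and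 $$\mathbf E[f(\bar x^K)-f(x^* )]\le\frac{4(\|x^0-x^*\|^2+\gamma F_1\sigma_0^2)}{\gamma K}+4\gamma(D_1'+D_3)$$ when $\mu=0$ (right-hand side read as $+\infty$ for $K=0$).
   Context: $f(x)=\frac1n\sum_{i=1}^nf_i(x)$ on $\mathbb R^d$. A function is $L$-smooth if it is differentiable with $L$-Lipschitz gradient. $f$ is $\mu$-quasi strongly convex if it has a unique minimizer $x^*$ and $f(x^* )\ge f(x)+\langle\nabla f(x),x^*-x\rangle+\frac\mu2\|x-x^*\|^2$ for all $x$. Operators: $\mathcal C$ is a (possibly randomized) compression operator with $\mathbf E\|\mathcal C(x)-x\|^2\le(1-\delta)\|x\|^2$ for all $x$, $\delta\in(0,1]$; $Q$ is a randomized quantization operator with $\mathbf E[Q(x)]=x$, $\mathbf E\|Q(x)-x\|^2\le\omega\|x\|^2$ for all $x$, $\omega>0$; every application uses fresh independent randomness. $\mathbf E_k$ is the conditional expectation given all randomness generated before iteration $k$. EC-SGD-DIANA: given deterministic $x^0,h_1^0,\dots,h_n^0\in\mathbb R^d$, $e_i^0=0$. At iteration $k\ge0$ each worker $i$ samples $\hat g_i^k$, independently of the other workers, with $\mathbf E_k[\hat g_i^k]=\nabla f_i(x^k)$ and $\mathbf E_k\|\hat g_i^k-\nabla f_i(x^k)\|^2\le\widetilde D_{1,i}$ (for a constant $\widetilde D_{1,i}\ge0$), and sets $g_i^k=\hat g_i^k-h_i^k+h^k$ with $h^k=\frac1n\sum_ih_i^k$, $v_i^k=\mathcal C(e_i^k+\gamma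 g_i^k)$, $e_i^{k+1}=e_i^k+\gamma g_i^k-v_i^k$, $h_i^{k+1}=h_i^k+\alpha Q(\hat g_i^k-h_i^k)$. Then $x^{k+1}=x^k-\frac1n\sum_iv_i^k$. Parametric assumption: let $g^k=\frac1n\sum_ig_i^k$, $e^k=\frac1n\sum_ie_i^k$, $\bar g_i^k=\mathbf E_k[g_i^k]$. For all $k,K\ge0$: $\mathbf E_k[g^k]=\nabla f(x^k)$; $\frac1n\sum_i\|\bar g_i^k\|^2\le2A(f(x^k)-f(x^* ))+B_1\sigma_{1,k}^2+B_2\sigma_{2,k}^2+D_1$; $\frac1n\sum_i\mathbf E_k\|g_i^k-\bar g_i^k\|^2\le2\widetilde A(f(x^k)-f(x^* ))+\widetilde B_1\sigma_{1,k}^2+\widetilde B_2\sigma_{2,k}^2+\widetilde D_1$; $\mathbf E_k\|g^k\|^2\le2A'(f(x^k)-f(x^* ))+B_1'\sigma_{1,k}^2+B_2'\sigma_{2,k}^2+D_1'$; $\mathbf E_k[\sigma_{1,k+1}^2]\le(1-\rho_1)\sigma_{1,k}^2+2C_1(f(x^k)-f(x^* ))+G\rho_1\sigma_{2,k}^2+D_2$; $\mathbf E_k[\sigma_{2,k+1}^2]\le(1-\rho_2)\sigma_{2,k}^2+2C_2(f(x^k)-f(x^* ))$; $3L\sum_{k=0}^Kw_k\mathbf E\|e^k\|^2\le\frac14\sum_{k=0}^Kw_k\mathbf E[f(x^k)-f(x^* )]+F_1\sigma_{1,0}^2+F_2\sigma_{2,0}^2+\gamma D_3W_K$, where $w_k=(1-\eta)^{-(k+1)}$,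 $W_K=\sum_{k=0}^Kw_k$, $\eta=\min\{\frac{\gamma\mu}2,\frac{\rho_1}4,\frac{\rho_2}4\}$. Also $\bar x^K=\frac1{W_K}\sum_{k=0}^Kw_kx^k$. *)

theory Defs
  imports "HOL-Probability.Probability"
begin

section \<open>Function classes\<close>

definition grad :: "('a::euclidean_space \<Rightarrow> real) \<Rightarrow> 'a \<Rightarrow> 'a" where
  "grad f x = (THE D. GDERIV f x :> D)"

definition smooth :: "real \<Rightarrow> ('a::euclidean_space \<Rightarrow> real) \<Rightarrow> bool" where
  "smooth L f \<longleftrightarrow> (\<forall>x. f differentiable (at x)) \<and> L-lipschitz_on UNIV (grad f)"

definition quasi_strongly_convex :: "real \<Rightarrow> ('a::euclidean_space \<Rightarrow> real) \<Rightarrow> 'a \<Rightarrow> bool" where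
  "quasi_strongly_convex \<mu> f xs \<longleftrightarrow>
     {z. \<forall>y. f z \<le> f y} = {xs} \<and>
     (\<forall>x. f xs \<ge> f x + grad f x \<bullet> (xs - x) + \<mu> / 2 * (norm (x - xs))\<^sup>2)"

text \<open>Workers are numbered \<open>1, \<dots>, n\<close>.\<close>

definition avg :: "nat \<Rightarrow> (nat \<Rightarrow> 'b::real_vector) \<Rightarrow> 'b" where
  "avg n u = (1 / real n) *\<^sub>R (\<Sum>i=1..n. u i)"

section \<open>Randomized operators\<close>

text \<open>A randomized operator is a jointly measurable map of a random seed and a point; the seed
  has law \<open>S\<close> (respectively \<open>R\<close>). A deterministic operator is the case of a one-point seed space.\<close>

definition compression_operator ::
    "'s measure \<Rightarrow> real \<Rightarrow> ('s \<Rightarrow> 'a::euclidean_space \<Rightarrow> 'a) \<Rightarrow> bool" where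
  "compression_operator S \<delta> C \<longleftrightarrow>
     prob_space S \<and> (\<lambda>(s, y). C s y) \<in> borel_measurable (S \<Otimes>\<^sub>M borel) \<and>
     0 < \<delta> \<and> \<delta> \<le> 1 \<and>
     (\<forall>y. integrable S (\<lambda>s. (norm (C s y - y))\<^sup>2) \<and>
          (LINT s|S. (norm (C s y - y))\<^sup>2) \<le> (1 - \<delta>) * (norm y)\<^sup>2)"

definition quantization_operator ::
    "'r measure \<Rightarrow> real \<Rightarrow> ('r \<Rightarrow> 'a::euclidean_space \<Rightarrow> 'a) \<Rightarrow> bool" where
  "quantization_operator R \<omega> Q \<longleftrightarrow>
     prob_space R \<and> (\<lambda>(s, y). Q s y) \<in> borel_measurable (R \<Otimes>\<^sub>M borel) \<and>
     0 < \<omega> \<and>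
     (\<forall>y. integrable R (\<lambda>s. Q s y) \<and> (LINT s|R. Q s y) = y \<and>
          integrable R (\<lambda>s. (norm (Q s y - y))\<^sup>2) \<and>
          (LINT s|R. (norm (Q s y - y))\<^sup>2) \<le> \<omega> * (norm y)\<^sup>2)"

section \<open>Conditional expectation\<close>

text \<open>The library's \<^const>\<open>real_cond_exp\<close> is real-valued; vectors are treated coordinatewise.\<close>

definition vec_cond_exp ::
    "'w measure \<Rightarrow> 'w measure \<Rightarrow> ('w \<Rightarrow> 'a::euclidean_space) \<Rightarrow> 'w \<Rightarrow> 'a" where
  "vec_cond_exp M F X w = (\<Sum>b\<in>Basis. real_cond_exp M F (\<lambda>w. X w \<bullet> b) w *\<^sub>R b)"

text \<open>Integrability is included because \<^const>\<open>real_cond_exp\<close> has unspecified meaning (it may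
  be \<open>0\<close>) for a non-integrable variable; for \<open>X \<ge> 0\<close> and constant \<open>Y\<close> it costs nothing, as
  \<open>\<E>[X | F] \<le> Y\<close> then forces integrability.\<close>

definition cond_exp_le ::
    "'w measure \<Rightarrow> 'w measure \<Rightarrow> ('w \<Rightarrow> real) \<Rightarrow> ('w \<Rightarrow> real) \<Rightarrow> bool" where
  "cond_exp_le M F X Y \<longleftrightarrow> integrable M X \<and> (AE w in M. real_cond_exp M F X w \<le> Y w)"

text \<open>Conditional independence given \<open>F\<close> of a finite family. Subfamilies need no separate
  mention: take the remaining sets to be \<^const>\<open>UNIV\<close>.\<close>

definition cond_indep_vars ::
    "'w measure \<Rightarrow> 'w measure \<Rightarrow> 'i set \<Rightarrow> ('i \<Rightarrow> 'w \<Rightarrow> 'a::euclidean_space) \<Rightarrow> bool" where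
  "cond_indep_vars M F I X \<longleftrightarrow>
     (\<forall>i\<in>I. X i \<in> borel_measurable M) \<and>
     (\<forall>A. (\<forall>i\<in>I. A i \<in> sets borel) \<longrightarrow>
        (AE w in M. real_cond_exp M F (\<lambda>w. \<Prod>i\<in>I. indicator (A i) (X i w)) w
                    = (\<Prod>i\<in>I. real_cond_exp M F (\<lambda>w. indicator (A i) (X i w)) w)))"

section \<open>EC-SGD-DIANA\<close>

text \<open>\<open>past M n gh S sC R sQ j k\<close> is generated by the sampled gradients \<open>gh i l\<close> of the
  iterations \<open>l < j\<close> and the operator seeds \<open>sC i l\<close>, \<open>sQ i l\<close> of the iterations \<open>l < k\<close>. Hence
  \<open>j = k\<close> gives everything generated before iteration \<open>k\<close>, and \<open>j = k + 1\<close> additionally the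
  gradients sampled in iteration \<open>k\<close>, before \<open>C\<close> and \<open>Q\<close> are applied.\<close>

definition past ::
    "'w measure \<Rightarrow> nat \<Rightarrow> (nat \<Rightarrow> nat \<Rightarrow> 'w \<Rightarrow> 'a::euclidean_space) \<Rightarrow>
     's measure \<Rightarrow> (nat \<Rightarrow> nat \<Rightarrow> 'w \<Rightarrow> 's) \<Rightarrow> 'r measure \<Rightarrow> (nat \<Rightarrow> nat \<Rightarrow> 'w \<Rightarrow> 'r) \<Rightarrow>
     nat \<Rightarrow> nat \<Rightarrow> 'w measure" where
  "past M n gh S sC R sQ j k = sigma (space M)
     (\<Union>i\<in>{1..n}. (\<Union>l<j. sets (vimage_algebra (space M) (gh i l) borel)) \<union>
                  (\<Union>l<k. sets (vimage_algebra (space M) (sC i l) S)) \<union>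
                  (\<Union>l<k. sets (vimage_algebra (space M) (sQ i l) R)))"

abbreviation history where
  "history M n gh S sC R sQ k \<equiv> past M n gh S sC R sQ k k"

datatype source = Past | Compr nat | Quant nat

text \<open>\<open>fi i\<close> is the objective of worker \<open>i\<close>, and \<open>xi i k\<close> stands for the iteration-\<open>k\<close> quantity
  \<open>xi\<close> of worker \<open>i\<close>. The sampled gradients \<open>gh\<close> (written with a hat on paper) are an arbitrary
  process subject to the stated conditional law; \<open>x\<close>, \<open>e\<close>, \<open>h\<close>, \<open>g\<close>, \<open>v\<close> are determined by it and
  the seeds through the update rules.\<close>

locale ec_sgd_diana = prob_space M
  for M :: "'w measure" +
  fixes n :: nat
    and fi :: "nat \<Rightarrow> 'a::euclidean_space \<Rightarrow> real"
    and \<gamma> \<alpha> :: real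
    and D1i :: "nat \<Rightarrow> real"
    and S :: "'s measure" and C :: "'s \<Rightarrow> 'a \<Rightarrow> 'a" and sC :: "nat \<Rightarrow> nat \<Rightarrow> 'w \<Rightarrow> 's"
    and R :: "'r measure" and Q :: "'r \<Rightarrow> 'a \<Rightarrow> 'a" and sQ :: "nat \<Rightarrow> nat \<Rightarrow> 'w \<Rightarrow> 'r"
    and x0 :: 'a and h0 :: "nat \<Rightarrow> 'a"
    and gh :: "nat \<Rightarrow> nat \<Rightarrow> 'w \<Rightarrow> 'a"
    and x :: "nat \<Rightarrow> 'w \<Rightarrow> 'a"
    and e h g v :: "nat \<Rightarrow> nat \<Rightarrow> 'w \<Rightarrow> 'a"
  assumes D1i_nonneg: "\<And>i. i \<in> {1..n} \<Longrightarrow> 0 \<le> D1i i"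
    and gh_integrable: "\<And>i k. i \<in> {1..n} \<Longrightarrow> integrable M (gh i k)"
    and gh_unbiased: "\<And>i k. i \<in> {1..n} \<Longrightarrow>
      AE w in M. vec_cond_exp M (history M n gh S sC R sQ k) (gh i k) w = grad (fi i) (x k w)"
    and gh_variance: "\<And>i k. i \<in> {1..n} \<Longrightarrow>
      cond_exp_le M (history M n gh S sC R sQ k)
        (\<lambda>w. (norm (gh i k w - grad (fi i) (x k w)))\<^sup>2) (\<lambda>_. D1i i)"
    and gh_indep: "\<And>k. cond_indep_vars M (history M n gh S sC R sQ k) {1..n} (\<lambda>i. gh i k)"
    and sC_law: "\<And>i k. i \<in> {1..n} \<Longrightarrow> sC i k \<in> measurable M S \<and> distr M S (sC i k) = S"
    and sQ_law: "\<And>i k. i \<in> {1..n} \<Longrightarrow> sQ i k \<in> measurable M R \<and> distr M R (sQ i k) = R"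
    and fresh: "\<And>k. indep_sets
      (\<lambda>s. case s of
             Past \<Rightarrow> sets (past M n gh S sC R sQ (Suc k) k)
           | Compr i \<Rightarrow> sets (vimage_algebra (space M) (sC i k) S)
           | Quant i \<Rightarrow> sets (vimage_algebra (space M) (sQ i k) R))
      ({Past} \<union> Compr ` {1..n} \<union> Quant ` {1..n})"
    and x_init: "\<And>w. w \<in> space M \<Longrightarrow> x 0 w = x0"
    and h_init: "\<And>i w. i \<in> {1..n} \<Longrightarrow> w \<in> space M \<Longrightarrow> h i 0 w = h0 i"
    and e_init: "\<And>i w. i \<in> {1..n} \<Longrightarrow> w \<in> space M \<Longrightarrow> e i 0 w = 0"
    and g_step: "\<And>i k w. i \<in> {1..n} \<Longrightarrow> w \<in> space M \<Longrightarrow>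
      g i k w = gh i k w - h i k w + avg n (\<lambda>j. h j k w)"
    and v_step: "\<And>i k w. i \<in> {1..n} \<Longrightarrow> w \<in> space M \<Longrightarrow>
      v i k w = C (sC i k w) (e i k w + \<gamma> *\<^sub>R g i k w)"
    and e_step: "\<And>i k w. i \<in> {1..n} \<Longrightarrow> w \<in> space M \<Longrightarrow>
      e i (Suc k) w = e i k w + \<gamma> *\<^sub>R g i k w - v i k w"
    and h_step: "\<And>i k w. i \<in> {1..n} \<Longrightarrow> w \<in> space M \<Longrightarrow>
      h i (Suc k) w = h i k w + \<alpha> *\<^sub>R Q (sQ i k w) (gh i k w - h i k w)"
    and x_step: "\<And>k w. w \<in> space M \<Longrightarrow>
      x (Suc k) w = x k w - avg n (\<lambda>i. v i k w)"

section \<open>Parametric assumption\<close>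

text \<open>A suffix \<open>t\<close> stands for a tilde.\<close>

record ec_params =
  par_A :: real
  par_At :: real
  par_A' :: real
  par_B1 :: real
  par_B1t :: real
  par_B1' :: real
  par_B2 :: real
  par_B2t :: real
  par_B2' :: real
  par_C1 :: real
  par_C2 :: real
  par_D1 :: real
  par_D1t :: real
  par_D1' :: real
  par_D2 :: real
  par_D3 :: real
  par_F1 :: real
  par_F2 :: real
  par_G :: real
  par_rho1 :: real
  par_rho2 :: real

definition rate :: "real \<Rightarrow> real \<Rightarrow> real \<Rightarrow> real \<Rightarrow> real" where
  "rate \<gamma> \<mu> \<rho>1 \<rho>2 = min (\<gamma> * \<mu> / 2) (min (\<rho>1 / 4) (\<rho>2 / 4))"

definition wgt :: "real \<Rightarrow> nat \<Rightarrow> real" where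
  "wgt \<eta> k = 1 / (1 - \<eta>) ^ (k + 1)"

definition wgt_sum :: "real \<Rightarrow> nat \<Rightarrow> real" where
  "wgt_sum \<eta> K = (\<Sum>k=0..K. wgt \<eta> k)"

definition wgt_avg :: "real \<Rightarrow> (nat \<Rightarrow> 'w \<Rightarrow> 'a::real_vector) \<Rightarrow> nat \<Rightarrow> 'w \<Rightarrow> 'a" where
  "wgt_avg \<eta> x K w = (1 / wgt_sum \<eta> K) *\<^sub>R (\<Sum>k=0..K. wgt \<eta> k *\<^sub>R x k w)"

text \<open>\<open>F k\<close> is the \<open>\<sigma>\<close>-algebra of everything generated before iteration \<open>k\<close>; \<open>s1 k\<close> and \<open>s2 k\<close>
  are the squares \<open>\<sigma>\<^sub>1\<^sub>,\<^sub>k\<^sup>2\<close> and \<open>\<sigma>\<^sub>2\<^sub>,\<^sub>k\<^sup>2\<close>. The integrability clauses ensure that every (conditional)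
  expectation below is a genuine one.\<close>

definition parametric_assumption ::
    "'w measure \<Rightarrow> (nat \<Rightarrow> 'w measure) \<Rightarrow> nat \<Rightarrow> ('a::euclidean_space \<Rightarrow> real) \<Rightarrow> 'a \<Rightarrow>
     real \<Rightarrow> real \<Rightarrow> real \<Rightarrow>
     (nat \<Rightarrow> 'w \<Rightarrow> 'a) \<Rightarrow> (nat \<Rightarrow> nat \<Rightarrow> 'w \<Rightarrow> 'a) \<Rightarrow> (nat \<Rightarrow> nat \<Rightarrow> 'w \<Rightarrow> 'a) \<Rightarrow>
     (nat \<Rightarrow> 'w \<Rightarrow> real) \<Rightarrow> (nat \<Rightarrow> 'w \<Rightarrow> real) \<Rightarrow> ec_params \<Rightarrow> bool" where
  "parametric_assumption M F n f xs L \<mu> \<gamma> x g e s1 s2 P \<longleftrightarrow>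
    (let gbar = (\<lambda>i k. vec_cond_exp M (F k) (g i k));
         gap = (\<lambda>k w. f (x k w) - f xs);
         ga = (\<lambda>k w. avg n (\<lambda>i. g i k w));
         ea = (\<lambda>k w. avg n (\<lambda>i. e i k w));
         \<eta> = rate \<gamma> \<mu> (par_rho1 P) (par_rho2 P)
     in
      (\<forall>k. integrable M (gap k) \<and> integrable M (s1 k) \<and> integrable M (s2 k)
         \<and> integrable M (\<lambda>w. (norm (ea k w))\<^sup>2)
         \<and> (\<forall>i\<in>{1..n}. integrable M (g i k)
               \<and> integrable M (\<lambda>w. (norm (g i k w - gbar i k w))\<^sup>2))) \<and>
      (\<forall>k. AE w in M. vec_cond_exp M (F k) (ga k) w = grad f (x k w)) \<and>
      (\<forall>k. AE w in M.
         avg n (\<lambda>i. (norm (gbar i k w))\<^sup>2)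
         \<le> 2 * par_A P * gap k w + par_B1 P * s1 k w + par_B2 P * s2 k w + par_D1 P) \<and>
      (\<forall>k. AE w in M.
         avg n (\<lambda>i. real_cond_exp M (F k) (\<lambda>w. (norm (g i k w - gbar i k w))\<^sup>2) w)
         \<le> 2 * par_At P * gap k w + par_B1t P * s1 k w + par_B2t P * s2 k w + par_D1t P) \<and>
      (\<forall>k. cond_exp_le M (F k) (\<lambda>w. (norm (ga k w))\<^sup>2)
         (\<lambda>w. 2 * par_A' P * gap k w + par_B1' P * s1 k w + par_B2' P * s2 k w + par_D1' P)) \<and>
      (\<forall>k. cond_exp_le M (F k) (s1 (k + 1))
         (\<lambda>w. (1 - par_rho1 P) * s1 k w + 2 * par_C1 P * gap k w
              + par_G P * par_rho1 P * s2 k w + par_D2 P)) \<and>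
      (\<forall>k. cond_exp_le M (F k) (s2 (k + 1))
         (\<lambda>w. (1 - par_rho2 P) * s2 k w + 2 * par_C2 P * gap k w)) \<and>
      (\<forall>K. AE w in M.
         3 * L * (\<Sum>k=0..K. wgt \<eta> k * (LINT w|M. (norm (ea k w))\<^sup>2))
         \<le> 1 / 4 * (\<Sum>k=0..K. wgt \<eta> k * (LINT w|M. gap k w))
            + par_F1 P * s1 0 w + par_F2 P * s2 0 w + \<gamma> * par_D3 P * wgt_sum \<eta> K))"

end

theory Submission
  imports Defs
begin

text \<open>
  The compression errors disappear from the iteration once the mean accumulated error
  \<open>eb k = avg e\<close> is subtracted from the iterate: \<open>xt k = x k - eb k\<close> satisfies
  \<open>xt (k + 1) = xt k - \<gamma> * avg g\<close>, a plain stochastic gradient step, except that the gradient is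
  taken at \<open>x k\<close> and not at \<open>xt k\<close>. Quasi strong convexity, with the displacement \<open>eb k\<close> absorbed by
  Young's inequality, yields (lemma \<open>A_step\<close>)
  \<open>E\<parallel>xt (k+1) - xs\<parallel>\<^sup>2 \<le> (1 - \<eta>) E\<parallel>xt k - xs\<parallel>\<^sup>2 - \<gamma>/2 E[gap k] + 3 L \<gamma> E\<parallel>eb k\<parallel>\<^sup>2 + \<gamma>\<^sup>2 D1/n\<close>.
  The weights \<open>(1 - \<eta>)\<^sup>-\<^sup>(\<^sup>k\<^sup>+\<^sup>1\<^sup>)\<close> telescope this inequality, so that both convergence rates follow from a
  bound on the weighted sum of \<open>E\<parallel>eb k\<parallel>\<^sup>2\<close>, which is also the last item of the parametric assumption.

  That bound (lemma \<open>weighted_error_sum\<close>) comes from two coupled linear recursions. Compression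
  contracts the error of each worker, which is driven by the size of its estimator \<open>g i\<close>
  (\<open>\<epsilon>_step\<close>). The estimator is small near \<open>xs\<close> as far as \<open>h i\<close> has learnt the gradient of \<open>fi i\<close> at
  \<open>xs\<close>; the squared distance \<open>\<sigma>2\<close> contracts by \<open>1 - \<alpha>\<close>, because \<open>\<alpha> (\<omega> + 1) \<le> 1\<close> makes the quantized
  update an averaging step in mean square (\<open>\<sigma>2_step_on\<close>). As \<open>\<eta>\<close> is at most \<open>\<alpha>/4\<close> and \<open>\<delta>/24\<close>, each
  recursion passes to the weighted sums with a contraction factor to spare
  (\<open>weighted_sum_recursion\<close>), and the step size bound keeps the constants within the stated ones.

  Inequalities between conditional expectations given the history are obtained by integrating over
  arbitrary events of the history. Three facts are used there: the gradient noise is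
  orthogonal to everything the history determines (\<open>noise_orthogonal\<close>), the noises of different
  workers are uncorrelated by conditional independence (\<open>noise_uncorrelated\<close>), and a fresh operator
  seed can be integrated out with the argument of the operator held fixed
  (\<open>fresh_seed_integral_le\<close>). All expectations exist because the iterates are square integrable, by
  induction along the algorithm (\<open>iterates_square_integrable\<close>).
\<close>

section \<open>Averages over the workers\<close>

lemma avg_cong: "(\<And>i. i \<in> {1..n} \<Longrightarrow> u i = v i) \<Longrightarrow> avg n u = avg n v"
  by (simp add: avg_def)

lemma avg_real: "avg n u = (\<Sum>i=1..n. u i) / real n"
  for u :: "nat \<Rightarrow> real"
  by (simp add: avg_def)

lemma avg_add: "avg n (\<lambda>i. u i + v i) = avg n u + avg n v"
  by (simp add: avg_def sum.distrib scaleR_add_right)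

lemma avg_diff: "avg n (\<lambda>i. u i - v i) = avg n u - avg n v"
  by (simp add: avg_def sum_subtractf scaleR_diff_right)

lemma avg_scaleR: "avg n (\<lambda>i. c *\<^sub>R u i) = c *\<^sub>R avg n u"
  by (simp add: avg_def scaleR_sum_right)

lemma avg_mult_left: "avg n (\<lambda>i. c * u i) = c * avg n u"
  for u :: "nat \<Rightarrow> real"
  using avg_scaleR[of n c u] by simp

lemma avg_const: "1 \<le> n \<Longrightarrow> avg n (\<lambda>i. c) = c"
  by (simp add: avg_def scaleR_conv_of_real flip: scaleR_scaleR)
     (simp add: sum_constant_scaleR)

lemma avg_inner_left: "avg n u \<bullet> z = avg n (\<lambda>i. u i \<bullet> z)"
  by (simp add: avg_def inner_sum_left)

lemma avg_mono: "(\<And>i. i \<in> {1..n} \<Longrightarrow> u i \<le> v i) \<Longrightarrow> avg n u \<le> avg n v"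
  for u :: "nat \<Rightarrow> real"
  unfolding avg_real by (intro divide_right_mono sum_mono) auto

lemma avg_nonneg: "(\<And>i. i \<in> {1..n} \<Longrightarrow> 0 \<le> u i) \<Longrightarrow> 0 \<le> avg n u"
  for u :: "nat \<Rightarrow> real"
  unfolding avg_real by (intro divide_nonneg_nonneg sum_nonneg) auto

lemma power2_norm_add: "(norm (a + b))\<^sup>2 = (norm a)\<^sup>2 + 2 * (a \<bullet> b) + (norm b)\<^sup>2"
  for a b :: "'a::real_inner"
  by (simp add: power2_norm_eq_inner inner_add_left inner_add_right inner_commute)

lemma power2_norm_diff: "(norm (a - b))\<^sup>2 = (norm a)\<^sup>2 - 2 * (a \<bullet> b) + (norm b)\<^sup>2"
  for a b :: "'a::real_inner"
  by (simp add: power2_norm_eq_inner inner_diff_left inner_diff_right inner_commute)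

lemma norm_scaleR_power2: "(norm (c *\<^sub>R a))\<^sup>2 = c\<^sup>2 * (norm a)\<^sup>2"
  by (simp add: power_mult_distrib)

lemma avg_norm2_centred:
  fixes u :: "nat \<Rightarrow> 'a::real_inner"
  assumes "1 \<le> n"
  shows "avg n (\<lambda>i. (norm (u i - avg n u))\<^sup>2) = avg n (\<lambda>i. (norm (u i))\<^sup>2) - (norm (avg n u))\<^sup>2"
proof -
  have "avg n (\<lambda>i. (norm (u i - avg n u))\<^sup>2)
      = avg n (\<lambda>i. ((norm (u i))\<^sup>2 - 2 * (u i \<bullet> avg n u)) + (norm (avg n u))\<^sup>2)"
    by (simp add: power2_norm_diff)
  also have "\<dots> = avg n (\<lambda>i. (norm (u i))\<^sup>2) - 2 * avg n (\<lambda>i. u i \<bullet> avg n u) + (norm (avg n u))\<^sup>2"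
    by (simp only: avg_add avg_diff avg_mult_left avg_const[OF assms])
  also have "avg n (\<lambda>i. u i \<bullet> avg n u) = (norm (avg n u))\<^sup>2"
    by (simp add: avg_inner_left[symmetric] power2_norm_eq_inner)
  finally show ?thesis by simp
qed

lemma norm2_avg_le:
  fixes u :: "nat \<Rightarrow> 'a::real_inner"
  assumes "1 \<le> n"
  shows "(norm (avg n u))\<^sup>2 \<le> avg n (\<lambda>i. (norm (u i))\<^sup>2)"
proof -
  have "0 \<le> avg n (\<lambda>i. (norm (u i - avg n u))\<^sup>2)" by (rule avg_nonneg) simp
  then show ?thesis using avg_norm2_centred[OF assms, of u] by simp
qed

text \<open>Young's inequality, from \<open>0 \<le> \<parallel>t a - b\<parallel>\<^sup>2\<close>.\<close>

lemma young_norm2: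
  fixes a b :: "'a::real_inner"
  assumes "0 < t"
  shows "(norm (a + b))\<^sup>2 \<le> (1 + t) * (norm a)\<^sup>2 + (1 + 1 / t) * (norm b)\<^sup>2"
proof -
  have "0 \<le> (norm (t *\<^sub>R a - b))\<^sup>2" by simp
  also have "\<dots> = t * (t * (norm a)\<^sup>2 - 2 * (a \<bullet> b)) + (norm b)\<^sup>2"
    by (simp add: power2_norm_diff norm_scaleR_power2 del: norm_scaleR)
       (simp add: power2_eq_square algebra_simps)
  finally have "2 * (a \<bullet> b) \<le> t * (norm a)\<^sup>2 + (norm b)\<^sup>2 / t"
    using assms by (simp add: field_simps)
  then show ?thesis by (simp add: power2_norm_add algebra_simps)
qed

section \<open>Smooth convex functions\<close>

lemma GDERIV_unique:
  assumes "GDERIV f x :> a" "GDERIV f x :> b"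
  shows "a = b"
proof -
  have "(\<lambda>h. h \<bullet> a) = (\<lambda>h. h \<bullet> b)"
    using assms unfolding gderiv_def by (rule has_derivative_unique)
  then have "(a - b) \<bullet> a = (a - b) \<bullet> b" by metis
  then have "(a - b) \<bullet> (a - b) = 0" by (simp add: inner_diff_right)
  then show ?thesis by simp
qed

lemma GDERIV_grad_eq: "GDERIV f x :> D \<Longrightarrow> grad f x = D"
  unfolding grad_def by (rule the_equality) (auto intro: GDERIV_unique)

lemma GDERIV_grad:
  fixes f :: "'a::euclidean_space \<Rightarrow> real"
  assumes "f differentiable (at x)"
  shows "GDERIV f x :> grad f x"
proof -
  obtain f' where f': "(f has_derivative f') (at x)"
    using assms by (auto simp: differentiable_def)
  interpret f': bounded_linear f' using f' by (rule has_derivative_bounded_linear)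
  have "f' = (\<lambda>h. h \<bullet> (\<Sum>b\<in>Basis. f' b *\<^sub>R b))"
  proof
    fix h
    have "f' h = f' (\<Sum>b\<in>Basis. (h \<bullet> b) *\<^sub>R b)" by (simp add: euclidean_representation)
    also have "\<dots> = h \<bullet> (\<Sum>b\<in>Basis. f' b *\<^sub>R b)"
      by (simp add: f'.sum f'.scaleR inner_sum_right mult.commute)
    finally show "f' h = h \<bullet> (\<Sum>b\<in>Basis. f' b *\<^sub>R b)" .
  qed
  then have "GDERIV f x :> (\<Sum>b\<in>Basis. f' b *\<^sub>R b)" using f' by (simp add: gderiv_def)
  then show ?thesis using GDERIV_grad_eq by metis
qed

lemma smooth_GDERIV: "smooth L f \<Longrightarrow> GDERIV f x :> grad f x"
  by (simp add: smooth_def GDERIV_grad)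

lemma smooth_lipschitz: "smooth L f \<Longrightarrow> norm (grad f y - grad f z) \<le> L * norm (y - z)"
  unfolding smooth_def by (auto dest: lipschitz_onD simp: dist_norm)

lemma smooth_borel_measurable: "smooth L f \<Longrightarrow> f \<in> borel_measurable borel"
  unfolding smooth_def
  by (intro borel_measurable_continuous_onI continuous_at_imp_continuous_on)
     (auto intro: differentiable_imp_continuous_within)

lemma smooth_grad_borel_measurable: "smooth L f \<Longrightarrow> grad f \<in> borel_measurable borel"
  unfolding smooth_def
  by (intro borel_measurable_continuous_onI lipschitz_on_continuous_on) auto

text \<open>The descent lemma and the tangent inequality both reduce to the restriction of \<open>f\<close> to a line.\<close>

lemma DERIV_along_line:
  assumes "smooth L f"
  shows "DERIV (\<lambda>t. f (z + t *\<^sub>R d)) t :> grad f (z + t *\<^sub>R d) \<bullet> d"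
proof -
  have "((\<lambda>t. z + t *\<^sub>R d) has_derivative (\<lambda>t. t *\<^sub>R d)) (at t)"
    by (auto intro!: derivative_eq_intros)
  moreover have "(f has_derivative (\<lambda>h. h \<bullet> grad f (z + t *\<^sub>R d))) (at (z + t *\<^sub>R d))"
    using smooth_GDERIV[OF assms] by (simp add: gderiv_def)
  ultimately have "((\<lambda>t. f (z + t *\<^sub>R d)) has_derivative (\<lambda>s. (s *\<^sub>R d) \<bullet> grad f (z + t *\<^sub>R d))) (at t)"
    by (rule has_derivative_compose)
  then show ?thesis
    by (simp add: has_field_derivative_def inner_commute mult.commute[of _ "d \<bullet> _"] )
qed

lemma descent_lemma:
  assumes f: "smooth L f"
  shows "f y \<le> f z + grad f z \<bullet> (y - z) + L / 2 * (norm (y - z))\<^sup>2"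
proof -
  define d where "d = y - z"
  \<comment> \<open>The difference of the two sides along the segment, which is nonincreasing.\<close>
  define \<phi> where "\<phi> t = f (z + t *\<^sub>R d) - t * (grad f z \<bullet> d) - L / 2 * (norm d)\<^sup>2 * t\<^sup>2" for t :: real
  have der: "DERIV \<phi> t :> grad f (z + t *\<^sub>R d) \<bullet> d - grad f z \<bullet> d - L * (norm d)\<^sup>2 * t" for t
    unfolding \<phi>_def
    by (auto intro!: derivative_eq_intros DERIV_along_line[OF f])
  have "\<phi> 1 \<le> \<phi> 0"
  proof (rule DERIV_nonpos_imp_nonincreasing[of 0 1 \<phi>])
    fix t :: real assume t: "0 \<le> t" "t \<le> 1"
    have "grad f (z + t *\<^sub>R d) \<bullet> d - grad f z \<bullet> d = (grad f (z + t *\<^sub>R d) - grad f z) \<bullet> d"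
      by (simp add: inner_diff_left)
    also have "\<dots> \<le> norm (grad f (z + t *\<^sub>R d) - grad f z) * norm d"
      by (rule norm_cauchy_schwarz)
    also have "\<dots> \<le> (L * norm (z + t *\<^sub>R d - z)) * norm d"
      by (intro mult_right_mono smooth_lipschitz[OF f]) simp
    also have "\<dots> = L * (norm d)\<^sup>2 * t" using t by (simp add: power2_eq_square)
    finally show "\<exists>y. DERIV \<phi> t :> y \<and> y \<le> 0" using der[of t] by auto
  qed simp
  then show ?thesis by (simp add: \<phi>_def d_def)
qed

lemma convex_tangent_le:
  assumes f: "smooth L f" and c: "convex_on UNIV f"
  shows "f z + grad f z \<bullet> (y - z) \<le> f y"
proof -
  define \<phi> where "\<phi> t = f (z + t *\<^sub>R (y - z))" for t :: real
  have "convex_on UNIV \<phi>"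
  proof (rule convex_onI)
    fix t a b :: real assume "0 < t" "t < 1"
    have "z + ((1 - t) *\<^sub>R a + t *\<^sub>R b) *\<^sub>R (y - z)
        = (1 - t) *\<^sub>R (z + a *\<^sub>R (y - z)) + t *\<^sub>R (z + b *\<^sub>R (y - z))"
      by (simp add: algebra_simps)
    then show "\<phi> ((1 - t) *\<^sub>R a + t *\<^sub>R b) \<le> (1 - t) * \<phi> a + t * \<phi> b"
      unfolding \<phi>_def using convex_onD[OF c, of t] \<open>0 < t\<close> \<open>t < 1\<close> by simp
  qed simp
  moreover have "DERIV \<phi> 0 :> grad f z \<bullet> (y - z)"
    unfolding \<phi>_def using DERIV_along_line[OF f, of z "y - z" 0] by simp
  ultimately have "\<phi> 1 - \<phi> 0 \<ge> (grad f z \<bullet> (y - z)) * (1 - 0)"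
    by (intro convex_on_imp_above_tangent[where A=UNIV]) auto
  then show ?thesis by (simp add: \<phi>_def)
qed

text \<open>Co-coercivity: at the point \<open>p = y - (grad f y - grad f z) / L\<close> the tangent at \<open>z\<close> bounds \<open>f\<close>
  from below and the descent lemma at \<open>y\<close> bounds it from above.\<close>

lemma grad_diff_norm2_le:
  assumes f: "smooth L f" and c: "convex_on UNIV f" and L: "0 < L"
  shows "(norm (grad f y - grad f z))\<^sup>2 \<le> 2 * L * (f y - f z - grad f z \<bullet> (y - z))"
proof -
  define d where "d = grad f y - grad f z"
  define p where "p = y - (1 / L) *\<^sub>R d"
  have "f z + grad f z \<bullet> (p - z) \<le> f y + grad f y \<bullet> (p - y) + L / 2 * (norm (p - y))\<^sup>2"
    using convex_tangent_le[OF f c, of z p] descent_lemma[OF f, of p y] by simp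
  moreover have "grad f z \<bullet> (p - z) = grad f z \<bullet> (y - z) - (1 / L) * (grad f z \<bullet> d)"
    by (simp add: p_def inner_diff_right)
  moreover have "grad f y \<bullet> (p - y) = - (1 / L) * (grad f y \<bullet> d)"
    by (simp add: p_def)
  moreover have "L / 2 * (norm (p - y))\<^sup>2 = (norm d)\<^sup>2 / (2 * L)"
    using L by (simp add: p_def power_divide) (simp add: power2_eq_square)
  moreover have "(1 / L) * (grad f y \<bullet> d) - (1 / L) * (grad f z \<bullet> d) = (norm d)\<^sup>2 / L"
    by (simp add: d_def power2_norm_eq_inner inner_diff_left diff_divide_distrib)
  ultimately have "(norm d)\<^sup>2 / (2 * L) \<le> f y - f z - grad f z \<bullet> (y - z)"
    using L by simp
  then show ?thesis using L by (simp add: d_def field_simps)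
qed

lemma GDERIV_avg:
  assumes "\<And>i. i \<in> {1..n} \<Longrightarrow> GDERIV (fi i) z :> G i"
  shows "GDERIV (\<lambda>y. avg n (\<lambda>i. fi i y)) z :> avg n G"
proof -
  have "((\<lambda>y. (1 / real n) *\<^sub>R (\<Sum>i=1..n. fi i y)) has_derivative
      (\<lambda>h. (1 / real n) *\<^sub>R (\<Sum>i=1..n. h \<bullet> G i))) (at z)"
    using assms by (intro derivative_intros) (simp add: gderiv_def)
  moreover have "(\<lambda>h. (1 / real n) *\<^sub>R (\<Sum>i=1..n. h \<bullet> G i)) = (\<lambda>h. h \<bullet> avg n G)"
    by (simp add: avg_def inner_sum_right)
  ultimately show ?thesis by (simp add: gderiv_def avg_def)
qed

lemma grad_avg:
  assumes "\<And>i. i \<in> {1..n} \<Longrightarrow> smooth L (fi i)"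
  shows "grad (\<lambda>y. avg n (\<lambda>i. fi i y)) z = avg n (\<lambda>i. grad (fi i) z)"
  using assms by (intro GDERIV_grad_eq GDERIV_avg smooth_GDERIV)

lemma smooth_avg:
  assumes "1 \<le> n" and f: "\<And>i. i \<in> {1..n} \<Longrightarrow> smooth L (fi i)"
  shows "smooth L (\<lambda>y. avg n (\<lambda>i. fi i y))"
  unfolding smooth_def
proof (intro conjI allI lipschitz_onI)
  fix z show "(\<lambda>y. avg n (\<lambda>i. fi i y)) differentiable (at z)"
    using GDERIV_avg[of n fi z "\<lambda>i. grad (fi i) z"] smooth_GDERIV[OF f]
    by (auto simp: gderiv_def differentiable_def)
next
  fix y z
  have "norm (avg n (\<lambda>i. grad (fi i) y - grad (fi i) z))
      \<le> avg n (\<lambda>i. norm (grad (fi i) y - grad (fi i) z))"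
    by (simp add: avg_def sum_norm_le divide_right_mono norm_sum)
  also have "\<dots> \<le> avg n (\<lambda>i. L * norm (y - z))"
    by (intro avg_mono smooth_lipschitz f)
  finally have "norm (avg n (\<lambda>i. grad (fi i) y) - avg n (\<lambda>i. grad (fi i) z)) \<le> L * norm (y - z)"
    using \<open>1 \<le> n\<close> by (simp add: avg_diff avg_const)
  then show "dist (grad (\<lambda>y. avg n (\<lambda>i. fi i y)) y) (grad (\<lambda>y. avg n (\<lambda>i. fi i y)) z) \<le> L * dist y z"
    unfolding dist_norm using grad_avg[of n L fi, OF f] by presburger
next
  show "0 \<le> L" using f[of 1] \<open>1 \<le> n\<close> lipschitz_on_nonneg unfolding smooth_def by auto
qed

lemma convex_on_avg:
  assumes "\<And>i. i \<in> {1..n} \<Longrightarrow> convex_on UNIV (fi i)"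
  shows "convex_on UNIV (\<lambda>y. avg n (\<lambda>i. fi i y))"
proof (rule convex_onI)
  fix t :: real and y z assume t: "0 < t" "t < 1"
  have "avg n (\<lambda>i. fi i ((1 - t) *\<^sub>R y + t *\<^sub>R z)) \<le> avg n (\<lambda>i. (1 - t) * fi i y + t * fi i z)"
    using t by (intro avg_mono convex_onD[OF assms]) auto
  then show "avg n (\<lambda>i. fi i ((1 - t) *\<^sub>R y + t *\<^sub>R z))
      \<le> (1 - t) * avg n (\<lambda>i. fi i y) + t * avg n (\<lambda>i. fi i z)"
    by (simp add: avg_add avg_mult_left)
qed simp

text \<open>A gradient step from a minimizer would decrease the function by \<open>\<parallel>grad f xs\<parallel>\<^sup>2 / (2 L)\<close>.\<close>

lemma grad_minimizer_eq_0:
  assumes f: "smooth L f" and L: "0 < L" and min: "\<And>y. f xs \<le> f y"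
  shows "grad f xs = 0"
proof -
  let ?G = "grad f xs"
  have "f xs \<le> f (xs - (1 / L) *\<^sub>R ?G)" by (rule min)
  also have "\<dots> \<le> f xs + ?G \<bullet> ((xs - (1 / L) *\<^sub>R ?G) - xs)
      + L / 2 * (norm ((xs - (1 / L) *\<^sub>R ?G) - xs))\<^sup>2"
    by (rule descent_lemma[OF f])
  also have "\<dots> = f xs - (norm ?G)\<^sup>2 / (2 * L)"
    using L by (simp add: power_divide power2_norm_eq_inner) (simp add: power2_eq_square field_simps)
  finally have "(norm ?G)\<^sup>2 \<le> 0" using L by (simp add: divide_le_0_iff)
  then show ?thesis by simp
qed

text \<open>With \<open>u = \<parallel>grad f y\<parallel>\<close> and \<open>d = \<parallel>y - xs\<parallel>\<close> one has
  \<open>\<mu> d\<^sup>2 / 2 \<le> u d - (f y - f xs) \<le> u d - u\<^sup>2 / (2 L) \<le> L d\<^sup>2 / 2\<close>.\<close>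

lemma quasi_strongly_convex_le_smooth:
  fixes f :: "'a::euclidean_space \<Rightarrow> real"
  assumes f: "smooth L f" and c: "convex_on UNIV f" and L: "0 < L"
    and q: "quasi_strongly_convex \<mu> f xs"
  shows "\<mu> \<le> L"
proof -
  \<comment> \<open>Any point at distance \<open>1\<close> from \<open>xs\<close> serves.\<close>
  obtain b :: 'a where b: "b \<in> Basis" using nonempty_Basis by blast
  define y where "y = xs + b"
  define u where "u = norm (grad f y)"
  have min: "\<And>z. f xs \<le> f z" using q by (auto simp: quasi_strongly_convex_def)
  have nb: "norm b = 1" using b by simp
  have "f y + grad f y \<bullet> (xs - y) + \<mu> / 2 * (norm (y - xs))\<^sup>2 \<le> f xs"
    using q by (auto simp: quasi_strongly_convex_def)
  then have 1: "f y - f xs + \<mu> / 2 \<le> grad f y \<bullet> b" by (simp add: y_def nb)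
  have 2: "grad f y \<bullet> b \<le> u" using norm_cauchy_schwarz[of "grad f y" b] by (simp add: u_def nb)
  have "u\<^sup>2 \<le> 2 * L * (f y - f xs)"
    using grad_diff_norm2_le[OF f c L, of y xs] grad_minimizer_eq_0[OF f L min] by (simp add: u_def)
  then have "u\<^sup>2 \<le> 2 * L * (u - \<mu> / 2)" using 1 2 L
    by (smt (verit, ccfv_SIG) mult_left_mono)
  moreover have "0 \<le> (u - L)\<^sup>2" by simp
  ultimately have "L * \<mu> \<le> L * L" by (simp add: power2_eq_square algebra_simps)
  then show ?thesis using L by simp
qed

section \<open>Square-integrable random vectors\<close>

definition square_integrable :: "'w measure \<Rightarrow> ('w \<Rightarrow> 'a::euclidean_space) \<Rightarrow> bool" where
  "square_integrable M X \<longleftrightarrow> X \<in> borel_measurable M \<and> integrable M (\<lambda>w. (norm (X w))\<^sup>2)"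

lemma square_integrable_measurable: "square_integrable M X \<Longrightarrow> X \<in> borel_measurable M"
  by (simp add: square_integrable_def)

lemma square_integrable_norm2: "square_integrable M X \<Longrightarrow> integrable M (\<lambda>w. (norm (X w))\<^sup>2)"
  by (simp add: square_integrable_def)

lemma square_integrable_bound:
  assumes Y: "integrable M Y" and X: "X \<in> borel_measurable M"
    and le: "\<And>w. w \<in> space M \<Longrightarrow> (norm (X w))\<^sup>2 \<le> Y w"
  shows "square_integrable M X"
  unfolding square_integrable_def
proof (intro conjI X Bochner_Integration.integrable_bound[OF Y] AE_I2)
  show "(\<lambda>w. (norm (X w))\<^sup>2) \<in> borel_measurable M" using X by measurable
  show "norm ((norm (X w))\<^sup>2) \<le> norm (Y w)" if "w \<in> space M" for w
    using le[OF that] by simp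
qed

lemma square_integrable_add:
  assumes X: "square_integrable M X" and Y: "square_integrable M Y"
  shows "square_integrable M (\<lambda>w. X w + Y w)"
proof (rule square_integrable_bound)
  show "integrable M (\<lambda>w. 2 * (norm (X w))\<^sup>2 + 2 * (norm (Y w))\<^sup>2)"
    using X Y by (simp add: square_integrable_def)
  show "(\<lambda>w. X w + Y w) \<in> borel_measurable M"
    using X Y by (auto simp: square_integrable_def)
  show "(norm (X w + Y w))\<^sup>2 \<le> 2 * (norm (X w))\<^sup>2 + 2 * (norm (Y w))\<^sup>2" for w
    using young_norm2[of 1 "X w" "Y w"] by simp
qed

lemma square_integrable_scaleR:
  "square_integrable M X \<Longrightarrow> square_integrable M (\<lambda>w. c *\<^sub>R X w)"
  by (auto simp: square_integrable_def power_mult_distrib)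

lemma square_integrable_diff:
  assumes X: "square_integrable M X" and Y: "square_integrable M Y"
  shows "square_integrable M (\<lambda>w. X w - Y w)"
  using square_integrable_add[OF X square_integrable_scaleR[OF Y, of "-1"]] by simp

lemma (in finite_measure) square_integrable_const: "square_integrable M (\<lambda>w. c)"
  by (simp add: square_integrable_def)

lemma (in finite_measure) square_integrable_sum:
  "(\<And>i. i \<in> I \<Longrightarrow> square_integrable M (X i)) \<Longrightarrow> square_integrable M (\<lambda>w. \<Sum>i\<in>I. X i w)"
  by (induction I rule: infinite_finite_induct)
     (auto intro!: square_integrable_add square_integrable_const)

lemma (in finite_measure) square_integrable_avg:
  "(\<And>i. i \<in> {1..n} \<Longrightarrow> square_integrable M (X i)) \<Longrightarrow> square_integrable M (\<lambda>w. avg n (\<lambda>i. X i w))"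
  unfolding avg_def by (intro square_integrable_scaleR square_integrable_sum)

lemma square_integrable_cong:
  assumes "\<And>w. w \<in> space M \<Longrightarrow> X w = Y w"
  shows "square_integrable M X \<longleftrightarrow> square_integrable M Y"
  unfolding square_integrable_def
  using assms by (intro arg_cong2[where f="(\<and>)"] measurable_cong Bochner_Integration.integrable_cong) auto

lemma square_integrable_indicator:
  assumes "square_integrable M X" "B \<in> sets M"
  shows "square_integrable M (\<lambda>w. indicator B w *\<^sub>R X w)"
  by (rule square_integrable_bound[OF square_integrable_norm2[OF assms(1)]])
     (use assms in \<open>auto simp: square_integrable_def indicator_def\<close>)

lemma square_integrable_inner:
  assumes X: "square_integrable M X" and Y: "square_integrable M Y"
  shows "integrable M (\<lambda>w. X w \<bullet> Y w)"
proof (rule Bochner_Integration.integrable_bound)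
  show "integrable M (\<lambda>w. (norm (X w))\<^sup>2 + (norm (Y w))\<^sup>2)"
    using X Y by (simp add: square_integrable_def)
  show "(\<lambda>w. X w \<bullet> Y w) \<in> borel_measurable M"
    using X Y by (auto simp: square_integrable_def)
  show "AE w in M. norm (X w \<bullet> Y w) \<le> norm ((norm (X w))\<^sup>2 + (norm (Y w))\<^sup>2)"
  proof (rule AE_I2)
    fix w
    have "\<bar>X w \<bullet> Y w\<bar> \<le> norm (X w) * norm (Y w)" by (rule Cauchy_Schwarz_ineq2)
    also have "\<dots> \<le> (norm (X w))\<^sup>2 + (norm (Y w))\<^sup>2"
      using sum_squares_bound[of "norm (X w)" "norm (Y w)"]
        mult_nonneg_nonneg[OF norm_ge_zero[of "X w"] norm_ge_zero[of "Y w"]]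
      by linarith
    finally show "norm (X w \<bullet> Y w) \<le> norm ((norm (X w))\<^sup>2 + (norm (Y w))\<^sup>2)" by simp
  qed
qed

lemma (in finite_measure) square_integrable_integrable:
  assumes X: "square_integrable M X"
  shows "integrable M X"
proof (rule Bochner_Integration.integrable_bound)
  show "integrable M (\<lambda>w. 1 + (norm (X w))\<^sup>2)"
    using X by (simp add: square_integrable_def)
  show "X \<in> borel_measurable M" using X by (simp add: square_integrable_def)
  show "AE w in M. norm (X w) \<le> norm (1 + (norm (X w))\<^sup>2)"
  proof (rule AE_I2)
    fix w
    have "0 \<le> (norm (X w) - 1)\<^sup>2" by simp
    then have "2 * norm (X w) \<le> 1 + (norm (X w))\<^sup>2" by (simp add: power2_diff)
    then have "norm (X w) \<le> 1 + (norm (X w))\<^sup>2" using norm_ge_zero[of "X w"] by linarith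
    then show "norm (X w) \<le> norm (1 + (norm (X w))\<^sup>2)" by simp
  qed
qed

lemma integrable_avg:
  fixes X :: "nat \<Rightarrow> 'w \<Rightarrow> real"
  shows "(\<And>i. i \<in> {1..n} \<Longrightarrow> integrable M (X i)) \<Longrightarrow> integrable M (\<lambda>w. avg n (\<lambda>i. X i w))"
  unfolding avg_def by (intro integrable_scaleR_right Bochner_Integration.integrable_sum) auto

lemma integral_avg:
  fixes X :: "nat \<Rightarrow> 'w \<Rightarrow> real"
  shows "(\<And>i. i \<in> {1..n} \<Longrightarrow> integrable M (X i)) \<Longrightarrow>
    (LINT w|M. avg n (\<lambda>i. X i w)) = avg n (\<lambda>i. LINT w|M. X i w)"
  unfolding avg_real by simp

lemma integrable_indicator_mult:
  fixes X :: "'w \<Rightarrow> real"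
  assumes "integrable M X" "B \<in> sets M"
  shows "integrable M (\<lambda>w. indicator B w * X w)"
  using integrable_mult_indicator[OF assms(2,1)] by simp

section \<open>Conditional expectations tested on sets\<close>

lemma (in prob_space) subalgebra_sigma_finite:
  assumes "subalgebra M F"
  shows "sigma_finite_subalgebra M F"
  by (rule finite_measure_subalgebra_is_sigma_finite)
     (simp add: finite_measure_subalgebra_def finite_measure_subalgebra_axioms_def assms finite_measure_axioms)

text \<open>This rule, its converse and the next one reduce conditional statements to integrals over the
  events of \<open>F\<close>, which can be split and estimated term by term.\<close>

lemma (in prob_space) cond_exp_leI:
  assumes F: "subalgebra M F"
    and X: "integrable M X" and Y: "integrable M Y" "Y \<in> borel_measurable F"
    and le: "\<And>B. B \<in> sets F \<Longrightarrow> (LINT w|M. indicator B w * X w) \<le> (LINT w|M. indicator B w * Y w)"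
  shows "cond_exp_le M F X Y"
  unfolding cond_exp_le_def
proof (intro conjI X)
  interpret sigma_finite_subalgebra M F by (rule subalgebra_sigma_finite[OF F])
  define c where "c = real_cond_exp M F X"
  have c: "integrable M c" "c \<in> borel_measurable F"
    unfolding c_def using real_cond_exp_int(1)[OF X] by auto
  \<comment> \<open>Test on the set where the desired inequality fails.\<close>
  define B where "B = {w \<in> space M. c w > Y w}"
  have sp: "space F = space M" using F by (simp add: subalgebra_def)
  have B: "B \<in> sets F" unfolding B_def sp[symmetric] using c(2) Y(2) by measurable
  have BM: "B \<in> sets M" using B F by (auto simp: subalgebra_def)
  have "(LINT w|M. indicator B w * c w) = (LINT w|M. indicator B w * X w)"
    unfolding c_def using real_cond_exp_intA[OF X B] by (simp add: set_lebesgue_integral_def)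
  also have "\<dots> \<le> (LINT w|M. indicator B w * Y w)" by (rule le[OF B])
  finally have "(LINT w|M. indicator B w * (c w - Y w)) \<le> 0"
    using integrable_indicator_mult[OF c(1) BM] integrable_indicator_mult[OF Y(1) BM]
    by (simp add: right_diff_distrib)
  moreover have nn: "0 \<le> indicator B w * (c w - Y w)" for w
    by (auto simp: B_def indicator_def)
  ultimately have "(LINT w|M. indicator B w * (c w - Y w)) = 0"
    by (meson antisym Bochner_Integration.integral_nonneg)
  then have "AE w in M. indicator B w * (c w - Y w) = 0"
    using nn c(1) Y(1) BM
    by (subst (asm) integral_nonneg_eq_0_iff_AE)
       (auto intro: integrable_indicator_mult)
  then show "AE w in M. real_cond_exp M F X w \<le> Y w"
    by (rule AE_mp) (auto simp: B_def c_def indicator_def intro!: AE_I2)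
qed

lemma (in prob_space) cond_exp_leD:
  assumes F: "subalgebra M F" and le: "cond_exp_le M F X Y" and Y: "integrable M Y" and B: "B \<in> sets F"
  shows "(LINT w|M. indicator B w * X w) \<le> (LINT w|M. indicator B w * Y w)"
proof -
  interpret sigma_finite_subalgebra M F by (rule subalgebra_sigma_finite[OF F])
  have X: "integrable M X" and le: "AE w in M. real_cond_exp M F X w \<le> Y w"
    using le by (auto simp: cond_exp_le_def)
  have BM: "B \<in> sets M" using B F by (auto simp: subalgebra_def)
  have "(LINT w|M. indicator B w * X w) = (LINT w|M. indicator B w * real_cond_exp M F X w)"
    using real_cond_exp_intA[OF X B] by (simp add: set_lebesgue_integral_def)
  also have "\<dots> \<le> (LINT w|M. indicator B w * Y w)"
  proof (rule integral_mono_AE)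
    show "AE w in M. indicator B w * real_cond_exp M F X w \<le> indicator B w * Y w"
      using le by (rule AE_mp) (auto intro!: AE_I2 mult_left_mono)
  qed (auto intro!: integrable_indicator_mult BM Y real_cond_exp_int X)
  finally show ?thesis .
qed

lemma (in prob_space) vec_cond_exp_eqI:
  assumes F: "subalgebra M F"
    and X: "integrable M X" and Y: "integrable M Y" "Y \<in> borel_measurable F"
    and eq: "\<And>B b. B \<in> sets F \<Longrightarrow> b \<in> Basis \<Longrightarrow>
      (LINT w|M. indicator B w * (X w \<bullet> b)) = (LINT w|M. indicator B w * (Y w \<bullet> b))"
  shows "AE w in M. vec_cond_exp M F X w = Y w"
proof -
  interpret sigma_finite_subalgebra M F by (rule subalgebra_sigma_finite[OF F])
  have "AE w in M. \<forall>b\<in>Basis. real_cond_exp M F (\<lambda>w. X w \<bullet> b) w = Y w \<bullet> b"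
  proof (rule AE_finite_allI)
    fix b :: 'b assume b: "b \<in> Basis"
    show "AE w in M. real_cond_exp M F (\<lambda>w. X w \<bullet> b) w = Y w \<bullet> b"
      using X Y by (intro real_cond_exp_charact)
        (auto simp: set_lebesgue_integral_def eq[OF _ b])
  qed simp
  then show ?thesis
    by (rule AE_mp) (auto simp: vec_cond_exp_def euclidean_representation intro!: AE_I2)
qed

section \<open>Conditional independence\<close>

text \<open>A variable with vanishing integral over every event \<open>X \<in> A\<close> has conditional expectation
  \<open>0\<close> given \<open>X\<close>, hence is orthogonal to every function of \<open>X\<close>.\<close>

lemma (in prob_space) orthogonal_events_imp_orthogonal_functions:
  fixes Z :: "'a \<Rightarrow> real"
  assumes X: "X \<in> measurable M N" and Z: "integrable M Z"
    and orth: "\<And>A. A \<in> sets N \<Longrightarrow> (LINT w|M. Z w * indicator A (X w)) = 0"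
    and \<phi>: "\<phi> \<in> borel_measurable N" and int: "integrable M (\<lambda>w. \<phi> (X w) * Z w)"
  shows "(LINT w|M. \<phi> (X w) * Z w) = 0"
proof -
  let ?V = "vimage_algebra (space M) X N"
  have XV: "X \<in> space M \<rightarrow> space N" using X by (auto dest: measurable_space)
  have sub: "subalgebra M ?V"
    using X by (auto simp: subalgebra_def sets_vimage_algebra2[OF XV] intro: measurable_sets)
  interpret sigma_finite_subalgebra M ?V by (rule subalgebra_sigma_finite[OF sub])
  have "AE w in M. real_cond_exp M ?V Z w = 0"
  proof (rule real_cond_exp_charact)
    fix B assume "B \<in> sets ?V"
    then obtain A where A: "A \<in> sets N" "B = X -` A \<inter> space M"
      by (auto simp: sets_vimage_algebra2[OF XV])
    have "(LINT w:B|M. Z w) = (LINT w|M. Z w * indicator A (X w))"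
      unfolding set_lebesgue_integral_def A(2)
      by (intro Bochner_Integration.integral_cong) (auto simp: indicator_def)
    then show "(LINT w:B|M. Z w) = (LINT w:B|M. 0)"
      using orth[OF A(1)] by simp
  qed (auto simp: Z)
  then have "(LINT w|M. \<phi> (X w) * real_cond_exp M ?V Z w) = (LINT w|M. 0)"
    using \<phi> X by (intro integral_cong_AE) (auto intro: measurable_from_subalg[OF sub])
  moreover have "(LINT w|M. \<phi> (X w) * real_cond_exp M ?V Z w) = (LINT w|M. \<phi> (X w) * Z w)"
    using int \<phi> Z measurable_vimage_algebra1[OF XV]
    by (intro real_cond_exp_intg(2)) (auto intro: measurable_compose)
  ultimately show ?thesis by simp
qed

text \<open>The sets belonging to the other indices are taken to be \<^const>\<open>UNIV\<close>, so that their
  factors become \<open>1\<close>.\<close>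

lemma (in prob_space) cond_indep_pair:
  assumes F: "subalgebra M F" and I: "finite I" and ij: "i \<in> I" "j \<in> I" "i \<noteq> j"
    and ind: "cond_indep_vars M F I X" and A: "A \<in> sets borel" and A': "A' \<in> sets borel"
  shows "AE w in M. real_cond_exp M F (\<lambda>w. indicator A (X i w) * indicator A' (X j w)) w
      = real_cond_exp M F (\<lambda>w. indicator A (X i w)) w * real_cond_exp M F (\<lambda>w. indicator A' (X j w)) w"
proof -
  interpret sigma_finite_subalgebra M F by (rule subalgebra_sigma_finite[OF F])
  define D where "D = (\<lambda>k. if k = i then A else if k = j then A' else UNIV)"
  have D: "\<forall>k\<in>I. D k \<in> sets borel" using A A' by (simp add: D_def)
  have split: "(\<Prod>k\<in>I. p k) = p i * (p j * (\<Prod>k\<in>I - {i} - {j}. p k))" for p :: "_ \<Rightarrow> real"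
    using I ij by (simp add: prod.remove[of I i] prod.remove[of "I - {i}" j])
  have one: "(\<Prod>k\<in>I - {i} - {j}. indicator (D k) (X k w)) = (1::real)" for w
    by (rule prod.neutral) (auto simp: D_def)
  have "AE w in M. \<forall>k\<in>I - {i} - {j}. real_cond_exp M F (\<lambda>w. indicator (D k) (X k w)) w = 1"
  proof (rule AE_finite_allI)
    fix k assume "k \<in> I - {i} - {j}"
    then have "(\<lambda>w. indicator (D k) (X k w)) = (\<lambda>w. 1 :: real)" by (auto simp: D_def)
    then show "AE w in M. real_cond_exp M F (\<lambda>w. indicator (D k) (X k w)) w = 1"
      using real_cond_exp_F_meas[of "\<lambda>_. 1"] by simp
  qed (use I in simp)
  then have "AE w in M. (\<Prod>k\<in>I - {i} - {j}. real_cond_exp M F (\<lambda>w. indicator (D k) (X k w)) w) = 1"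
    by (rule AE_mp) (auto intro!: AE_I2 prod.neutral)
  moreover have "AE w in M. real_cond_exp M F (\<lambda>w. \<Prod>k\<in>I. indicator (D k) (X k w)) w
      = (\<Prod>k\<in>I. real_cond_exp M F (\<lambda>w. indicator (D k) (X k w)) w)"
    using ind D by (simp add: cond_indep_vars_def)
  ultimately show ?thesis
  proof eventually_elim
    case (elim w)
    then show ?case
      using ij unfolding split one by (simp add: D_def)
  qed
qed

text \<open>Conditionally independent variables are conditionally uncorrelated. The rule is transported
  from indicators to functions in one variable at a time.\<close>

lemma (in prob_space) cond_indep_orthogonal:
  fixes X :: "'i \<Rightarrow> 'a \<Rightarrow> 'b::euclidean_space" and \<phi> \<psi> :: "'b \<Rightarrow> real"
  assumes F: "subalgebra M F" and I: "finite I" and ij: "i \<in> I" "j \<in> I" "i \<noteq> j"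
    and ind: "cond_indep_vars M F I X" and B: "B \<in> sets F"
    and \<phi>: "\<phi> \<in> borel_measurable borel" and \<psi>: "\<psi> \<in> borel_measurable borel"
    and Y: "integrable M (\<lambda>w. \<psi> (X j w))"
  defines "H \<equiv> real_cond_exp M F (\<lambda>w. \<psi> (X j w))"
  assumes int: "integrable M (\<lambda>w. \<phi> (X i w) * (\<psi> (X j w) - H w))"
  shows "(LINT w|M. indicator B w * (\<phi> (X i w) * (\<psi> (X j w) - H w))) = 0"
proof -
  interpret sigma_finite_subalgebra M F by (rule subalgebra_sigma_finite[OF F])
  have X[measurable]: "X i \<in> borel_measurable M" "X j \<in> borel_measurable M"
    using ind ij by (auto simp: cond_indep_vars_def)
  note [measurable] = \<phi> \<psi> B
  have BM[measurable]: "B \<in> sets M" using B F by (auto simp: subalgebra_def)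
  have H: "integrable M H" "H \<in> borel_measurable F"
    unfolding H_def using real_cond_exp_int(1)[OF Y] by auto
  note [measurable] = H(2)
  have ind_int: "integrable M (\<lambda>w. indicator A (X k w) :: real)"
    if "k \<in> {i, j}" "A \<in> sets borel" for k and A :: "'b set"
  proof (rule integrable_const_bound[where B=1])
    have "X k \<in> borel_measurable M" using that X by auto
    then show "(\<lambda>w. indicator A (X k w) :: real) \<in> borel_measurable M"
      using borel_measurable_indicator[OF that(2)] by (rule measurable_compose)
  qed auto
  \<comment> \<open>First let \<open>\<phi>\<close> be the indicator of \<open>A\<close>: \<open>Z = 1\<^sub>B (a - c)\<close> is orthogonal to every event in
    \<open>X j\<close>, hence to \<open>\<psi> (X j)\<close>; since \<open>H\<close> and \<open>c\<close> are conditional expectations, \<open>\<psi> (X j)\<close> may then be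
    exchanged for \<open>H\<close> in the remaining term.\<close>
  have test: "(LINT w|M. indicator B w * (\<psi> (X j w) - H w) * indicator A (X i w)) = 0"
    if A[measurable]: "A \<in> sets borel" for A
  proof -
    define a where "a w = (indicator A (X i w) :: real)" for w
    define c where "c = real_cond_exp M F a"
    have a: "integrable M a" "\<And>w. 0 \<le> a w" "\<And>w. a w \<le> 1"
      unfolding a_def using ind_int[of i A] by (auto simp: indicator_def)
    have am[measurable]: "a \<in> borel_measurable M" using a(1) by simp
    have c: "integrable M c" "c \<in> borel_measurable F"
      unfolding c_def using real_cond_exp_int(1)[OF a(1)] by auto
    note [measurable] = c(2)
    have cM[measurable]: "c \<in> borel_measurable M" using c(1) by simp
    have HM[measurable]: "H \<in> borel_measurable M" using H(1) by simp
    have cb: "AE w in M. norm (c w) \<le> 1"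
    proof -
      have "AE w in M. 0 \<le> c w" unfolding c_def using a by (intro real_cond_exp_pos) auto
      moreover have "AE w in M. c w \<le> 1" unfolding c_def using a by (intro real_cond_exp_le_c) auto
      ultimately show ?thesis by eventually_elim simp
    qed
    have bounded_mult: "integrable M (\<lambda>w. u w * U w)"
      if U: "integrable M U" and u: "u \<in> borel_measurable M" "AE w in M. norm (u w) \<le> 2" for u U :: "'a \<Rightarrow> real"
    proof (rule Bochner_Integration.integrable_bound[of M "\<lambda>w. 2 * U w"])
      show "AE w in M. norm (u w * U w) \<le> norm (2 * U w)"
        using u(2)
      proof eventually_elim
        case (elim w)
        show ?case using mult_right_mono[OF elim norm_ge_zero[of "U w"]] by (simp add: abs_mult)
      qed
      show "integrable M (\<lambda>w. 2 * U w)" using U by simp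
      show "(\<lambda>w. u w * U w) \<in> borel_measurable M"
        using u(1) U by (intro borel_measurable_times) auto
    qed
    have ab: "AE w in M. norm (a w) \<le> 2"
    proof (rule AE_I2)
      show "norm (a w) \<le> 2" for w using a(2)[of w] a(3)[of w] by simp
    qed
    have cb2: "AE w in M. norm (c w) \<le> 2" using cb by eventually_elim simp
    define Z where "Z w = indicator B w * (a w - c w)" for w
    have Zm: "Z \<in> borel_measurable M" unfolding Z_def by measurable
    have Zb: "AE w in M. norm (Z w) \<le> 2"
      using cb
    proof eventually_elim
      case (elim w)
      then show ?case using a(2,3)[of w] by (auto simp: Z_def indicator_def abs_le_iff)
    qed
    have Zi: "integrable M Z" using bounded_mult[OF _ Zm Zb, of "\<lambda>_. 1"] by simp
    have "(LINT w|M. \<psi> (X j w) * Z w) = 0"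
    proof (rule orthogonal_events_imp_orthogonal_functions[OF X(2) Zi _ \<psi>])
      fix A' :: "'b set" assume A'[measurable]: "A' \<in> sets borel"
      define a' where "a' w = (indicator A' (X j w) :: real)" for w
      have a': "integrable M a'" "\<And>w. 0 \<le> a' w" "\<And>w. a' w \<le> 1"
        unfolding a'_def using ind_int[of j A'] by (auto simp: indicator_def)
      have a'm[measurable]: "a' \<in> borel_measurable M" using a'(1) by simp
      have aa': "integrable M (\<lambda>w. a w * a' w)"
        by (rule bounded_mult[OF a'(1)]) (use am ab in auto)
      have ca': "integrable M (\<lambda>w. c w * a' w)"
        by (rule bounded_mult[OF a'(1)]) (use cM cb2 in auto)
      have "(LINT w|M. indicator B w * (a w * a' w)) = (LINT w|M. indicator B w * real_cond_exp M F (\<lambda>w. a w * a' w) w)"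
        using real_cond_exp_intA[OF aa' B] by (simp add: set_lebesgue_integral_def)
      also have "\<dots> = (LINT w|M. (indicator B w * c w) * real_cond_exp M F a' w)"
      proof (rule integral_cong_AE)
        show "AE w in M. indicator B w * real_cond_exp M F (\<lambda>w. a w * a' w) w
            = (indicator B w * c w) * real_cond_exp M F a' w"
          using cond_indep_pair[OF F I ij ind A A']
          unfolding a_def[symmetric] a'_def[symmetric] c_def by eventually_elim simp
      qed measurable
      also have "\<dots> = (LINT w|M. (indicator B w * c w) * a' w)"
        by (rule real_cond_exp_intg(2))
           (use integrable_indicator_mult[OF ca' BM] in \<open>auto simp: mult.assoc\<close>)
      finally have "(LINT w|M. indicator B w * (a w * a' w)) = (LINT w|M. indicator B w * (c w * a' w))"
        by (simp add: mult.assoc)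
      then have "(LINT w|M. indicator B w * (a w * a' w) - indicator B w * (c w * a' w)) = 0"
        using integrable_indicator_mult[OF aa' BM] integrable_indicator_mult[OF ca' BM] by simp
      then show "(LINT w|M. Z w * indicator A' (X j w)) = 0"
        unfolding Z_def a'_def[symmetric] by (simp add: algebra_simps)
    next
      show "integrable M (\<lambda>w. \<psi> (X j w) * Z w)"
        using bounded_mult[OF Y Zm Zb] by (simp add: mult.commute)
    qed
    moreover have aY: "integrable M (\<lambda>w. a w * \<psi> (X j w))"
      by (rule bounded_mult[OF Y]) (use am ab in auto)
    moreover have cY: "integrable M (\<lambda>w. c w * \<psi> (X j w))"
      by (rule bounded_mult[OF Y]) (use cM cb2 in auto)
    moreover have aH: "integrable M (\<lambda>w. a w * H w)"
      by (rule bounded_mult[OF H(1)]) (use am ab in auto)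
    moreover have cH: "integrable M (\<lambda>w. c w * H w)"
      by (rule bounded_mult[OF H(1)]) (use cM cb2 in auto)
    moreover have "(LINT w|M. (indicator B w * c w) * H w) = (LINT w|M. (indicator B w * c w) * \<psi> (X j w))"
      unfolding H_def
      by (rule real_cond_exp_intg(2))
         (use integrable_indicator_mult[OF cY BM] Y in \<open>auto simp: mult.assoc\<close>)
    moreover have "(LINT w|M. (indicator B w * H w) * c w) = (LINT w|M. (indicator B w * H w) * a w)"
      unfolding c_def
      by (rule real_cond_exp_intg(2))
         (use integrable_indicator_mult[OF aH BM] in \<open>auto simp: mult_ac\<close>)
    moreover have "(LINT w|M. \<psi> (X j w) * Z w)
        = (LINT w|M. indicator B w * (a w * \<psi> (X j w)) - indicator B w * (c w * \<psi> (X j w)))"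
      unfolding Z_def by (simp add: algebra_simps)
    moreover have "(LINT w|M. indicator B w * (\<psi> (X j w) - H w) * indicator A (X i w))
        = (LINT w|M. indicator B w * (a w * \<psi> (X j w)) - indicator B w * (a w * H w))"
      unfolding a_def by (simp add: algebra_simps)
    ultimately show ?thesis
      using integrable_indicator_mult[OF aY BM] integrable_indicator_mult[OF cY BM]
        integrable_indicator_mult[OF aH BM] integrable_indicator_mult[OF cH BM]
      by (simp add: mult_ac)
  qed
  have "(LINT w|M. \<phi> (X i w) * (indicator B w * (\<psi> (X j w) - H w))) = 0"
  proof (rule orthogonal_events_imp_orthogonal_functions[OF X(1) _ test \<phi>])
    show "integrable M (\<lambda>w. indicator B w * (\<psi> (X j w) - H w))"
      using Y H BM by (intro integrable_indicator_mult) auto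
    show "integrable M (\<lambda>w. \<phi> (X i w) * (indicator B w * (\<psi> (X j w) - H w)))"
      using integrable_indicator_mult[OF int BM] by (simp add: mult_ac)
  qed
  then show ?thesis by (simp add: mult_ac)
qed

section \<open>Fresh randomness\<close>

text \<open>A seed \<open>Z\<close> that is independent of \<open>G\<close> can be integrated out while the \<open>G\<close>-measurable
  argument \<open>Y\<close> is held fixed. The event \<open>B\<close> is absorbed into the argument by carrying its
  indicator as a second component of \<open>Y\<close>, so that Fubini on the product law suffices.\<close>

lemma (in prob_space) fresh_seed_integral_le:
  fixes \<phi> :: "'s \<Rightarrow> 'y \<Rightarrow> real"
  assumes G: "subalgebra M G" and Z: "Z \<in> measurable M S" and law: "distr M S Z = S"
    and ind: "\<And>A B. A \<in> sets (vimage_algebra (space M) Z S) \<Longrightarrow> B \<in> sets G \<Longrightarrow> prob (A \<inter> B) = prob A * prob B"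
    and Y: "Y \<in> measurable G N"
    and \<phi>: "(\<lambda>(s, y). \<phi> s y) \<in> borel_measurable (S \<Otimes>\<^sub>M N)" and \<phi>0: "\<And>s y. 0 \<le> \<phi> s y"
    and le: "\<And>y. integrable S (\<lambda>s. \<phi> s y) \<and> (LINT s|S. \<phi> s y) \<le> \<psi> y"
    and \<psi>: "\<psi> \<in> borel_measurable N" and int: "integrable M (\<lambda>w. \<psi> (Y w))"
  shows "integrable M (\<lambda>w. \<phi> (Z w) (Y w))"
    and "B \<in> sets G \<Longrightarrow> (LINT w|M. indicator B w * \<phi> (Z w) (Y w)) \<le> (LINT w|M. indicator B w * \<psi> (Y w))"
proof -
  have \<psi>0: "0 \<le> \<psi> y" for y
    using le[of y] \<phi>0 by (meson Bochner_Integration.integral_nonneg order_trans)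
  note [measurable] = \<phi> \<psi> Z
  have YM[measurable]: "Y \<in> measurable M N" using measurable_from_subalg[OF G Y] .
  have \<phi>M[measurable]: "(\<lambda>w. \<phi> (Z w) (Y w)) \<in> borel_measurable M"
    using measurable_compose[of "\<lambda>w. (Z w, Y w)" M "S \<Otimes>\<^sub>M N" "\<lambda>(s, y). \<phi> s y" borel] by simp
  have S: "prob_space S" using prob_space_distr[OF Z] law by simp
  have sp: "space G = space M" using G by (simp add: subalgebra_def)
  have nn: "(\<integral>\<^sup>+ w. ennreal (indicator B w * \<phi> (Z w) (Y w)) \<partial>M) \<le> (\<integral>\<^sup>+ w. ennreal (indicator B w * \<psi> (Y w)) \<partial>M)"
    if B: "B \<in> sets G" for B
  proof -
    have BM[measurable]: "B \<in> sets M" using B G by (auto simp: subalgebra_def)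
    let ?N = "N \<Otimes>\<^sub>M (borel :: real measure)"
    define P where "P w = (Y w, indicator B w :: real)" for w
    have PG: "P \<in> measurable G ?N" unfolding P_def using Y B by measurable
    have PM[measurable]: "P \<in> measurable M ?N" by (rule measurable_from_subalg[OF G PG])
    have joint: "S \<Otimes>\<^sub>M distr M ?N P = distr M (S \<Otimes>\<^sub>M ?N) (\<lambda>w. (Z w, P w))"
    proof (rule pair_measure_eqI)
      fix A D assume A: "A \<in> sets S" and D: "D \<in> sets (distr M ?N P)"
      have ZA: "Z -` A \<inter> space M \<in> sets (vimage_algebra (space M) Z S)"
        by (rule in_vimage_algebra[OF A])
      have PD: "P -` D \<inter> space M \<in> sets G"
        using measurable_sets[OF PG, of D] D by (simp add: sp)
      have "emeasure S A = prob (Z -` A \<inter> space M)"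
        by (subst law[symmetric]) (simp add: emeasure_distr A emeasure_eq_measure)
      moreover have "emeasure (distr M ?N P) D = prob (P -` D \<inter> space M)"
        using D by (simp add: emeasure_distr emeasure_eq_measure)
      moreover have "emeasure (distr M (S \<Otimes>\<^sub>M ?N) (\<lambda>w. (Z w, P w))) (A \<times> D)
          = prob ((Z -` A \<inter> space M) \<inter> (P -` D \<inter> space M))"
        using A D by (subst emeasure_distr) (auto simp: emeasure_eq_measure intro!: arg_cong[where f=prob])
      ultimately show "emeasure S A * emeasure (distr M ?N P) D
          = emeasure (distr M (S \<Otimes>\<^sub>M ?N) (\<lambda>w. (Z w, P w))) (A \<times> D)"
        by (simp add: ind[OF ZA PD] ennreal_mult)
    qed (use S prob_space_distr[OF PM] in \<open>auto simp: prob_space_imp_sigma_finite cong: sets_pair_measure_cong\<close>)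
    interpret D: prob_space "distr M ?N P" by (rule prob_space_distr[OF PM])
    interpret SS: prob_space S by (rule S)
    interpret pair_sigma_finite S "distr M ?N P" ..
    define f where "f = (\<lambda>q. ennreal (snd (snd q) * \<phi> (fst q) (fst (snd q))))"
    have f[measurable]: "f \<in> borel_measurable (S \<Otimes>\<^sub>M ?N)"
      unfolding f_def
      using measurable_compose[of "\<lambda>q. (fst q, fst (snd q))" "S \<Otimes>\<^sub>M ?N" "S \<Otimes>\<^sub>M N" "\<lambda>(s, y). \<phi> s y" borel]
      by simp
    have "(\<integral>\<^sup>+ w. ennreal (indicator B w * \<phi> (Z w) (Y w)) \<partial>M) = (\<integral>\<^sup>+ w. f (Z w, P w) \<partial>M)"
      by (simp add: f_def P_def)
    also have "\<dots> = (\<integral>\<^sup>+ q. f q \<partial>distr M (S \<Otimes>\<^sub>M ?N) (\<lambda>w. (Z w, P w)))"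
      by (subst nn_integral_distr) auto
    also have "\<dots> = (\<integral>\<^sup>+ q. f q \<partial>(S \<Otimes>\<^sub>M distr M ?N P))"
      by (simp add: joint)
    also have "\<dots> = (\<integral>\<^sup>+ p. (\<integral>\<^sup>+ s. f (s, p) \<partial>S) \<partial>distr M ?N P)"
    proof -
      have "f \<in> borel_measurable (S \<Otimes>\<^sub>M distr M ?N P)"
        using f by (simp cong: measurable_cong_sets sets_pair_measure_cong)
      then show ?thesis by (simp add: nn_integral_snd)
    qed
    also have "\<dots> = (\<integral>\<^sup>+ w. (\<integral>\<^sup>+ s. f (s, P w) \<partial>S) \<partial>M)"
      by (subst nn_integral_distr) auto
    also have "\<dots> \<le> (\<integral>\<^sup>+ w. ennreal (indicator B w * \<psi> (Y w)) \<partial>M)"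
    proof (rule nn_integral_mono)
      fix w
      have "(\<integral>\<^sup>+ s. f (s, P w) \<partial>S) = ennreal (LINT s|S. indicator B w * \<phi> s (Y w))"
        unfolding f_def P_def fst_conv snd_conv
        using le[of "Y w"] \<phi>0 by (intro nn_integral_eq_integral) auto
      also have "\<dots> \<le> ennreal (indicator B w * \<psi> (Y w))"
        using le[of "Y w"] by (intro ennreal_leI) (auto simp: indicator_def)
      finally show "(\<integral>\<^sup>+ s. f (s, P w) \<partial>S) \<le> ennreal (indicator B w * \<psi> (Y w))" .
    qed
    finally show ?thesis .
  qed
  show *: "integrable M (\<lambda>w. \<phi> (Z w) (Y w))"
  proof (rule integrableI_bounded)
    have "(\<integral>\<^sup>+ w. ennreal (norm (\<phi> (Z w) (Y w))) \<partial>M)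
        = (\<integral>\<^sup>+ w. ennreal (indicator (space M) w * \<phi> (Z w) (Y w)) \<partial>M)"
      by (intro nn_integral_cong) (simp add: \<phi>0)
    also have "\<dots> \<le> (\<integral>\<^sup>+ w. ennreal (indicator (space M) w * \<psi> (Y w)) \<partial>M)"
      by (rule nn) (simp add: sp[symmetric])
    also have "\<dots> = (\<integral>\<^sup>+ w. ennreal (\<psi> (Y w)) \<partial>M)" by (intro nn_integral_cong) simp
    also have "\<dots> < \<infinity>"
      using int \<psi>0 by (simp add: nn_integral_eq_integral)
    finally show "(\<integral>\<^sup>+ w. ennreal (norm (\<phi> (Z w) (Y w))) \<partial>M) < \<infinity>" .
  qed simp
  show "(LINT w|M. indicator B w * \<phi> (Z w) (Y w)) \<le> (LINT w|M. indicator B w * \<psi> (Y w))"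
    if B: "B \<in> sets G"
  proof -
    have BM: "B \<in> sets M" using B G by (auto simp: subalgebra_def)
    have "ennreal (LINT w|M. indicator B w * \<phi> (Z w) (Y w)) \<le> ennreal (LINT w|M. indicator B w * \<psi> (Y w))"
      using nn[OF B] \<phi>0 \<psi>0 integrable_indicator_mult[OF * BM] integrable_indicator_mult[OF int BM]
      by (simp add: nn_integral_eq_integral)
    then show ?thesis using \<psi>0 by (simp add: ennreal_le_iff)
  qed
qed

section \<open>Weighted sums\<close>

lemma wgt_pos: "\<eta> < 1 \<Longrightarrow> 0 < wgt \<eta> k"
  by (simp add: wgt_def)

lemma wgt_0: "\<eta> < 1 \<Longrightarrow> (1 - \<eta>) * wgt \<eta> 0 = 1"
  by (simp add: wgt_def)

lemma wgt_Suc: "\<eta> < 1 \<Longrightarrow> (1 - \<eta>) * wgt \<eta> (Suc k) = wgt \<eta> k"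
  by (simp add: wgt_def)

text \<open>Since \<open>(1 - \<eta>) w\<^sub>k\<^sub>+\<^sub>1 = w\<^sub>k\<close>, a weighted recursion shifts the index for the price of a factor
  \<open>1 - \<eta>\<close>; what remains of the contraction is \<open>1 - \<eta> - q\<close>.\<close>

lemma weighted_sum_recursion:
  fixes a b :: "nat \<Rightarrow> real"
  assumes \<eta>: "\<eta> < 1" and q: "0 \<le> q" and a: "\<And>k. 0 \<le> a k" and b: "\<And>k. 0 \<le> b k"
    and step: "\<And>k. a (Suc k) \<le> q * a k + b k"
  shows "(1 - \<eta> - q) * (\<Sum>k=0..K. wgt \<eta> k * a k) \<le> a 0 + (\<Sum>k=0..K. wgt \<eta> k * b k)"
proof -
  \<comment> \<open>The extra term dominates the next summand and makes the induction close.\<close>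
  have "(1 - \<eta>) * (\<Sum>k=0..K. wgt \<eta> k * a k) + wgt \<eta> K * (q * a K + b K)
      \<le> a 0 + q * (\<Sum>k=0..K. wgt \<eta> k * a k) + (\<Sum>k=0..K. wgt \<eta> k * b k)"
  proof (induction K)
    case 0
    have "(1 - \<eta>) * (wgt \<eta> 0 * a 0) = a 0" using wgt_0[OF \<eta>] by (metis mult.assoc mult_1)
    then show ?case by (simp add: algebra_simps)
  next
    case (Suc K)
    have "(1 - \<eta>) * (wgt \<eta> (Suc K) * a (Suc K)) = wgt \<eta> K * a (Suc K)"
      using wgt_Suc[OF \<eta>, of K] by (metis mult.assoc)
    also have "\<dots> \<le> wgt \<eta> K * (q * a K + b K)"
      using wgt_pos[OF \<eta>, of K] by (intro mult_left_mono step) simp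
    finally show ?case using Suc by (simp add: algebra_simps)
  qed
  moreover have "0 \<le> wgt \<eta> K * (q * a K + b K)"
    using wgt_pos[OF \<eta>, of K] q a[of K] b[of K] by simp
  ultimately show ?thesis by (simp add: algebra_simps)
qed

lemma weighted_telescope:
  fixes A p :: "nat \<Rightarrow> real"
  assumes \<eta>: "\<eta> < 1" and A: "\<And>k. 0 \<le> A k" and step: "\<And>k. A (Suc k) \<le> (1 - \<eta>) * A k - p k"
  shows "(\<Sum>k=0..K. wgt \<eta> k * p k) \<le> A 0"
proof -
  have "(\<Sum>k=0..K. wgt \<eta> k * p k) + wgt \<eta> K * A (Suc K) \<le> A 0"
  proof (induction K)
    case 0
    have "wgt \<eta> 0 * (p 0 + A (Suc 0)) \<le> wgt \<eta> 0 * ((1 - \<eta>) * A 0)"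
      using wgt_pos[OF \<eta>, of 0] step[of 0] by (intro mult_left_mono) auto
    also have "\<dots> = A 0" using wgt_0[OF \<eta>] by (metis mult.commute mult.left_commute mult_1)
    finally show ?case by (simp add: algebra_simps)
  next
    case (Suc K)
    have "wgt \<eta> (Suc K) * (p (Suc K) + A (Suc (Suc K))) \<le> wgt \<eta> (Suc K) * ((1 - \<eta>) * A (Suc K))"
      using wgt_pos[OF \<eta>, of "Suc K"] step[of "Suc K"] by (intro mult_left_mono) auto
    also have "\<dots> = wgt \<eta> K * A (Suc K)" using wgt_Suc[OF \<eta>, of K] by (metis mult.commute mult.left_commute)
    finally show ?case using Suc by (simp add: algebra_simps)
  qed
  moreover have "0 \<le> wgt \<eta> K * A (Suc K)" using wgt_pos[OF \<eta>, of K] A[of "Suc K"] by simp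
  ultimately show ?thesis by simp
qed

section \<open>Measurability and integrability of the iterates\<close>

locale ec_sgd_diana_convex = ec_sgd_diana M n fi \<gamma> \<alpha> D1i S C sC R Q sQ x0 h0 gh x e h g v
  for M :: "'w measure" and n :: nat
    and fi :: "nat \<Rightarrow> 'a::euclidean_space \<Rightarrow> real"
    and \<gamma> \<alpha> :: real and D1i :: "nat \<Rightarrow> real"
    and S :: "'s measure" and C :: "'s \<Rightarrow> 'a \<Rightarrow> 'a" and sC :: "nat \<Rightarrow> nat \<Rightarrow> 'w \<Rightarrow> 's"
    and R :: "'r measure" and Q :: "'r \<Rightarrow> 'a \<Rightarrow> 'a" and sQ :: "nat \<Rightarrow> nat \<Rightarrow> 'w \<Rightarrow> 'r"
    and x0 :: 'a and h0 :: "nat \<Rightarrow> 'a"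
    and gh :: "nat \<Rightarrow> nat \<Rightarrow> 'w \<Rightarrow> 'a" and x :: "nat \<Rightarrow> 'w \<Rightarrow> 'a"
    and e h g v :: "nat \<Rightarrow> nat \<Rightarrow> 'w \<Rightarrow> 'a" +
  fixes xs :: 'a and L \<mu> \<delta> \<omega> :: real
  assumes n_pos: "1 \<le> n" and L_pos: "0 < L" and \<mu>_nonneg: "0 \<le> \<mu>"
    and convex_fi: "\<And>i. i \<in> {1..n} \<Longrightarrow> convex_on UNIV (fi i)"
    and smooth_fi: "\<And>i. i \<in> {1..n} \<Longrightarrow> smooth L (fi i)"
    and quasi_convex: "quasi_strongly_convex \<mu> (\<lambda>y. avg n (\<lambda>i. fi i y)) xs"
    and compression: "compression_operator S \<delta> C"
    and quantization: "quantization_operator R \<omega> Q"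
    and \<gamma>_pos: "0 < \<gamma>"
    and \<gamma>_le: "\<gamma> \<le> min (1 / (4 * L)) (\<delta> * sqrt (1 - \<alpha>) / (8 * L * sqrt (6 * (3 - \<alpha>))))"
    and \<alpha>_pos: "0 < \<alpha>" and \<alpha>_le: "\<alpha> \<le> 1 / (\<omega> + 1)"
begin

definition f :: "'a \<Rightarrow> real" where "f y = avg n (\<lambda>i. fi i y)"

text \<open>\<open>pre k\<close> contains the arguments to which \<open>C\<close> and \<open>Q\<close> are applied in iteration \<open>k\<close> and is
  independent of the seeds used there.\<close>

abbreviation pre :: "nat \<Rightarrow> 'w measure" where "pre k \<equiv> past M n gh S sC R sQ (Suc k) k"

abbreviation hist :: "nat \<Rightarrow> 'w measure" where "hist k \<equiv> history M n gh S sC R sQ k"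

definition gap :: "nat \<Rightarrow> 'w \<Rightarrow> real" where "gap k w = f (x k w) - f xs"

definition G :: "nat \<Rightarrow> nat \<Rightarrow> 'w \<Rightarrow> 'a" where "G i k w = grad (fi i) (x k w)"

definition noise :: "nat \<Rightarrow> nat \<Rightarrow> 'w \<Rightarrow> 'a" where "noise i k w = gh i k w - G i k w"

text \<open>The limit that \<open>h i\<close> is meant to learn.\<close>

definition hs :: "nat \<Rightarrow> 'a" where "hs i = grad (fi i) xs"

lemma gh_measurable [measurable]: "i \<in> {1..n} \<Longrightarrow> gh i k \<in> borel_measurable M"
  using gh_integrable by auto

lemma space_past [simp]: "space (past M n gh S sC R sQ j k) = space M"
  by (simp add: past_def space_measure_of_conv)

lemma space_in_past: "space M \<in> sets (past M n gh S sC R sQ j k)"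
  using sets.top[of "past M n gh S sC R sQ j k"] unfolding space_past .

lemma sets_past:
  "sets (past M n gh S sC R sQ j k) = sigma_sets (space M)
     (\<Union>i\<in>{1..n}. (\<Union>l<j. sets (vimage_algebra (space M) (gh i l) borel)) \<union>
                  (\<Union>l<k. sets (vimage_algebra (space M) (sC i l) S)) \<union>
                  (\<Union>l<k. sets (vimage_algebra (space M) (sQ i l) R)))"
  unfolding past_def
proof (intro sets_measure_of UN_least Un_least)
  fix i l
  show "sets (vimage_algebra (space M) (gh i l) borel) \<subseteq> Pow (space M)"
    using sets.space_closed[of "vimage_algebra (space M) (gh i l) borel"] by simp
  show "sets (vimage_algebra (space M) (sC i l) S) \<subseteq> Pow (space M)"
    using sets.space_closed[of "vimage_algebra (space M) (sC i l) S"] by simp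
  show "sets (vimage_algebra (space M) (sQ i l) R) \<subseteq> Pow (space M)"
    using sets.space_closed[of "vimage_algebra (space M) (sQ i l) R"] by simp
qed

lemma subalgebra_past: "subalgebra M (past M n gh S sC R sQ j k)"
  unfolding subalgebra_def sets_past space_past
proof (intro conjI refl sets.sigma_sets_subset UN_least Un_least)
  fix i l assume i: "i \<in> {1..n}"
  show "sets (vimage_algebra (space M) (gh i l) borel) \<subseteq> events"
    using i by (intro sets_image_in_sets gh_measurable) auto
  show "sets (vimage_algebra (space M) (sC i l) S) \<subseteq> events"
    using sC_law[OF i] by (intro sets_image_in_sets) auto
  show "sets (vimage_algebra (space M) (sQ i l) R) \<subseteq> events"
    using sQ_law[OF i] by (intro sets_image_in_sets) auto
qed

lemma subalgebra_past_mono: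
  assumes "j \<le> j'" "k \<le> k'"
  shows "subalgebra (past M n gh S sC R sQ j' k') (past M n gh S sC R sQ j k)"
  unfolding subalgebra_def sets_past space_past
proof (intro conjI refl sigma_sets_mono' UN_least Un_least)
  fix i l assume i: "i \<in> {1..n}"
  let ?gens = "\<Union>i\<in>{1..n}. (\<Union>l<j'. sets (vimage_algebra (space M) (gh i l) borel)) \<union>
      (\<Union>l<k'. sets (vimage_algebra (space M) (sC i l) S)) \<union>
      (\<Union>l<k'. sets (vimage_algebra (space M) (sQ i l) R))"
  show "sets (vimage_algebra (space M) (gh i l) borel) \<subseteq> ?gens" if "l \<in> {..<j}"
  proof -
    have "l \<in> {..<j'}" using that assms by simp
    then show ?thesis using i by blast
  qed
  show "sets (vimage_algebra (space M) (sC i l) S) \<subseteq> ?gens" if "l \<in> {..<k}"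
  proof -
    have "l \<in> {..<k'}" using that assms by simp
    then show ?thesis using i by blast
  qed
  show "sets (vimage_algebra (space M) (sQ i l) R) \<subseteq> ?gens" if "l \<in> {..<k}"
  proof -
    have "l \<in> {..<k'}" using that assms by simp
    then show ?thesis using i by blast
  qed
qed

lemma hist_pre: "X \<in> measurable (hist k) N \<Longrightarrow> X \<in> measurable (pre k) N"
  by (rule measurable_from_subalg[OF subalgebra_past_mono]) simp_all

lemma pre_hist: "X \<in> measurable (pre k) N \<Longrightarrow> X \<in> measurable (hist (Suc k)) N"
  by (rule measurable_from_subalg[OF subalgebra_past_mono]) simp_all

lemma sets_hist_pre: "B \<in> sets (hist k) \<Longrightarrow> B \<in> sets (pre k)"
  using subalgebra_past_mono[of k "Suc k" k k] by (auto simp: subalgebra_def)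

lemma sets_hist_M: "B \<in> sets (hist k) \<Longrightarrow> B \<in> sets M"
  using subalgebra_past by (auto simp: subalgebra_def)

lemma hist_M: "X \<in> measurable (hist k) N \<Longrightarrow> X \<in> measurable M N"
  by (rule measurable_from_subalg[OF subalgebra_past])

lemma measurable_pastI:
  assumes X: "X \<in> measurable M N"
    and sub: "\<And>B. B \<in> sets (vimage_algebra (space M) X N) \<Longrightarrow> B \<in> sets (past M n gh S sC R sQ j k)"
  shows "X \<in> measurable (past M n gh S sC R sQ j k) N"
  using X by (intro measurableI sub) (auto dest: measurable_space intro: in_vimage_algebra)

lemma gh_measurable_pre:
  assumes i: "i \<in> {1..n}"
  shows "gh i k \<in> borel_measurable (pre k)"
proof (rule measurable_pastI[OF gh_measurable[OF i]])
  fix B assume "B \<in> sets (vimage_algebra (space M) (gh i k) borel)"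
  then show "B \<in> sets (pre k)" unfolding sets_past using i by (intro sigma_sets.Basic) blast
qed

lemma sC_measurable_hist:
  assumes i: "i \<in> {1..n}"
  shows "sC i k \<in> measurable (hist (Suc k)) S"
proof (rule measurable_pastI)
  show "sC i k \<in> measurable M S" using sC_law[OF i] by blast
  fix B assume "B \<in> sets (vimage_algebra (space M) (sC i k) S)"
  then show "B \<in> sets (hist (Suc k))" unfolding sets_past using i by (intro sigma_sets.Basic) blast
qed

lemma sQ_measurable_hist:
  assumes i: "i \<in> {1..n}"
  shows "sQ i k \<in> measurable (hist (Suc k)) R"
proof (rule measurable_pastI)
  show "sQ i k \<in> measurable M R" using sQ_law[OF i] by blast
  fix B assume "B \<in> sets (vimage_algebra (space M) (sQ i k) R)"
  then show "B \<in> sets (hist (Suc k))" unfolding sets_past using i by (intro sigma_sets.Basic) blast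
qed

lemma avg_measurable:
  fixes u :: "nat \<Rightarrow> 'w \<Rightarrow> 'b::euclidean_space"
  assumes "\<And>i. i \<in> {1..n} \<Longrightarrow> u i \<in> borel_measurable N"
  shows "(\<lambda>w. avg n (\<lambda>i. u i w)) \<in> borel_measurable N"
  unfolding avg_def using assms by (intro borel_measurable_scaleR borel_measurable_sum) auto

lemma C_measurable: "(\<lambda>(s, y). C s y) \<in> borel_measurable (S \<Otimes>\<^sub>M borel)"
  and Q_measurable: "(\<lambda>(s, y). Q s y) \<in> borel_measurable (R \<Otimes>\<^sub>M borel)"
  using compression quantization by (auto simp: compression_operator_def quantization_operator_def)

lemma compose_C:
  assumes "X \<in> measurable N S" "Y \<in> borel_measurable N"
  shows "(\<lambda>w. C (X w) (Y w)) \<in> borel_measurable N"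
  using measurable_compose[OF measurable_Pair[OF assms] C_measurable] by simp

lemma compose_Q:
  assumes "X \<in> measurable N R" "Y \<in> borel_measurable N"
  shows "(\<lambda>w. Q (X w) (Y w)) \<in> borel_measurable N"
  using measurable_compose[OF measurable_Pair[OF assms] Q_measurable] by simp

lemma g_measurable_preI:
  assumes "\<And>i. i \<in> {1..n} \<Longrightarrow> h i k \<in> borel_measurable (hist k)" and i: "i \<in> {1..n}"
  shows "g i k \<in> borel_measurable (pre k)"
proof -
  have "(\<lambda>w. gh i k w - h i k w + avg n (\<lambda>j. h j k w)) \<in> borel_measurable (pre k)"
    using i assms by (intro borel_measurable_add borel_measurable_diff gh_measurable_pre hist_pre avg_measurable)
  then show ?thesis
    by (subst measurable_cong[where g="\<lambda>w. gh i k w - h i k w + avg n (\<lambda>j. h j k w)"]) (auto simp: g_step[OF i])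
qed

lemma iterates_measurable:
  "x k \<in> borel_measurable (hist k) \<and>
   (\<forall>i\<in>{1..n}. e i k \<in> borel_measurable (hist k) \<and> h i k \<in> borel_measurable (hist k))"
proof (induction k)
  case 0
  have "x 0 \<in> borel_measurable (hist 0)"
    by (subst measurable_cong[where g="\<lambda>_. x0"]) (auto simp: x_init)
  moreover have "e i 0 \<in> borel_measurable (hist 0)" if "i \<in> {1..n}" for i
    by (subst measurable_cong[where g="\<lambda>_. 0"]) (use that in \<open>auto simp: e_init\<close>)
  moreover have "h i 0 \<in> borel_measurable (hist 0)" if "i \<in> {1..n}" for i
    by (subst measurable_cong[where g="\<lambda>_. h0 i"]) (use that in \<open>auto simp: h_init\<close>)
  ultimately show ?case by blast
next
  case (Suc k)
  let ?H = "hist (Suc k)"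
  have up: "X \<in> borel_measurable ?H" if "X \<in> borel_measurable (hist k)" for X :: "'w \<Rightarrow> 'a"
    using that hist_pre pre_hist by blast
  have g: "g i k \<in> borel_measurable ?H" if "i \<in> {1..n}" for i
    using Suc that by (intro pre_hist g_measurable_preI) auto
  have v: "v i k \<in> borel_measurable ?H" if i: "i \<in> {1..n}" for i
  proof -
    have "(\<lambda>w. C (sC i k w) (e i k w + \<gamma> *\<^sub>R g i k w)) \<in> borel_measurable ?H"
      using i Suc by (intro compose_C sC_measurable_hist borel_measurable_add borel_measurable_scaleR g up) auto
    then show ?thesis
      by (subst measurable_cong[where g="\<lambda>w. C (sC i k w) (e i k w + \<gamma> *\<^sub>R g i k w)"]) (auto simp: v_step[OF i])
  qed
  have "x (Suc k) \<in> borel_measurable ?H"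
  proof -
    have "(\<lambda>w. x k w - avg n (\<lambda>i. v i k w)) \<in> borel_measurable ?H"
      using Suc by (intro borel_measurable_diff avg_measurable v up) auto
    then show ?thesis
      by (subst measurable_cong[where g="\<lambda>w. x k w - avg n (\<lambda>i. v i k w)"]) (auto simp: x_step)
  qed
  moreover have "e i (Suc k) \<in> borel_measurable ?H" if i: "i \<in> {1..n}" for i
  proof -
    have "(\<lambda>w. e i k w + \<gamma> *\<^sub>R g i k w - v i k w) \<in> borel_measurable ?H"
      using i Suc by (intro borel_measurable_diff borel_measurable_add borel_measurable_scaleR g v up) auto
    then show ?thesis
      by (subst measurable_cong[where g="\<lambda>w. e i k w + \<gamma> *\<^sub>R g i k w - v i k w"]) (auto simp: e_step[OF i])
  qed
  moreover have "h i (Suc k) \<in> borel_measurable ?H" if i: "i \<in> {1..n}" for i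
  proof -
    have "(\<lambda>w. h i k w + \<alpha> *\<^sub>R Q (sQ i k w) (gh i k w - h i k w)) \<in> borel_measurable ?H"
      using i Suc
      by (intro borel_measurable_add borel_measurable_scaleR borel_measurable_diff compose_Q
          sQ_measurable_hist up pre_hist[OF gh_measurable_pre]) auto
    then show ?thesis
      by (subst measurable_cong[where g="\<lambda>w. h i k w + \<alpha> *\<^sub>R Q (sQ i k w) (gh i k w - h i k w)"])
         (auto simp: h_step[OF i])
  qed
  ultimately show ?case by blast
qed

lemma x_hist: "x k \<in> borel_measurable (hist k)"
  and e_hist: "i \<in> {1..n} \<Longrightarrow> e i k \<in> borel_measurable (hist k)"
  and h_hist: "i \<in> {1..n} \<Longrightarrow> h i k \<in> borel_measurable (hist k)"
  using iterates_measurable by auto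

lemma g_pre: "i \<in> {1..n} \<Longrightarrow> g i k \<in> borel_measurable (pre k)"
  by (rule g_measurable_preI[OF h_hist])

lemma G_hist: "i \<in> {1..n} \<Longrightarrow> G i k \<in> borel_measurable (hist k)"
  unfolding G_def
  using measurable_compose[OF x_hist smooth_grad_borel_measurable[OF smooth_fi]] .

lemma smooth_f: "smooth L f"
  using smooth_avg[OF n_pos smooth_fi] by (simp add: f_def[abs_def])

lemma convex_f: "convex_on UNIV f"
  using convex_on_avg[OF convex_fi] by (simp add: f_def[abs_def])

lemma quasi_convex_f: "quasi_strongly_convex \<mu> f xs"
  using quasi_convex by (simp add: f_def[abs_def])

lemma f_min: "f xs \<le> f y"
  using quasi_convex_f by (auto simp: quasi_strongly_convex_def)

lemma grad_f: "grad f y = avg n (\<lambda>i. grad (fi i) y)"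
  unfolding f_def[abs_def] by (rule grad_avg[OF smooth_fi])

lemma grad_f_xs: "grad f xs = 0"
  by (rule grad_minimizer_eq_0[OF smooth_f L_pos f_min])

lemma avg_hs: "avg n hs = 0"
  using grad_f_xs by (simp add: grad_f hs_def[abs_def])

lemma \<mu>_le_L: "\<mu> \<le> L"
  by (rule quasi_strongly_convex_le_smooth[OF smooth_f convex_f L_pos quasi_convex_f])

text \<open>Smoothness at the minimizer bounds the function gap by \<open>L/2 \<parallel>X - xs\<parallel>\<^sup>2\<close>.\<close>

lemma integrable_f_gap:
  assumes "square_integrable M X"
  shows "integrable M (\<lambda>w. f (X w) - f xs)"
proof (rule Bochner_Integration.integrable_bound)
  show "integrable M (\<lambda>w. L / 2 * (norm (X w - xs))\<^sup>2)"
    using square_integrable_norm2[OF square_integrable_diff[OF assms square_integrable_const]] by simp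
  show "(\<lambda>w. f (X w) - f xs) \<in> borel_measurable M"
    using measurable_compose[OF square_integrable_measurable[OF assms] smooth_borel_measurable[OF smooth_f]] by simp
  show "AE w in M. norm (f (X w) - f xs) \<le> norm (L / 2 * (norm (X w - xs))\<^sup>2)"
  proof (rule AE_I2)
    fix w
    show "norm (f (X w) - f xs) \<le> norm (L / 2 * (norm (X w - xs))\<^sup>2)"
      using descent_lemma[OF smooth_f, of "X w" xs] f_min[of "X w"] L_pos
      by (simp add: grad_f_xs)
  qed
qed

lemma square_integrable_grad:
  assumes X: "square_integrable M X" and i: "i \<in> {1..n}"
  shows "square_integrable M (\<lambda>w. grad (fi i) (X w))"
proof (rule square_integrable_bound)
  show "integrable M (\<lambda>w. 2 * (L\<^sup>2 * (norm (X w))\<^sup>2) + 2 * (norm (grad (fi i) 0))\<^sup>2)"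
    using square_integrable_norm2[OF X] by simp
  show "(\<lambda>w. grad (fi i) (X w)) \<in> borel_measurable M"
    using measurable_compose[OF square_integrable_measurable[OF X] smooth_grad_borel_measurable[OF smooth_fi[OF i]]] .
  fix w
  have "norm (grad (fi i) (X w) - grad (fi i) 0) \<le> L * norm (X w)"
    using smooth_lipschitz[OF smooth_fi[OF i], of "X w" 0] by simp
  then have "(norm (grad (fi i) (X w) - grad (fi i) 0))\<^sup>2 \<le> L\<^sup>2 * (norm (X w))\<^sup>2"
    using power_mono by (fastforce simp: power_mult_distrib)
  then show "(norm (grad (fi i) (X w)))\<^sup>2 \<le> 2 * (L\<^sup>2 * (norm (X w))\<^sup>2) + 2 * (norm (grad (fi i) 0))\<^sup>2"
    using young_norm2[of 1 "grad (fi i) (X w) - grad (fi i) 0" "grad (fi i) 0"] by simp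
qed

lemma fresh_C:
  assumes i: "i \<in> {1..n}" and A: "A \<in> sets (vimage_algebra (space M) (sC i k) S)" and B: "B \<in> sets (pre k)"
  shows "prob (A \<inter> B) = prob A * prob B"
proof -
  have "prob (\<Inter>j\<in>{Past, Compr i}. (case j of Past \<Rightarrow> B | _ \<Rightarrow> A))
      = (\<Prod>j\<in>{Past, Compr i}. prob (case j of Past \<Rightarrow> B | _ \<Rightarrow> A))"
    using i A B by (intro indep_setsD[OF fresh[of k]]) auto
  then show ?thesis by (simp add: Int_commute mult.commute)
qed

lemma fresh_Q:
  assumes i: "i \<in> {1..n}" and A: "A \<in> sets (vimage_algebra (space M) (sQ i k) R)" and B: "B \<in> sets (pre k)"
  shows "prob (A \<inter> B) = prob A * prob B"
proof -
  have "prob (\<Inter>j\<in>{Past, Quant i}. (case j of Past \<Rightarrow> B | _ \<Rightarrow> A))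
      = (\<Prod>j\<in>{Past, Quant i}. prob (case j of Past \<Rightarrow> B | _ \<Rightarrow> A))"
    using i A B by (intro indep_setsD[OF fresh[of k]]) auto
  then show ?thesis by (simp add: Int_commute mult.commute)
qed

lemma compression_error:
  assumes i: "i \<in> {1..n}" and y: "y \<in> borel_measurable (pre k)" "square_integrable M y"
  shows "square_integrable M (\<lambda>w. C (sC i k w) (y w) - y w)"
    and "(LINT w|M. (norm (C (sC i k w) (y w) - y w))\<^sup>2) \<le> (1 - \<delta>) * (LINT w|M. (norm (y w))\<^sup>2)"
proof -
  define \<phi> where "\<phi> s p = (norm (C s p - p))\<^sup>2" for s p
  define \<psi> where "\<psi> p = (1 - \<delta>) * (norm p)\<^sup>2" for p :: 'a
  have sC: "sC i k \<in> measurable M S" "distr M S (sC i k) = S" using sC_law[OF i] by auto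
  have \<phi>: "(\<lambda>(s, p). \<phi> s p) \<in> borel_measurable (S \<Otimes>\<^sub>M borel)"
    unfolding \<phi>_def using C_measurable by (simp add: case_prod_beta')
  have \<psi>: "\<psi> \<in> borel_measurable borel" unfolding \<psi>_def by measurable
  have le: "integrable S (\<lambda>s. \<phi> s p) \<and> (LINT s|S. \<phi> s p) \<le> \<psi> p" for p
    using compression by (auto simp: compression_operator_def \<phi>_def \<psi>_def)
  have int: "integrable M (\<lambda>w. \<psi> (y w))"
    unfolding \<psi>_def using square_integrable_norm2[OF y(2)] by simp
  have ind: "prob (A \<inter> B) = prob A * prob B"
    if "A \<in> sets (vimage_algebra (space M) (sC i k) S)" "B \<in> sets (pre k)" for A B
    using that by (rule fresh_C[OF i])
  have \<phi>0: "0 \<le> \<phi> s p" for s p by (simp add: \<phi>_def)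
  note fr = fresh_seed_integral_le[OF subalgebra_past sC ind y(1) \<phi> \<phi>0 le \<psi> int]
  have "integrable M (\<lambda>w. \<phi> (sC i k w) (y w))" by (rule fr(1))
  moreover have "(\<lambda>w. C (sC i k w) (y w)) \<in> borel_measurable M"
    by (rule compose_C[OF sC(1) square_integrable_measurable[OF y(2)]])
  ultimately show "square_integrable M (\<lambda>w. C (sC i k w) (y w) - y w)"
    using square_integrable_measurable[OF y(2)] by (simp add: square_integrable_def \<phi>_def)
  have "(LINT w|M. indicator (space M) w * \<phi> (sC i k w) (y w)) \<le> (LINT w|M. indicator (space M) w * \<psi> (y w))"
    by (rule fr(2)) (simp_all add: space_in_past)
  moreover have "(LINT w|M. indicator (space M) w * \<phi> (sC i k w) (y w)) = (LINT w|M. \<phi> (sC i k w) (y w))"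
    by (intro Bochner_Integration.integral_cong) auto
  moreover have "(LINT w|M. indicator (space M) w * \<psi> (y w)) = (LINT w|M. \<psi> (y w))"
    by (intro Bochner_Integration.integral_cong) auto
  ultimately show "(LINT w|M. (norm (C (sC i k w) (y w) - y w))\<^sup>2) \<le> (1 - \<delta>) * (LINT w|M. (norm (y w))\<^sup>2)"
    by (simp add: \<phi>_def \<psi>_def)
qed

text \<open>Around its mean \<open>u + \<alpha> y\<close> the quantized update has no cross term.\<close>

lemma quantization_second_moment:
  "integrable R (\<lambda>s. (norm (u + \<alpha> *\<^sub>R Q s y))\<^sup>2) \<and>
   (LINT s|R. (norm (u + \<alpha> *\<^sub>R Q s y))\<^sup>2) \<le> (norm (u + \<alpha> *\<^sub>R y))\<^sup>2 + \<alpha>\<^sup>2 * \<omega> * (norm y)\<^sup>2"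
proof -
  interpret R: prob_space R using quantization by (simp add: quantization_operator_def)
  have Q: "integrable R (\<lambda>s. Q s y)" "(LINT s|R. Q s y) = y"
    "integrable R (\<lambda>s. (norm (Q s y - y))\<^sup>2)" "(LINT s|R. (norm (Q s y - y))\<^sup>2) \<le> \<omega> * (norm y)\<^sup>2"
    using quantization by (auto simp: quantization_operator_def)
  define a where "a = u + \<alpha> *\<^sub>R y"
  have expand: "(norm (u + \<alpha> *\<^sub>R Q s y))\<^sup>2
      = (norm a)\<^sup>2 + 2 * \<alpha> * (a \<bullet> (Q s y - y)) + \<alpha>\<^sup>2 * (norm (Q s y - y))\<^sup>2" for s
  proof -
    have "u + \<alpha> *\<^sub>R Q s y = a + \<alpha> *\<^sub>R (Q s y - y)" by (simp add: a_def algebra_simps)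
    then show ?thesis by (simp add: power2_norm_add power_mult_distrib)
  qed
  have int: "integrable R (\<lambda>s. a \<bullet> (Q s y - y))" using Q(1) by simp
  have "(LINT s|R. a \<bullet> (Q s y - y)) = a \<bullet> (LINT s|R. Q s y - y)"
    using Q(1) by (intro integral_inner_right) simp
  also have "(LINT s|R. Q s y - y) = 0" using Q(1,2) by (simp add: R.prob_space)
  finally have zero: "(LINT s|R. a \<bullet> (Q s y - y)) = 0" by simp
  have "(LINT s|R. (norm (u + \<alpha> *\<^sub>R Q s y))\<^sup>2)
      = (norm a)\<^sup>2 + \<alpha>\<^sup>2 * (LINT s|R. (norm (Q s y - y))\<^sup>2)"
    unfolding expand using int Q(3) zero by (simp add: R.prob_space del: inner_diff_right)
  also have "\<dots> \<le> (norm a)\<^sup>2 + \<alpha>\<^sup>2 * (\<omega> * (norm y)\<^sup>2)"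
    by (intro add_left_mono mult_left_mono Q(4)) simp
  finally show ?thesis
    unfolding expand using int Q(3) by (auto simp: a_def expand mult.assoc simp del: inner_diff_right)
qed

lemma quantization_step:
  assumes i: "i \<in> {1..n}"
    and u: "u \<in> borel_measurable (pre k)" "square_integrable M u"
    and y: "y \<in> borel_measurable (pre k)" "square_integrable M y"
  shows "square_integrable M (\<lambda>w. u w + \<alpha> *\<^sub>R Q (sQ i k w) (y w))"
    and "B \<in> sets (pre k) \<Longrightarrow> (LINT w|M. indicator B w * (norm (u w + \<alpha> *\<^sub>R Q (sQ i k w) (y w)))\<^sup>2)
      \<le> (LINT w|M. indicator B w * ((norm (u w + \<alpha> *\<^sub>R y w))\<^sup>2 + \<alpha>\<^sup>2 * \<omega> * (norm (y w))\<^sup>2))"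
proof -
  define \<phi> where "\<phi> s p = (norm (fst p + \<alpha> *\<^sub>R Q s (snd p)))\<^sup>2" for s p
  define \<psi> where "\<psi> p = (norm (fst p + \<alpha> *\<^sub>R snd p))\<^sup>2 + \<alpha>\<^sup>2 * \<omega> * (norm (snd p))\<^sup>2" for p :: "'a \<times> 'a"
  define P where "P w = (u w, y w)" for w
  have sQ: "sQ i k \<in> measurable M R" "distr M R (sQ i k) = R" using sQ_law[OF i] by auto
  have P: "P \<in> measurable (pre k) (borel \<Otimes>\<^sub>M borel)"
    unfolding P_def using u(1) y(1) by measurable
  have Qm: "(\<lambda>q. Q (fst q) (snd (snd q))) \<in> borel_measurable (R \<Otimes>\<^sub>M (borel \<Otimes>\<^sub>M borel))"
    by (rule compose_Q) measurable
  have \<phi>: "(\<lambda>(s, p). \<phi> s p) \<in> borel_measurable (R \<Otimes>\<^sub>M (borel \<Otimes>\<^sub>M borel))"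
  proof -
    note Qm [measurable]
    show ?thesis unfolding \<phi>_def case_prod_beta' by measurable
  qed
  have \<psi>: "\<psi> \<in> borel_measurable (borel \<Otimes>\<^sub>M borel)" unfolding \<psi>_def by measurable
  have le: "integrable R (\<lambda>s. \<phi> s p) \<and> (LINT s|R. \<phi> s p) \<le> \<psi> p" for p
    unfolding \<phi>_def \<psi>_def by (rule quantization_second_moment)
  have int: "integrable M (\<lambda>w. \<psi> (P w))"
    unfolding \<psi>_def P_def fst_conv snd_conv
    using square_integrable_norm2[OF square_integrable_add[OF u(2) square_integrable_scaleR[OF y(2)]]]
      square_integrable_norm2[OF y(2)] by simp
  have ind: "prob (A \<inter> B) = prob A * prob B"
    if "A \<in> sets (vimage_algebra (space M) (sQ i k) R)" "B \<in> sets (pre k)" for A B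
    using that by (rule fresh_Q[OF i])
  have \<phi>0: "0 \<le> \<phi> s p" for s p by (simp add: \<phi>_def)
  note fr = fresh_seed_integral_le[OF subalgebra_past sQ ind P \<phi> \<phi>0 le \<psi> int]
  have "integrable M (\<lambda>w. \<phi> (sQ i k w) (P w))" by (rule fr(1))
  moreover have "(\<lambda>w. Q (sQ i k w) (y w)) \<in> borel_measurable M"
    by (rule compose_Q[OF sQ(1) square_integrable_measurable[OF y(2)]])
  ultimately show "square_integrable M (\<lambda>w. u w + \<alpha> *\<^sub>R Q (sQ i k w) (y w))"
    using square_integrable_measurable[OF u(2)] by (simp add: square_integrable_def \<phi>_def P_def)
  show "(LINT w|M. indicator B w * (norm (u w + \<alpha> *\<^sub>R Q (sQ i k w) (y w)))\<^sup>2)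
      \<le> (LINT w|M. indicator B w * ((norm (u w + \<alpha> *\<^sub>R y w))\<^sup>2 + \<alpha>\<^sup>2 * \<omega> * (norm (y w))\<^sup>2))"
    if "B \<in> sets (pre k)"
  proof -
    have "(LINT w|M. indicator B w * \<phi> (sQ i k w) (P w)) \<le> (LINT w|M. indicator B w * \<psi> (P w))"
      using that by - (rule fr(2))
    then show ?thesis unfolding \<phi>_def \<psi>_def P_def fst_conv snd_conv .
  qed
qed

lemma noise_square_integrable:
  assumes i: "i \<in> {1..n}"
  shows "square_integrable M (noise i k)"
proof -
  have "noise i k \<in> borel_measurable M"
    unfolding noise_def using gh_measurable[OF i] hist_M[OF G_hist[OF i]] by (rule borel_measurable_diff)
  moreover have "integrable M (\<lambda>w. (norm (noise i k w))\<^sup>2)"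
    using gh_variance[OF i] by (auto simp: cond_exp_le_def noise_def G_def)
  ultimately show ?thesis by (simp add: square_integrable_def)
qed

lemma gh_eq: "gh i k w = G i k w + noise i k w"
  by (simp add: noise_def)

lemma gh_square_integrableI:
  assumes "square_integrable M (x k)" and i: "i \<in> {1..n}"
  shows "square_integrable M (gh i k)"
  using square_integrable_add[OF square_integrable_grad[OF assms] noise_square_integrable[OF i, of k]]
  by (simp add: noise_def G_def)

lemma g_square_integrableI:
  assumes "square_integrable M (x k)" and "\<And>i. i \<in> {1..n} \<Longrightarrow> square_integrable M (h i k)"
    and i: "i \<in> {1..n}"
  shows "square_integrable M (g i k)"
proof -
  have "square_integrable M (\<lambda>w. gh i k w - h i k w + avg n (\<lambda>j. h j k w))"
    using assms gh_square_integrableI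
    by (intro square_integrable_add square_integrable_diff square_integrable_avg) auto
  then show ?thesis
    by (subst square_integrable_cong[where Y="\<lambda>w. gh i k w - h i k w + avg n (\<lambda>j. h j k w)"])
       (auto simp: g_step[OF i])
qed

lemma iterates_square_integrable:
  "square_integrable M (x k) \<and>
   (\<forall>i\<in>{1..n}. square_integrable M (e i k) \<and> square_integrable M (h i k))"
proof (induction k)
  case 0
  have "square_integrable M (x 0)"
    by (subst square_integrable_cong[where Y="\<lambda>_. x0"]) (auto simp: x_init square_integrable_const)
  moreover have "square_integrable M (e i 0)" if "i \<in> {1..n}" for i
    by (subst square_integrable_cong[where Y="\<lambda>_. 0"]) (use that in \<open>auto simp: e_init square_integrable_const\<close>)
  moreover have "square_integrable M (h i 0)" if "i \<in> {1..n}" for i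
    by (subst square_integrable_cong[where Y="\<lambda>_. h0 i"]) (use that in \<open>auto simp: h_init square_integrable_const\<close>)
  ultimately show ?case by blast
next
  case (Suc k)
  then have x: "square_integrable M (x k)" and e: "\<And>i. i \<in> {1..n} \<Longrightarrow> square_integrable M (e i k)"
    and h: "\<And>i. i \<in> {1..n} \<Longrightarrow> square_integrable M (h i k)" by auto
  have g: "square_integrable M (g i k)" if "i \<in> {1..n}" for i
    by (rule g_square_integrableI[OF x h that])
  have y: "square_integrable M (\<lambda>w. e i k w + \<gamma> *\<^sub>R g i k w)"
    "(\<lambda>w. e i k w + \<gamma> *\<^sub>R g i k w) \<in> borel_measurable (pre k)" if i: "i \<in> {1..n}" for i
    using e[OF i] g[OF i] hist_pre[OF e_hist[OF i, of k]] g_pre[OF i, of k]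
    by (auto intro: square_integrable_add square_integrable_scaleR)
  have e': "square_integrable M (e i (Suc k))" if i: "i \<in> {1..n}" for i
  proof -
    have "square_integrable M (\<lambda>w. - 1 *\<^sub>R (C (sC i k w) (e i k w + \<gamma> *\<^sub>R g i k w) - (e i k w + \<gamma> *\<^sub>R g i k w)))"
      by (rule square_integrable_scaleR[OF compression_error(1)[OF i y(2,1)[OF i]]])
    then show ?thesis
      by (subst square_integrable_cong[where Y="\<lambda>w. - 1 *\<^sub>R (C (sC i k w) (e i k w + \<gamma> *\<^sub>R g i k w) - (e i k w + \<gamma> *\<^sub>R g i k w))"])
         (auto simp: e_step[OF i] v_step[OF i])
  qed
  moreover have "square_integrable M (h i (Suc k))" if i: "i \<in> {1..n}" for i
  proof -
    have "square_integrable M (\<lambda>w. h i k w + \<alpha> *\<^sub>R Q (sQ i k w) (gh i k w - h i k w))"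
      using i by (intro quantization_step(1) borel_measurable_diff square_integrable_diff
          gh_measurable_pre gh_square_integrableI hist_pre h_hist h x)
    then show ?thesis
      by (subst square_integrable_cong[where Y="\<lambda>w. h i k w + \<alpha> *\<^sub>R Q (sQ i k w) (gh i k w - h i k w)"])
         (auto simp: h_step[OF i])
  qed
  \<comment> \<open>The message \<open>v i k\<close> is recovered from the two successive errors.\<close>
  moreover have "square_integrable M (x (Suc k))"
  proof -
    have "square_integrable M (\<lambda>w. x k w - avg n (\<lambda>i. e i k w + \<gamma> *\<^sub>R g i k w - e i (Suc k) w))"
      using y(1) e' by (intro square_integrable_diff square_integrable_avg x)
    moreover have "x (Suc k) w = x k w - avg n (\<lambda>i. e i k w + \<gamma> *\<^sub>R g i k w - e i (Suc k) w)"
      if "w \<in> space M" for w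
      using that by (auto simp: x_step e_step intro!: avg_cong)
    ultimately show ?thesis by (subst square_integrable_cong)
  qed
  ultimately show ?case by blast
qed

lemma x_sq: "square_integrable M (x k)"
  and e_sq: "i \<in> {1..n} \<Longrightarrow> square_integrable M (e i k)"
  and h_sq: "i \<in> {1..n} \<Longrightarrow> square_integrable M (h i k)"
  using iterates_square_integrable by auto

lemma gh_sq: "i \<in> {1..n} \<Longrightarrow> square_integrable M (gh i k)"
  by (rule gh_square_integrableI[OF x_sq])

lemma g_sq: "i \<in> {1..n} \<Longrightarrow> square_integrable M (g i k)"
  by (rule g_square_integrableI[OF x_sq h_sq])

lemma G_sq: "i \<in> {1..n} \<Longrightarrow> square_integrable M (G i k)"
  unfolding G_def by (rule square_integrable_grad[OF x_sq])

section \<open>The gradient noise\<close>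

lemma gap_nonneg: "0 \<le> gap k w"
  using f_min by (simp add: gap_def)

lemma gap_integrable: "integrable M (gap k)"
  unfolding gap_def[abs_def] by (rule integrable_f_gap[OF x_sq])

lemma gap_hist: "gap k \<in> borel_measurable (hist k)"
  unfolding gap_def[abs_def]
  using measurable_compose[OF x_hist smooth_borel_measurable[OF smooth_f]] by simp

lemma cond_exp_gh:
  assumes i: "i \<in> {1..n}" and b: "b \<in> Basis"
  shows "AE w in M. real_cond_exp M (hist k) (\<lambda>w. gh i k w \<bullet> b) w = G i k w \<bullet> b"
  using gh_unbiased[OF i, of k]
proof eventually_elim
  case (elim w)
  have "G i k w \<bullet> b = vec_cond_exp M (hist k) (gh i k) w \<bullet> b" by (simp add: elim G_def)
  also have "\<dots> = real_cond_exp M (hist k) (\<lambda>w. gh i k w \<bullet> b) w"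
    unfolding vec_cond_exp_def using b by (simp add: inner_sum_left inner_Basis if_distrib cong: if_cong)
  finally show ?case by simp
qed

text \<open>A factor determined by the history can be pulled out of the conditional expectation, in which
  the noise has mean zero; this is done for each coordinate.\<close>

lemma noise_orthogonal:
  assumes i: "i \<in> {1..n}" and U: "U \<in> borel_measurable (hist k)" "square_integrable M U"
  shows "(LINT w|M. U w \<bullet> noise i k w) = 0"
proof -
  interpret sigma_finite_subalgebra M "hist k" by (rule subalgebra_sigma_finite[OF subalgebra_past])
  have sq: "square_integrable M (\<lambda>w. (X w \<bullet> b) *\<^sub>R b)" if "square_integrable M X" "b \<in> Basis" for X :: "'w \<Rightarrow> 'a" and b
  proof (rule square_integrable_bound[OF square_integrable_norm2[OF that(1)]])
    show "(\<lambda>w. (X w \<bullet> b) *\<^sub>R b) \<in> borel_measurable M"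
      using square_integrable_measurable[OF that(1)] by simp
    show "(norm ((X w \<bullet> b) *\<^sub>R b))\<^sup>2 \<le> (norm (X w))\<^sup>2" for w
      using Basis_le_norm[OF that(2), of "X w"] that(2) by (simp add: abs_le_square_iff[symmetric])
  qed
  have prod: "integrable M (\<lambda>w. (U w \<bullet> b) * (X w \<bullet> b))" if "square_integrable M X" "b \<in> Basis" for X b
    using square_integrable_inner[OF sq[OF U(2) that(2)] that(1)] by (simp add: inner_commute)
  have comp: "(LINT w|M. (U w \<bullet> b) * (noise i k w \<bullet> b)) = 0" if b: "b \<in> Basis" for b
  proof -
    have "(LINT w|M. (U w \<bullet> b) * (gh i k w \<bullet> b))
        = (LINT w|M. (U w \<bullet> b) * real_cond_exp M (hist k) (\<lambda>w. gh i k w \<bullet> b) w)"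
      using prod[OF gh_sq[OF i] b] U(1) square_integrable_measurable[OF gh_sq[OF i]]
      by (intro real_cond_exp_intg(2)[symmetric]) auto
    also have "\<dots> = (LINT w|M. (U w \<bullet> b) * (G i k w \<bullet> b))"
    proof (rule integral_cong_AE)
      show "AE w in M. (U w \<bullet> b) * real_cond_exp M (hist k) (\<lambda>w. gh i k w \<bullet> b) w = (U w \<bullet> b) * (G i k w \<bullet> b)"
        using cond_exp_gh[OF i b, of k] by eventually_elim simp
      show "(\<lambda>w. (U w \<bullet> b) * (G i k w \<bullet> b)) \<in> borel_measurable M"
        using prod[OF G_sq[OF i] b] by (rule borel_measurable_integrable)
      show "(\<lambda>w. (U w \<bullet> b) * real_cond_exp M (hist k) (\<lambda>w. gh i k w \<bullet> b) w) \<in> borel_measurable M"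
        using square_integrable_measurable[OF U(2)] by simp
    qed
    finally show ?thesis
      using prod[OF gh_sq[OF i] b] prod[OF G_sq[OF i] b]
      by (simp add: noise_def inner_diff_left right_diff_distrib)
  qed
  have "(LINT w|M. U w \<bullet> noise i k w) = (LINT w|M. (\<Sum>b\<in>Basis. (U w \<bullet> b) * (noise i k w \<bullet> b)))"
    by (intro Bochner_Integration.integral_cong refl euclidean_inner)
  also have "\<dots> = 0"
    using prod[OF noise_square_integrable[OF i]] comp
    by (subst Bochner_Integration.integral_sum) auto
  finally show ?thesis .
qed

lemma noise_orthogonal_on:
  assumes i: "i \<in> {1..n}" and U: "U \<in> borel_measurable (hist k)" "square_integrable M U"
    and B: "B \<in> sets (hist k)"
  shows "(LINT w|M. indicator B w * (U w \<bullet> noise i k w)) = 0"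
proof -
  have "(LINT w|M. (indicator B w *\<^sub>R U w) \<bullet> noise i k w) = 0"
    using U B by (intro noise_orthogonal[OF i] square_integrable_indicator sets_hist_M) auto
  then show ?thesis by simp
qed

lemma noise_norm2_on:
  assumes i: "i \<in> {1..n}" and B: "B \<in> sets (hist k)"
  shows "(LINT w|M. indicator B w * (norm (noise i k w))\<^sup>2) \<le> (LINT w|M. indicator B w * D1i i)"
  using cond_exp_leD[OF subalgebra_past gh_variance[OF i] _ B]
  by (simp add: noise_def G_def)

text \<open>This is where the conditional independence of the workers enters. One of the two noises suffices
  to be centred: with \<open>noise j\<close> both \<open>gh i\<close>, by independence, and \<open>G i\<close>, by measurability, are
  uncorrelated.\<close>

lemma noise_uncorrelated:
  assumes i: "i \<in> {1..n}" and j: "j \<in> {1..n}" and ij: "i \<noteq> j" and B: "B \<in> sets (hist k)"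
  shows "(LINT w|M. indicator B w * (noise i k w \<bullet> noise j k w)) = 0"
proof -
  have BM: "B \<in> sets M" by (rule sets_hist_M[OF B])
  have nj: "square_integrable M (noise j k)" by (rule noise_square_integrable[OF j])
  have sqb: "integrable M (\<lambda>w. (X w \<bullet> b) * (noise j k w \<bullet> b))"
    if X: "square_integrable M X" and b: "b \<in> Basis" for X b
  proof (rule Bochner_Integration.integrable_bound)
    show "integrable M (\<lambda>w. (norm (X w))\<^sup>2 + (norm (noise j k w))\<^sup>2)"
      using square_integrable_norm2[OF X] square_integrable_norm2[OF nj] by simp
    show "(\<lambda>w. (X w \<bullet> b) * (noise j k w \<bullet> b)) \<in> borel_measurable M"
      using square_integrable_measurable[OF X] square_integrable_measurable[OF nj] by simp
    show "AE w in M. norm ((X w \<bullet> b) * (noise j k w \<bullet> b)) \<le> norm ((norm (X w))\<^sup>2 + (norm (noise j k w))\<^sup>2)"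
    proof (rule AE_I2)
      fix w
      have "\<bar>(X w \<bullet> b) * (noise j k w \<bullet> b)\<bar> \<le> norm (X w) * norm (noise j k w)"
        unfolding abs_mult using b by (intro mult_mono Basis_le_norm) auto
      then show "norm ((X w \<bullet> b) * (noise j k w \<bullet> b)) \<le> norm ((norm (X w))\<^sup>2 + (norm (noise j k w))\<^sup>2)"
        using sum_squares_bound[of "norm (X w)" "norm (noise j k w)"]
          mult_nonneg_nonneg[OF norm_ge_zero[of "X w"] norm_ge_zero[of "noise j k w"]] by simp
    qed
  qed
  have comp: "(LINT w|M. indicator B w * ((gh i k w \<bullet> b) * (noise j k w \<bullet> b))) = 0" if b: "b \<in> Basis" for b
  proof -
    define H where "H = real_cond_exp M (hist k) (\<lambda>w. gh j k w \<bullet> b)"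
    have ae: "AE w in M. (gh i k w \<bullet> b) * (gh j k w \<bullet> b - H w) = (gh i k w \<bullet> b) * (noise j k w \<bullet> b)"
      using cond_exp_gh[OF j b, of k]
      by eventually_elim (simp add: H_def noise_def inner_diff_left)
    have meas: "(\<lambda>w. (gh i k w \<bullet> b) * (gh j k w \<bullet> b - H w)) \<in> borel_measurable M"
      unfolding H_def using gh_measurable[OF i] gh_measurable[OF j] by simp
    have meas': "(\<lambda>w. (gh i k w \<bullet> b) * (noise j k w \<bullet> b)) \<in> borel_measurable M"
      by (rule borel_measurable_integrable[OF sqb[OF gh_sq[OF i] b]])
    have int: "integrable M (\<lambda>w. (gh i k w \<bullet> b) * (gh j k w \<bullet> b - H w))"
      using integrable_cong_AE[OF meas meas' ae] sqb[OF gh_sq[OF i] b] by blast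
    have "(LINT w|M. indicator B w * ((gh i k w \<bullet> b) * (gh j k w \<bullet> b - H w))) = 0"
      unfolding H_def
    proof (rule cond_indep_orthogonal[OF subalgebra_past _ i j ij gh_indep B, where \<phi>="\<lambda>z. z \<bullet> b" and \<psi>="\<lambda>z. z \<bullet> b"])
      show "integrable M (\<lambda>w. gh j k w \<bullet> b)" using gh_integrable[OF j] by simp
      show "integrable M (\<lambda>w. (gh i k w \<bullet> b) * (gh j k w \<bullet> b - real_cond_exp M (hist k) (\<lambda>w. gh j k w \<bullet> b) w))"
        using int unfolding H_def .
    qed simp_all
    moreover have "(LINT w|M. indicator B w * ((gh i k w \<bullet> b) * (gh j k w \<bullet> b - H w)))
        = (LINT w|M. indicator B w * ((gh i k w \<bullet> b) * (noise j k w \<bullet> b)))"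
    proof (rule integral_cong_AE)
      show "AE w in M. indicator B w * ((gh i k w \<bullet> b) * (gh j k w \<bullet> b - H w))
          = indicator B w * ((gh i k w \<bullet> b) * (noise j k w \<bullet> b))"
        using ae by eventually_elim simp
    qed (use meas meas' BM in auto)
    ultimately show ?thesis by simp
  qed
  have 1: "(LINT w|M. indicator B w * (gh i k w \<bullet> noise j k w)) = 0"
  proof -
    have "(LINT w|M. indicator B w * (gh i k w \<bullet> noise j k w))
        = (LINT w|M. (\<Sum>b\<in>Basis. indicator B w * ((gh i k w \<bullet> b) * (noise j k w \<bullet> b))))"
      unfolding sum_distrib_left[symmetric]
      by (intro Bochner_Integration.integral_cong refl arg_cong[where f="(*) _"] euclidean_inner)
    also have "\<dots> = 0"
      using integrable_indicator_mult[OF sqb[OF gh_sq[OF i]] BM] comp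
      by (subst Bochner_Integration.integral_sum) auto
    finally show ?thesis .
  qed
  have 2: "(LINT w|M. indicator B w * (G i k w \<bullet> noise j k w)) = 0"
    by (rule noise_orthogonal_on[OF j G_hist[OF i] G_sq[OF i] B])
  have "(LINT w|M. indicator B w * (noise i k w \<bullet> noise j k w))
      = (LINT w|M. indicator B w * (gh i k w \<bullet> noise j k w) - indicator B w * (G i k w \<bullet> noise j k w))"
    by (simp add: noise_def[of i] inner_diff_left right_diff_distrib)
  also have "\<dots> = 0"
    using 1 2 integrable_indicator_mult[OF square_integrable_inner[OF gh_sq[OF i, of k] nj] BM]
      integrable_indicator_mult[OF square_integrable_inner[OF G_sq[OF i, of k] nj] BM] by simp
  finally show ?thesis .
qed

definition mean_noise :: "nat \<Rightarrow> 'w \<Rightarrow> 'a" where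
  "mean_noise k w = avg n (\<lambda>i. noise i k w)"

lemma mean_noise_sq: "square_integrable M (mean_noise k)"
  unfolding mean_noise_def[abs_def] by (intro square_integrable_avg noise_square_integrable)

lemma mean_noise_orthogonal_on:
  assumes U: "U \<in> borel_measurable (hist k)" "square_integrable M U" and B: "B \<in> sets (hist k)"
  shows "(LINT w|M. indicator B w * (U w \<bullet> mean_noise k w)) = 0"
proof -
  have "(LINT w|M. indicator B w * (U w \<bullet> mean_noise k w))
      = (LINT w|M. avg n (\<lambda>i. indicator B w * (U w \<bullet> noise i k w)))"
    by (simp only: mean_noise_def inner_commute[of "U _"] avg_inner_left avg_mult_left)
  also have "\<dots> = avg n (\<lambda>i. LINT w|M. indicator B w * (U w \<bullet> noise i k w))"
    using B by (intro integral_avg integrable_indicator_mult square_integrable_inner U noise_square_integrable sets_hist_M)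
  also have "\<dots> = avg n (\<lambda>i. 0)"
    by (intro avg_cong noise_orthogonal_on U B)
  finally show ?thesis by (simp add: avg_def)
qed

text \<open>The off-diagonal terms of the square vanish, which gains the factor \<open>1/n\<close>.\<close>

lemma mean_noise_norm2_on:
  assumes B: "B \<in> sets (hist k)"
  shows "(LINT w|M. indicator B w * (norm (mean_noise k w))\<^sup>2)
    \<le> (LINT w|M. indicator B w * (avg n D1i / real n))"
proof -
  have BM: "B \<in> sets M" by (rule sets_hist_M[OF B])
  have int: "integrable M (\<lambda>w. indicator B w * (noise i k w \<bullet> noise j k w))" if "i \<in> {1..n}" "j \<in> {1..n}" for i j
    using that BM by (intro integrable_indicator_mult square_integrable_inner noise_square_integrable)
  have "(LINT w|M. indicator B w * (norm (mean_noise k w))\<^sup>2)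
      = (LINT w|M. (1 / real n)\<^sup>2 * (\<Sum>i=1..n. \<Sum>j=1..n. indicator B w * (noise i k w \<bullet> noise j k w)))"
  proof (intro Bochner_Integration.integral_cong refl)
    fix w
    have "(norm (\<Sum>i=1..n. noise i k w))\<^sup>2 = (\<Sum>i=1..n. noise i k w \<bullet> (\<Sum>j=1..n. noise j k w))"
      unfolding power2_norm_eq_inner by (rule inner_sum_left)
    also have "\<dots> = (\<Sum>i=1..n. \<Sum>j=1..n. noise i k w \<bullet> noise j k w)"
      unfolding inner_sum_right ..
    finally have "(norm (mean_noise k w))\<^sup>2 = (1 / real n)\<^sup>2 * (\<Sum>i=1..n. \<Sum>j=1..n. noise i k w \<bullet> noise j k w)"
      by (simp only: mean_noise_def avg_def norm_scaleR_power2)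
    then show "indicator B w * (norm (mean_noise k w))\<^sup>2
        = (1 / real n)\<^sup>2 * (\<Sum>i=1..n. \<Sum>j=1..n. indicator B w * (noise i k w \<bullet> noise j k w))"
      unfolding sum_distrib_left[symmetric] by (simp only: mult.left_commute)
  qed
  also have "\<dots> = (1 / real n)\<^sup>2 * (\<Sum>i=1..n. \<Sum>j=1..n. LINT w|M. indicator B w * (noise i k w \<bullet> noise j k w))"
  proof -
    have "(LINT w|M. (\<Sum>i=1..n. \<Sum>j=1..n. indicator B w * (noise i k w \<bullet> noise j k w)))
        = (\<Sum>i=1..n. LINT w|M. (\<Sum>j=1..n. indicator B w * (noise i k w \<bullet> noise j k w)))"
      by (intro Bochner_Integration.integral_sum Bochner_Integration.integrable_sum int)
    also have "\<dots> = (\<Sum>i=1..n. \<Sum>j=1..n. LINT w|M. indicator B w * (noise i k w \<bullet> noise j k w))"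
      by (intro sum.cong refl Bochner_Integration.integral_sum int)
    finally show ?thesis by (simp only: integral_mult_right_zero)
  qed
  also have "(\<Sum>i=1..n. \<Sum>j=1..n. LINT w|M. indicator B w * (noise i k w \<bullet> noise j k w))
      = (\<Sum>i=1..n. LINT w|M. indicator B w * (norm (noise i k w))\<^sup>2)"
  proof (rule sum.cong[OF refl])
    fix i assume i: "i \<in> {1..n}"
    have "(\<Sum>j=1..n. LINT w|M. indicator B w * (noise i k w \<bullet> noise j k w))
        = (\<Sum>j\<in>{1..n}. if j = i then LINT w|M. indicator B w * (norm (noise i k w))\<^sup>2 else 0)"
      using noise_uncorrelated[OF i _ _ B] by (intro sum.cong) (auto simp: power2_norm_eq_inner)
    then show "(\<Sum>j=1..n. LINT w|M. indicator B w * (noise i k w \<bullet> noise j k w))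
        = (LINT w|M. indicator B w * (norm (noise i k w))\<^sup>2)"
      using i by simp
  qed
  also have "(1 / real n)\<^sup>2 * \<dots> \<le> (1 / real n)\<^sup>2 * (\<Sum>i=1..n. LINT w|M. indicator B w * D1i i)"
    using B by (intro mult_left_mono sum_mono noise_norm2_on) auto
  also have "\<dots> = (LINT w|M. indicator B w * (avg n D1i / real n))"
  proof -
    have "(LINT w|M. indicator B w * c) = prob B * c" for c :: real
      using BM by simp
    then show ?thesis
      by (simp add: avg_real power2_eq_square flip: sum_distrib_left)
  qed
  finally show ?thesis .
qed

section \<open>One iteration of the algorithm\<close>

text \<open>The conditional mean of \<open>g i k\<close>, by lemma \<open>vec_cond_exp_g\<close> below.\<close>

definition gb :: "nat \<Rightarrow> nat \<Rightarrow> 'w \<Rightarrow> 'a" where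
  "gb i k w = G i k w - h i k w + avg n (\<lambda>j. h j k w)"

definition \<sigma>2 :: "nat \<Rightarrow> 'w \<Rightarrow> real" where
  "\<sigma>2 k w = avg n (\<lambda>i. (norm (h i k w - hs i))\<^sup>2)"

definition D1 :: real where "D1 = avg n D1i"

lemma D1_nonneg: "0 \<le> D1"
  unfolding D1_def by (rule avg_nonneg[OF D1i_nonneg])

lemma gb_sq: "i \<in> {1..n} \<Longrightarrow> square_integrable M (gb i k)"
  unfolding gb_def[abs_def]
  by (intro square_integrable_add square_integrable_diff square_integrable_avg G_sq h_sq)

lemma gb_hist: "i \<in> {1..n} \<Longrightarrow> gb i k \<in> borel_measurable (hist k)"
  unfolding gb_def[abs_def]
  by (intro borel_measurable_add borel_measurable_diff avg_measurable G_hist h_hist)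

lemma g_eq: "i \<in> {1..n} \<Longrightarrow> w \<in> space M \<Longrightarrow> g i k w = gb i k w + noise i k w"
  by (simp add: g_step gb_def noise_def)

text \<open>The shifts by \<open>h\<close> cancel in the mean over the workers.\<close>

lemma avg_g:
  assumes "w \<in> space M"
  shows "avg n (\<lambda>i. g i k w) = grad f (x k w) + mean_noise k w"
proof -
  have "avg n (\<lambda>i. g i k w) = avg n (\<lambda>i. (G i k w - h i k w) + avg n (\<lambda>j. h j k w) + noise i k w)"
    using assms by (intro avg_cong) (simp add: g_eq gb_def)
  also have "\<dots> = avg n (\<lambda>i. G i k w) + mean_noise k w"
    by (simp add: avg_add avg_diff avg_const[OF n_pos] mean_noise_def)
  finally show ?thesis by (simp add: grad_f G_def)
qed

lemma \<sigma>2_nonneg: "0 \<le> \<sigma>2 k w"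
  unfolding \<sigma>2_def by (rule avg_nonneg) simp

lemma h_hs_sq: "i \<in> {1..n} \<Longrightarrow> square_integrable M (\<lambda>w. h i k w - hs i)"
  by (intro square_integrable_diff h_sq square_integrable_const)

lemma \<sigma>2_integrable: "integrable M (\<sigma>2 k)"
  unfolding \<sigma>2_def[abs_def] by (intro integrable_avg square_integrable_norm2 h_hs_sq)

lemma \<sigma>2_hist: "\<sigma>2 k \<in> borel_measurable (hist k)"
  unfolding \<sigma>2_def[abs_def]
  using h_hist by (intro avg_measurable borel_measurable_power borel_measurable_norm borel_measurable_diff) auto

lemma grad_f_norm2_le: "(norm (grad f (x k w)))\<^sup>2 \<le> 2 * L * gap k w"
  using grad_diff_norm2_le[OF smooth_f convex_f L_pos, of "x k w" xs] by (simp add: grad_f_xs gap_def)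

text \<open>Co-coercivity for each worker; the linear terms cancel because \<open>hs\<close> averages to
  \<open>grad f xs = 0\<close>.\<close>

lemma avg_G_diff_norm2_le: "avg n (\<lambda>i. (norm (G i k w - hs i))\<^sup>2) \<le> 2 * L * gap k w"
proof -
  have "avg n (\<lambda>i. (norm (G i k w - hs i))\<^sup>2)
      \<le> avg n (\<lambda>i. 2 * L * (fi i (x k w) - fi i xs - hs i \<bullet> (x k w - xs)))"
    unfolding G_def hs_def by (intro avg_mono grad_diff_norm2_le smooth_fi convex_fi L_pos)
  also have "\<dots> = 2 * L * (f (x k w) - f xs - avg n hs \<bullet> (x k w - xs))"
    by (simp only: avg_mult_left avg_diff avg_inner_left f_def)
  finally show ?thesis by (simp add: avg_hs gap_def)
qed

text \<open>\<open>gb\<close> is the sum of \<open>G - hs\<close> and the centred deviation of \<open>h - hs\<close>; centring does not increase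
  the mean square. The parameter \<open>t\<close> trades the two parts off against each other.\<close>

lemma avg_gb_norm2_le:
  assumes t: "0 < t"
  shows "avg n (\<lambda>i. (norm (gb i k w))\<^sup>2) \<le> (1 + t) * (2 * L * gap k w) + (1 + 1 / t) * \<sigma>2 k w"
proof -
  define u where "u i = h i k w - hs i" for i
  have u: "avg n u = avg n (\<lambda>i. h i k w)" by (simp add: u_def[abs_def] avg_diff avg_hs)
  have "gb i k w = (G i k w - hs i) + (avg n u - u i)" for i
    by (simp add: gb_def u) (simp add: u_def)
  then have "avg n (\<lambda>i. (norm (gb i k w))\<^sup>2)
      \<le> avg n (\<lambda>i. (1 + t) * (norm (G i k w - hs i))\<^sup>2 + (1 + 1 / t) * (norm (avg n u - u i))\<^sup>2)"
    using young_norm2[OF t] by (intro avg_mono) simp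
  also have "\<dots> = (1 + t) * avg n (\<lambda>i. (norm (G i k w - hs i))\<^sup>2)
      + (1 + 1 / t) * avg n (\<lambda>i. (norm (u i - avg n u))\<^sup>2)"
    by (simp only: avg_add avg_mult_left norm_minus_commute)
  also have "\<dots> \<le> (1 + t) * (2 * L * gap k w) + (1 + 1 / t) * \<sigma>2 k w"
  proof (intro add_mono mult_left_mono avg_G_diff_norm2_le)
    show "avg n (\<lambda>i. (norm (u i - avg n u))\<^sup>2) \<le> \<sigma>2 k w"
      by (simp add: avg_norm2_centred[OF n_pos]) (simp add: \<sigma>2_def u_def)
  qed (use t in auto)
  finally show ?thesis .
qed

lemma vec_cond_exp_g:
  assumes i: "i \<in> {1..n}"
  shows "AE w in M. vec_cond_exp M (hist k) (g i k) w = gb i k w"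
proof (rule vec_cond_exp_eqI[OF subalgebra_past])
  show "integrable M (g i k)" "integrable M (gb i k)"
    by (intro square_integrable_integrable g_sq gb_sq i)+
  show "gb i k \<in> borel_measurable (hist k)" by (rule gb_hist[OF i])
  fix B and b :: 'a assume B: "B \<in> sets (hist k)" and b: "b \<in> Basis"
  have BM: "B \<in> sets M" by (rule sets_hist_M[OF B])
  have "(LINT w|M. indicator B w * (g i k w \<bullet> b))
      = (LINT w|M. indicator B w * (gb i k w \<bullet> b) + indicator B w * (b \<bullet> noise i k w))"
    by (intro Bochner_Integration.integral_cong) (simp_all add: g_eq[OF i] inner_add_left inner_add_right inner_commute distrib_left)
  also have "\<dots> = (LINT w|M. indicator B w * (gb i k w \<bullet> b)) + (LINT w|M. indicator B w * (b \<bullet> noise i k w))"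
    using square_integrable_inner[OF gb_sq[OF i, of k] square_integrable_const[of b]]
      square_integrable_inner[OF square_integrable_const[of b] noise_square_integrable[OF i, of k]]
    by (intro Bochner_Integration.integral_add integrable_indicator_mult BM)
  also have "(LINT w|M. indicator B w * (b \<bullet> noise i k w)) = 0"
    by (rule noise_orthogonal_on[OF i _ square_integrable_const B]) simp
  finally show "(LINT w|M. indicator B w * (g i k w \<bullet> b)) = (LINT w|M. indicator B w * (gb i k w \<bullet> b))"
    by simp
qed

lemma grad_f_hist: "(\<lambda>w. grad f (x k w)) \<in> borel_measurable (hist k)"
  using measurable_compose[OF x_hist smooth_grad_borel_measurable[OF smooth_f]] .

lemma grad_f_sq: "square_integrable M (\<lambda>w. grad f (x k w))"
  unfolding grad_f by (intro square_integrable_avg square_integrable_grad x_sq)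

lemma avg_g_sq: "square_integrable M (\<lambda>w. avg n (\<lambda>i. g i k w))"
  by (intro square_integrable_avg g_sq)

lemma vec_cond_exp_avg_g: "AE w in M. vec_cond_exp M (hist k) (\<lambda>w. avg n (\<lambda>i. g i k w)) w = grad f (x k w)"
proof (rule vec_cond_exp_eqI[OF subalgebra_past])
  show "integrable M (\<lambda>w. avg n (\<lambda>i. g i k w))" "integrable M (\<lambda>w. grad f (x k w))"
    by (intro square_integrable_integrable avg_g_sq grad_f_sq)+
  show "(\<lambda>w. grad f (x k w)) \<in> borel_measurable (hist k)" by (rule grad_f_hist)
  fix B and b :: 'a assume B: "B \<in> sets (hist k)" and b: "b \<in> Basis"
  have BM: "B \<in> sets M" by (rule sets_hist_M[OF B])
  have "(LINT w|M. indicator B w * (avg n (\<lambda>i. g i k w) \<bullet> b))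
      = (LINT w|M. indicator B w * (grad f (x k w) \<bullet> b) + indicator B w * (b \<bullet> mean_noise k w))"
    by (intro Bochner_Integration.integral_cong) (simp_all add: avg_g inner_add_left inner_add_right inner_commute distrib_left)
  also have "\<dots> = (LINT w|M. indicator B w * (grad f (x k w) \<bullet> b)) + (LINT w|M. indicator B w * (b \<bullet> mean_noise k w))"
    using square_integrable_inner[OF grad_f_sq[of k] square_integrable_const[of b]]
      square_integrable_inner[OF square_integrable_const[of b] mean_noise_sq[of k]]
    by (intro Bochner_Integration.integral_add integrable_indicator_mult BM)
  also have "(LINT w|M. indicator B w * (b \<bullet> mean_noise k w)) = 0"
    by (rule mean_noise_orthogonal_on[OF _ square_integrable_const B]) simp
  finally show "(LINT w|M. indicator B w * (avg n (\<lambda>i. g i k w) \<bullet> b)) = (LINT w|M. indicator B w * (grad f (x k w) \<bullet> b))"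
    by simp
qed

lemma g_deviation:
  fixes k
  assumes i: "i \<in> {1..n}"
  defines "X \<equiv> \<lambda>w. (norm (g i k w - vec_cond_exp M (hist k) (g i k) w))\<^sup>2"
  shows "integrable M X" and "AE w in M. real_cond_exp M (hist k) X w \<le> D1i i"
proof -
  interpret sigma_finite_subalgebra M "hist k" by (rule subalgebra_sigma_finite[OF subalgebra_past])
  have "vec_cond_exp M (hist k) (g i k) \<in> borel_measurable M"
    unfolding vec_cond_exp_def[abs_def] by (intro borel_measurable_sum borel_measurable_scaleR) auto
  note [measurable] = this square_integrable_measurable[OF g_sq[OF i, of k]]
  have X: "X \<in> borel_measurable M"
    unfolding X_def by measurable
  have N: "integrable M (\<lambda>w. (norm (noise i k w))\<^sup>2)"
    by (rule square_integrable_norm2[OF noise_square_integrable[OF i]])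
  have ae: "AE w in M. X w = (norm (noise i k w))\<^sup>2"
    using vec_cond_exp_g[OF i, of k] AE_space
    by eventually_elim (simp add: X_def g_eq[OF i])
  show "integrable M X"
    using integrable_cong_AE[OF X _ ae] N by auto
  have "AE w in M. real_cond_exp M (hist k) X w = real_cond_exp M (hist k) (\<lambda>w. (norm (noise i k w))\<^sup>2) w"
    using N by (intro real_cond_exp_cong[OF ae X]) auto
  moreover have "AE w in M. real_cond_exp M (hist k) (\<lambda>w. (norm (noise i k w))\<^sup>2) w \<le> D1i i"
    using gh_variance[OF i, of k] by (simp add: cond_exp_le_def noise_def G_def)
  ultimately show "AE w in M. real_cond_exp M (hist k) X w \<le> D1i i"
    by eventually_elim simp
qed

lemma avg_g_norm2_on:
  assumes B: "B \<in> sets (hist k)"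
  shows "(LINT w|M. indicator B w * (norm (avg n (\<lambda>i. g i k w)))\<^sup>2)
    \<le> (LINT w|M. indicator B w * (2 * L * gap k w + D1 / real n))"
proof -
  have BM: "B \<in> sets M" by (rule sets_hist_M[OF B])
  let ?F = "\<lambda>w. grad f (x k w)"
  have i1: "integrable M (\<lambda>w. indicator B w * (norm (?F w))\<^sup>2)"
    by (intro integrable_indicator_mult square_integrable_norm2 grad_f_sq BM)
  have i2: "integrable M (\<lambda>w. indicator B w * (?F w \<bullet> mean_noise k w))"
    by (intro integrable_indicator_mult square_integrable_inner grad_f_sq mean_noise_sq BM)
  have i3: "integrable M (\<lambda>w. indicator B w * (norm (mean_noise k w))\<^sup>2)"
    by (intro integrable_indicator_mult square_integrable_norm2 mean_noise_sq BM)
  have i4: "integrable M (\<lambda>w. indicator B w * (2 * L * gap k w))"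
    using gap_integrable[of k] by (intro integrable_indicator_mult BM) simp
  have i5: "integrable M (\<lambda>w. indicator B w * (D1 / real n))"
    by (intro integrable_indicator_mult BM) simp
  have "(LINT w|M. indicator B w * (norm (avg n (\<lambda>i. g i k w)))\<^sup>2)
      = (LINT w|M. indicator B w * (norm (?F w))\<^sup>2 + 2 * (indicator B w * (?F w \<bullet> mean_noise k w))
           + indicator B w * (norm (mean_noise k w))\<^sup>2)"
    by (intro Bochner_Integration.integral_cong refl) (simp add: avg_g power2_norm_add inner_commute algebra_simps)
  also have "\<dots> = (LINT w|M. indicator B w * (norm (?F w))\<^sup>2) + (LINT w|M. indicator B w * (norm (mean_noise k w))\<^sup>2)"
    using i1 i2 i3 mean_noise_orthogonal_on[OF grad_f_hist grad_f_sq B] by simp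
  also have "\<dots> \<le> (LINT w|M. indicator B w * (2 * L * gap k w)) + (LINT w|M. indicator B w * (D1 / real n))"
    unfolding D1_def
    by (intro add_mono mean_noise_norm2_on B integral_mono i1 i4 mult_left_mono grad_f_norm2_le) simp
  also have "\<dots> = (LINT w|M. indicator B w * (2 * L * gap k w) + indicator B w * (D1 / real n))"
    using i4 i5 by simp
  finally show ?thesis by (simp add: distrib_left)
qed

section \<open>Consequences of the parameter ranges\<close>

definition \<eta> :: real where "\<eta> = min (\<gamma> * \<mu> / 2) (\<alpha> / 4)"

lemma \<omega>_pos: "0 < \<omega>" using quantization by (simp add: quantization_operator_def)

lemma \<delta>_pos: "0 < \<delta>" and \<delta>_le_1: "\<delta> \<le> 1" using compression by (auto simp: compression_operator_def)

lemma \<alpha>_\<omega>_le_1: "\<alpha> * (\<omega> + 1) \<le> 1"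
  using \<alpha>_le \<omega>_pos by (simp add: field_simps)

lemma \<alpha>_less_1: "\<alpha> < 1"
proof -
  have "1 / (\<omega> + 1) < 1" using \<omega>_pos by simp
  then show ?thesis using \<alpha>_le by linarith
qed

lemma \<gamma>L_le_quarter: "\<gamma> * L \<le> 1 / 4"
  using \<gamma>_le L_pos by (simp add: field_simps)

text \<open>The factor \<open>(1 - \<alpha>) / (3 - \<alpha>)\<close> in the step size bound is at most \<open>1/3\<close>.\<close>

lemma \<gamma>L_power2_le: "(\<gamma> * L)\<^sup>2 \<le> \<delta>\<^sup>2 / 1152"
proof -
  have "\<gamma> \<le> \<delta> * sqrt (1 - \<alpha>) / (8 * L * sqrt (6 * (3 - \<alpha>)))" using \<gamma>_le by simp
  then have "\<gamma> * (8 * L * sqrt (6 * (3 - \<alpha>))) \<le> \<delta> * sqrt (1 - \<alpha>)"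
    using L_pos \<alpha>_less_1 by (subst (asm) pos_le_divide_eq) auto
  moreover have "0 \<le> \<gamma> * (8 * L * sqrt (6 * (3 - \<alpha>)))" using \<gamma>_pos L_pos \<alpha>_less_1 by simp
  ultimately have "(\<gamma> * (8 * L * sqrt (6 * (3 - \<alpha>))))\<^sup>2 \<le> (\<delta> * sqrt (1 - \<alpha>))\<^sup>2"
    by (rule power_mono)
  moreover have "(\<gamma> * (8 * L * sqrt (6 * (3 - \<alpha>))))\<^sup>2 = 384 * (\<gamma> * L)\<^sup>2 * (3 - \<alpha>)"
    using \<alpha>_less_1 by (simp add: power_mult_distrib)
  moreover have "(\<delta> * sqrt (1 - \<alpha>))\<^sup>2 = \<delta>\<^sup>2 * (1 - \<alpha>)"
    using \<alpha>_less_1 by (simp add: power_mult_distrib)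
  moreover have "\<delta>\<^sup>2 * (1 - \<alpha>) \<le> \<delta>\<^sup>2 * ((3 - \<alpha>) / 3)"
    using \<alpha>_pos by (intro mult_left_mono) auto
  ultimately have "(384 * (\<gamma> * L)\<^sup>2) * (3 - \<alpha>) \<le> (\<delta>\<^sup>2 / 3) * (3 - \<alpha>)" by simp
  then have "384 * (\<gamma> * L)\<^sup>2 \<le> \<delta>\<^sup>2 / 3"
    using \<alpha>_less_1 by (subst (asm) mult_le_cancel_right_pos) auto
  then show ?thesis by simp
qed

lemma \<gamma>L_le: "\<gamma> * L \<le> \<delta> / 24"
proof (rule power2_le_imp_le)
  show "(\<gamma> * L)\<^sup>2 \<le> (\<delta> / 24)\<^sup>2"
    using \<gamma>L_power2_le by (simp add: power_divide) (smt (verit) zero_le_power2)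
  show "0 \<le> \<delta> / 24" using \<delta>_pos by simp
qed

lemma \<eta>_nonneg: "0 \<le> \<eta>" and \<eta>_le_\<alpha>: "\<eta> \<le> \<alpha> / 4" and \<eta>_le_\<mu>: "\<eta> \<le> \<gamma> * \<mu> / 2"
  using \<gamma>_pos \<mu>_nonneg \<alpha>_pos by (auto simp: \<eta>_def)

lemma \<eta>_less_1: "\<eta> < 1" using \<eta>_le_\<alpha> \<alpha>_less_1 by linarith

lemma \<eta>_le_\<delta>: "\<eta> \<le> \<delta> / 24"
proof -
  have "\<gamma> * \<mu> \<le> \<gamma> * L" using \<gamma>_pos \<mu>_le_L by (intro mult_left_mono) auto
  then show ?thesis using \<eta>_le_\<mu> \<gamma>L_le \<gamma>_pos \<delta>_pos by linarith
qed

section \<open>Contraction of the gradient estimators\<close>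

text \<open>With \<open>u = h - hs\<close>, \<open>y = G - h\<close> and \<open>c = \<alpha>\<^sup>2 (\<omega> + 1)\<close>, the mean square after the update is bounded by
  \<open>\<parallel>u\<parallel>\<^sup>2 + 2 \<alpha> u \<bullet> y + c \<parallel>y\<parallel>\<^sup>2\<close> plus noise. Since \<open>c \<le> \<alpha>\<close>, the first part is at most
  \<open>\<parallel>u\<parallel>\<^sup>2 + 2 \<alpha> u \<bullet> y + \<alpha> \<parallel>y\<parallel>\<^sup>2 = (1 - \<alpha>) \<parallel>u\<parallel>\<^sup>2 + \<alpha> \<parallel>u + y\<parallel>\<^sup>2\<close>, and \<open>u + y = G - hs\<close>.\<close>

lemma h_step_norm2_on:
  assumes i: "i \<in> {1..n}" and B: "B \<in> sets (hist k)"
  shows "(LINT w|M. indicator B w * (norm (h i (Suc k) w - hs i))\<^sup>2)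
    \<le> (LINT w|M. indicator B w * ((1 - \<alpha>) * (norm (h i k w - hs i))\<^sup>2
          + \<alpha> * (norm (G i k w - hs i))\<^sup>2 + \<alpha>\<^sup>2 * (\<omega> + 1) * D1i i))"
proof -
  define u where "u w = h i k w - hs i" for w
  define y where "y w = G i k w - h i k w" for w
  define \<xi> where "\<xi> w = noise i k w" for w
  define c where "c = \<alpha>\<^sup>2 * (\<omega> + 1)"
  define V where "V w = \<alpha> *\<^sub>R u w + c *\<^sub>R y w" for w
  define T where "T w = (1 - \<alpha>) * (norm (u w))\<^sup>2 + \<alpha> * (norm (G i k w - hs i))\<^sup>2" for w
  have BM: "B \<in> sets M" by (rule sets_hist_M[OF B])
  have c: "0 \<le> c" "c \<le> \<alpha>"
  proof -
    show "0 \<le> c" using \<omega>_pos by (simp add: c_def)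
    have "\<alpha> * (\<alpha> * (\<omega> + 1)) \<le> \<alpha> * 1" using \<alpha>_\<omega>_le_1 \<alpha>_pos by (intro mult_left_mono) auto
    then show "c \<le> \<alpha>" by (simp add: c_def power2_eq_square mult.assoc)
  qed
  have u: "square_integrable M u" "u \<in> borel_measurable (hist k)"
    unfolding u_def using h_hs_sq[OF i] h_hist[OF i] by auto
  have y: "square_integrable M y" "y \<in> borel_measurable (hist k)"
    unfolding y_def using square_integrable_diff[OF G_sq[OF i] h_sq[OF i]]
      borel_measurable_diff[OF G_hist[OF i] h_hist[OF i]] by auto
  have V: "square_integrable M V" "V \<in> borel_measurable (hist k)"
    unfolding V_def using u y
    by (auto intro: square_integrable_add square_integrable_scaleR)
  have z: "square_integrable M (\<lambda>w. gh i k w - h i k w)" "(\<lambda>w. gh i k w - h i k w) \<in> borel_measurable (pre k)"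
    using square_integrable_diff[OF gh_sq[OF i] h_sq[OF i]]
      borel_measurable_diff[OF gh_measurable_pre[OF i] hist_pre[OF h_hist[OF i]]] by auto
  have \<xi>: "square_integrable M \<xi>"
    unfolding \<xi>_def by (rule noise_square_integrable[OF i])
  have T: "integrable M T"
    unfolding T_def
    using square_integrable_norm2[OF u(1)]
      square_integrable_norm2[OF square_integrable_diff[OF G_sq[OF i, of k] square_integrable_const[of "hs i"]]]
    by simp
  have iT: "integrable M (\<lambda>w. indicator B w * T w)"
    by (rule integrable_indicator_mult[OF T BM])
  have iV: "integrable M (\<lambda>w. indicator B w * (V w \<bullet> \<xi> w))"
    by (intro integrable_indicator_mult square_integrable_inner V \<xi> BM)
  have i\<xi>: "integrable M (\<lambda>w. indicator B w * (norm (\<xi> w))\<^sup>2)"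
    by (intro integrable_indicator_mult square_integrable_norm2 \<xi> BM)
  have iD: "integrable M (\<lambda>w. indicator B w * D1i i)"
    by (intro integrable_indicator_mult BM) simp
  have bound: "(norm (u w + \<alpha> *\<^sub>R (gh i k w - h i k w)))\<^sup>2 + \<alpha>\<^sup>2 * \<omega> * (norm (gh i k w - h i k w))\<^sup>2
      \<le> T w + 2 * (V w \<bullet> \<xi> w) + c * (norm (\<xi> w))\<^sup>2" for w
  proof -
    have z: "gh i k w - h i k w = y w + \<xi> w" by (simp add: y_def \<xi>_def gh_eq)
    have "(norm (u w + \<alpha> *\<^sub>R (y w + \<xi> w)))\<^sup>2 + \<alpha>\<^sup>2 * \<omega> * (norm (y w + \<xi> w))\<^sup>2
        = (norm (u w))\<^sup>2 + 2 * \<alpha> * (u w \<bullet> (y w + \<xi> w)) + c * (norm (y w + \<xi> w))\<^sup>2"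
      by (simp only: power2_norm_add[of "u w"] norm_scaleR_power2 inner_scaleR_right c_def)
         (simp add: distrib_right distrib_left)
    also have "\<dots> = ((norm (u w))\<^sup>2 + 2 * \<alpha> * (u w \<bullet> y w) + c * (norm (y w))\<^sup>2)
        + 2 * (V w \<bullet> \<xi> w) + c * (norm (\<xi> w))\<^sup>2"
      by (simp add: power2_norm_add V_def inner_add_left inner_add_right inner_commute algebra_simps)
    also have "(norm (u w))\<^sup>2 + 2 * \<alpha> * (u w \<bullet> y w) + c * (norm (y w))\<^sup>2 \<le> T w"
    proof -
      have "G i k w - hs i = u w + y w" by (simp add: u_def y_def)
      then have "T w = (norm (u w))\<^sup>2 + 2 * \<alpha> * (u w \<bullet> y w) + \<alpha> * (norm (y w))\<^sup>2"
        by (simp add: T_def power2_norm_add algebra_simps)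
      moreover have "c * (norm (y w))\<^sup>2 \<le> \<alpha> * (norm (y w))\<^sup>2"
        using c by (intro mult_right_mono) auto
      ultimately show ?thesis by simp
    qed
    finally show ?thesis unfolding z by simp
  qed
  have "(LINT w|M. indicator B w * (norm (h i (Suc k) w - hs i))\<^sup>2)
      = (LINT w|M. indicator B w * (norm (u w + \<alpha> *\<^sub>R Q (sQ i k w) (gh i k w - h i k w)))\<^sup>2)"
    by (intro Bochner_Integration.integral_cong refl) (simp add: h_step[OF i] u_def algebra_simps)
  also have "\<dots> \<le> (LINT w|M. indicator B w * ((norm (u w + \<alpha> *\<^sub>R (gh i k w - h i k w)))\<^sup>2
      + \<alpha>\<^sup>2 * \<omega> * (norm (gh i k w - h i k w))\<^sup>2))"
    by (rule quantization_step(2)[OF i hist_pre[OF u(2)] u(1) z(2,1) sets_hist_pre[OF B]])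
  also have "\<dots> \<le> (LINT w|M. indicator B w * T w + 2 * (indicator B w * (V w \<bullet> \<xi> w))
      + c * (indicator B w * (norm (\<xi> w))\<^sup>2))"
  proof (rule integral_mono)
    show "integrable M (\<lambda>w. indicator B w * ((norm (u w + \<alpha> *\<^sub>R (gh i k w - h i k w)))\<^sup>2
      + \<alpha>\<^sup>2 * \<omega> * (norm (gh i k w - h i k w))\<^sup>2))"
      using square_integrable_norm2[OF square_integrable_add[OF u(1) square_integrable_scaleR[OF z(1)]]]
        square_integrable_norm2[OF z(1)] by (intro integrable_indicator_mult BM) simp
    show "integrable M (\<lambda>w. indicator B w * T w + 2 * (indicator B w * (V w \<bullet> \<xi> w)) + c * (indicator B w * (norm (\<xi> w))\<^sup>2))"
      using iT iV i\<xi> by simp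
    fix w
    show "indicator B w * ((norm (u w + \<alpha> *\<^sub>R (gh i k w - h i k w)))\<^sup>2 + \<alpha>\<^sup>2 * \<omega> * (norm (gh i k w - h i k w))\<^sup>2)
      \<le> indicator B w * T w + 2 * (indicator B w * (V w \<bullet> \<xi> w)) + c * (indicator B w * (norm (\<xi> w))\<^sup>2)"
      using bound[of w] by (cases "w \<in> B") auto
  qed
  also have "\<dots> = (LINT w|M. indicator B w * T w) + c * (LINT w|M. indicator B w * (norm (\<xi> w))\<^sup>2)"
    using iT iV i\<xi> noise_orthogonal_on[OF i V(2,1) B] by (simp add: \<xi>_def)
  also have "\<dots> \<le> (LINT w|M. indicator B w * T w) + c * (LINT w|M. indicator B w * D1i i)"
    unfolding \<xi>_def using c(1) noise_norm2_on[OF i B] by (intro add_left_mono mult_left_mono)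
  also have "\<dots> = (LINT w|M. indicator B w * T w + c * (indicator B w * D1i i))"
    using iT iD by simp
  also have "\<dots> = (LINT w|M. indicator B w * (T w + c * D1i i))"
    by (intro Bochner_Integration.integral_cong refl) (simp add: algebra_simps)
  finally show ?thesis by (simp add: T_def u_def c_def)
qed

lemma \<sigma>2_step_on:
  assumes B: "B \<in> sets (hist k)"
  shows "(LINT w|M. indicator B w * \<sigma>2 (Suc k) w)
    \<le> (LINT w|M. indicator B w * ((1 - \<alpha>) * \<sigma>2 k w + 2 * (L * \<alpha>) * gap k w + \<alpha>\<^sup>2 * (\<omega> + 1) * D1))"
proof -
  have BM: "B \<in> sets M" by (rule sets_hist_M[OF B])
  define Y where "Y i w = (1 - \<alpha>) * (norm (h i k w - hs i))\<^sup>2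
          + \<alpha> * (norm (G i k w - hs i))\<^sup>2 + \<alpha>\<^sup>2 * (\<omega> + 1) * D1i i" for i w
  have Y: "integrable M (Y i)" if i: "i \<in> {1..n}" for i
    unfolding Y_def[abs_def] using square_integrable_norm2[OF h_hs_sq[OF i, of k]]
      square_integrable_norm2[OF square_integrable_diff[OF G_sq[OF i, of k] square_integrable_const[of "hs i"]]]
    by simp
  have "(LINT w|M. indicator B w * \<sigma>2 (Suc k) w)
      = (LINT w|M. avg n (\<lambda>i. indicator B w * (norm (h i (Suc k) w - hs i))\<^sup>2))"
    by (simp add: \<sigma>2_def avg_mult_left)
  also have "\<dots> = avg n (\<lambda>i. LINT w|M. indicator B w * (norm (h i (Suc k) w - hs i))\<^sup>2)"
    by (intro integral_avg integrable_indicator_mult square_integrable_norm2 h_hs_sq BM)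
  also have "\<dots> \<le> avg n (\<lambda>i. LINT w|M. indicator B w * Y i w)"
    unfolding Y_def by (intro avg_mono h_step_norm2_on B)
  also have "\<dots> = (LINT w|M. avg n (\<lambda>i. indicator B w * Y i w))"
    by (intro integral_avg[symmetric] integrable_indicator_mult Y BM)
  also have "\<dots> = (LINT w|M. indicator B w * avg n (\<lambda>i. Y i w))"
    by (simp add: avg_mult_left)
  also have "\<dots> \<le> (LINT w|M. indicator B w * ((1 - \<alpha>) * \<sigma>2 k w + 2 * (L * \<alpha>) * gap k w + \<alpha>\<^sup>2 * (\<omega> + 1) * D1))"
  proof (rule integral_mono)
    show "integrable M (\<lambda>w. indicator B w * avg n (\<lambda>i. Y i w))"
      by (intro integrable_indicator_mult integrable_avg Y BM)
    show "integrable M (\<lambda>w. indicator B w * ((1 - \<alpha>) * \<sigma>2 k w + 2 * (L * \<alpha>) * gap k w + \<alpha>\<^sup>2 * (\<omega> + 1) * D1))"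
      using \<sigma>2_integrable[of k] gap_integrable[of k] by (intro integrable_indicator_mult BM) simp
    fix w
    have "avg n (\<lambda>i. Y i w) = (1 - \<alpha>) * \<sigma>2 k w + \<alpha> * avg n (\<lambda>i. (norm (G i k w - hs i))\<^sup>2) + \<alpha>\<^sup>2 * (\<omega> + 1) * D1"
      by (simp only: Y_def avg_add avg_mult_left \<sigma>2_def D1_def)
    moreover have "\<alpha> * avg n (\<lambda>i. (norm (G i k w - hs i))\<^sup>2) \<le> \<alpha> * (2 * L * gap k w)"
      using \<alpha>_pos by (intro mult_left_mono avg_G_diff_norm2_le) simp
    ultimately have "avg n (\<lambda>i. Y i w) \<le> (1 - \<alpha>) * \<sigma>2 k w + 2 * (L * \<alpha>) * gap k w + \<alpha>\<^sup>2 * (\<omega> + 1) * D1"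
      by (simp add: mult_ac)
    then show "indicator B w * avg n (\<lambda>i. Y i w)
        \<le> indicator B w * ((1 - \<alpha>) * \<sigma>2 k w + 2 * (L * \<alpha>) * gap k w + \<alpha>\<^sup>2 * (\<omega> + 1) * D1)"
      by (intro mult_left_mono) simp_all
  qed
  finally show ?thesis .
qed

section \<open>Expected recursions\<close>

definition r :: "nat \<Rightarrow> real" where "r k = (LINT w|M. gap k w)"
definition s :: "nat \<Rightarrow> real" where "s k = (LINT w|M. \<sigma>2 k w)"

text \<open>The squared errors are averaged, instead of squaring the mean error, because the compressor
  contracts the error of each worker separately.\<close>

definition \<epsilon> :: "nat \<Rightarrow> real" where "\<epsilon> k = (LINT w|M. avg n (\<lambda>i. (norm (e i k w))\<^sup>2))"

lemma r_nonneg: "0 \<le> r k" unfolding r_def by (intro Bochner_Integration.integral_nonneg gap_nonneg)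
lemma s_nonneg: "0 \<le> s k" unfolding s_def by (intro Bochner_Integration.integral_nonneg \<sigma>2_nonneg)
lemma \<epsilon>_nonneg: "0 \<le> \<epsilon> k" unfolding \<epsilon>_def by (intro Bochner_Integration.integral_nonneg avg_nonneg) simp

lemma integral_indicator_space: "(LINT w|M. indicator (space M) w * X w) = (LINT w|M. X w)"
  for X :: "'w \<Rightarrow> real"
  by (intro Bochner_Integration.integral_cong) auto

lemma s_step: "s (Suc k) \<le> (1 - \<alpha>) * s k + (2 * (L * \<alpha>) * r k + \<alpha>\<^sup>2 * (\<omega> + 1) * D1)"
  using \<sigma>2_step_on[OF space_in_past, of k] \<sigma>2_integrable[of k] gap_integrable[of k]
  by (simp add: integral_indicator_space s_def r_def prob_space)

text \<open>The Young parameter \<open>\<delta>/3\<close> leaves the contraction factor \<open>(1 - \<delta>) (1 + \<delta>/3) \<le> 1 - 2\<delta>/3\<close>.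
  The noise in \<open>g i\<close> is kept out of Young's inequality by orthogonality and enters with factor \<open>1\<close>.\<close>

lemma error_step_worker:
  assumes i: "i \<in> {1..n}"
  shows "(LINT w|M. (norm (e i (Suc k) w))\<^sup>2) \<le> (1 - 2 * \<delta> / 3) * (LINT w|M. (norm (e i k w))\<^sup>2)
    + 3 / \<delta> * \<gamma>\<^sup>2 * (LINT w|M. (norm (gb i k w))\<^sup>2) + \<gamma>\<^sup>2 * D1i i"
proof -
  define p where "p w = e i k w + \<gamma> *\<^sub>R gb i k w" for w
  define y where "y w = e i k w + \<gamma> *\<^sub>R g i k w" for w
  define a where "a = (LINT w|M. (norm (e i k w))\<^sup>2)"
  define b where "b = (LINT w|M. (norm (gb i k w))\<^sup>2)"
  define N where "N = (LINT w|M. (norm (noise i k w))\<^sup>2)"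
  have p: "square_integrable M p" "p \<in> borel_measurable (hist k)"
    unfolding p_def using e_sq[OF i, of k] gb_sq[OF i, of k] e_hist[OF i, of k] gb_hist[OF i, of k]
    by (auto intro: square_integrable_add square_integrable_scaleR)
  have y: "square_integrable M y" "y \<in> borel_measurable (pre k)"
    unfolding y_def using e_sq[OF i, of k] g_sq[OF i, of k] hist_pre[OF e_hist[OF i, of k]] g_pre[OF i, of k]
    by (auto intro: square_integrable_add square_integrable_scaleR)
  have ab: "0 \<le> a" "0 \<le> b" unfolding a_def b_def by auto
  have N: "N \<le> D1i i"
    using noise_norm2_on[OF i space_in_past, of k] by (simp add: integral_indicator_space N_def prob_space)
  have "(LINT w|M. (norm (e i (Suc k) w))\<^sup>2) = (LINT w|M. (norm (C (sC i k w) (y w) - y w))\<^sup>2)"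
    by (intro Bochner_Integration.integral_cong refl)
       (simp add: e_step[OF i] v_step[OF i] y_def norm_minus_commute)
  also have "\<dots> \<le> (1 - \<delta>) * (LINT w|M. (norm (y w))\<^sup>2)"
    by (rule compression_error(2)[OF i y(2,1)])
  also have "(LINT w|M. (norm (y w))\<^sup>2)
      = (LINT w|M. (norm (p w))\<^sup>2 + 2 * \<gamma> * (p w \<bullet> noise i k w) + \<gamma>\<^sup>2 * (norm (noise i k w))\<^sup>2)"
  proof (intro Bochner_Integration.integral_cong refl)
    fix w assume "w \<in> space M"
    then have "y w = p w + \<gamma> *\<^sub>R noise i k w" by (simp add: y_def p_def g_eq[OF i] algebra_simps)
    then show "(norm (y w))\<^sup>2 = (norm (p w))\<^sup>2 + 2 * \<gamma> * (p w \<bullet> noise i k w) + \<gamma>\<^sup>2 * (norm (noise i k w))\<^sup>2"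
      by (simp add: power2_norm_add norm_scaleR_power2 del: norm_scaleR)
  qed
  also have "\<dots> = (LINT w|M. (norm (p w))\<^sup>2) + \<gamma>\<^sup>2 * N"
    using square_integrable_norm2[OF p(1)] square_integrable_inner[OF p(1) noise_square_integrable[OF i, of k]]
      square_integrable_norm2[OF noise_square_integrable[OF i, of k]] noise_orthogonal[OF i p(2,1)]
    by (simp add: N_def)
  also have "(1 - \<delta>) * \<dots> \<le> (1 - \<delta>) * (((1 + \<delta> / 3) * a + (1 + 3 / \<delta>) * \<gamma>\<^sup>2 * b) + \<gamma>\<^sup>2 * D1i i)"
  proof (intro mult_left_mono add_mono N)
    have "(LINT w|M. (norm (p w))\<^sup>2)
        \<le> (LINT w|M. (1 + \<delta> / 3) * (norm (e i k w))\<^sup>2 + (1 + 3 / \<delta>) * \<gamma>\<^sup>2 * (norm (gb i k w))\<^sup>2)"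
    proof (rule integral_mono)
      fix w
      show "(norm (p w))\<^sup>2 \<le> (1 + \<delta> / 3) * (norm (e i k w))\<^sup>2 + (1 + 3 / \<delta>) * \<gamma>\<^sup>2 * (norm (gb i k w))\<^sup>2"
        using young_norm2[of "\<delta> / 3" "e i k w" "\<gamma> *\<^sub>R gb i k w"] \<delta>_pos
        by (simp add: p_def norm_scaleR_power2 mult.assoc del: norm_scaleR)
    qed (use square_integrable_norm2[OF p(1)] square_integrable_norm2[OF e_sq[OF i, of k]]
           square_integrable_norm2[OF gb_sq[OF i, of k]] in auto)
    then show "(LINT w|M. (norm (p w))\<^sup>2) \<le> (1 + \<delta> / 3) * a + (1 + 3 / \<delta>) * \<gamma>\<^sup>2 * b"
      using square_integrable_norm2[OF e_sq[OF i, of k]] square_integrable_norm2[OF gb_sq[OF i, of k]]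
      by (simp add: a_def b_def)
  qed (use \<delta>_le_1 in auto)
  also have "\<dots> = ((1 - \<delta>) * (1 + \<delta> / 3)) * a + ((1 - \<delta>) * (1 + 3 / \<delta>)) * (\<gamma>\<^sup>2 * b) + (1 - \<delta>) * (\<gamma>\<^sup>2 * D1i i)"
    by (simp add: algebra_simps)
  also have "\<dots> \<le> (1 - 2 * \<delta> / 3) * a + (3 / \<delta>) * (\<gamma>\<^sup>2 * b) + 1 * (\<gamma>\<^sup>2 * D1i i)"
  proof (intro add_mono mult_right_mono)
    show "(1 - \<delta>) * (1 + \<delta> / 3) \<le> 1 - 2 * \<delta> / 3" by (simp add: algebra_simps)
    show "(1 - \<delta>) * (1 + 3 / \<delta>) \<le> 3 / \<delta>" using \<delta>_pos by (simp add: field_simps)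
  qed (use ab \<delta>_pos D1i_nonneg[OF i] in auto)
  finally show ?thesis by (simp add: a_def b_def mult.assoc)
qed

text \<open>The Young parameter \<open>5\<close> shifts weight from the gradient estimator error to the function gap,
  for which the error bound has room to spare.\<close>

lemma \<epsilon>_step: "\<epsilon> (Suc k) \<le> (1 - 2 * \<delta> / 3) * \<epsilon> k
    + (3 / \<delta> * \<gamma>\<^sup>2 * (12 * L * r k + 6 / 5 * s k) + \<gamma>\<^sup>2 * D1)"
proof -
  have \<epsilon>: "\<epsilon> k = avg n (\<lambda>i. LINT w|M. (norm (e i k w))\<^sup>2)" for k
    unfolding \<epsilon>_def by (intro integral_avg square_integrable_norm2 e_sq)
  have "avg n (\<lambda>i. LINT w|M. (norm (gb i k w))\<^sup>2) = (LINT w|M. avg n (\<lambda>i. (norm (gb i k w))\<^sup>2))"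
    by (intro integral_avg[symmetric] square_integrable_norm2 gb_sq)
  also have "\<dots> \<le> (LINT w|M. 12 * L * gap k w + 6 / 5 * \<sigma>2 k w)"
  proof (rule integral_mono)
    show "avg n (\<lambda>i. (norm (gb i k w))\<^sup>2) \<le> 12 * L * gap k w + 6 / 5 * \<sigma>2 k w" for w
      using avg_gb_norm2_le[of 5 k w] by simp
    show "integrable M (\<lambda>w. avg n (\<lambda>i. (norm (gb i k w))\<^sup>2))"
      by (intro integrable_avg square_integrable_norm2 gb_sq)
    show "integrable M (\<lambda>w. 12 * L * gap k w + 6 / 5 * \<sigma>2 k w)"
      using gap_integrable[of k] \<sigma>2_integrable[of k] by simp
  qed
  also have "\<dots> = 12 * L * r k + 6 / 5 * s k"
    using gap_integrable[of k] \<sigma>2_integrable[of k] by (simp add: r_def s_def)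
  finally have gb: "3 / \<delta> * \<gamma>\<^sup>2 * avg n (\<lambda>i. LINT w|M. (norm (gb i k w))\<^sup>2)
      \<le> 3 / \<delta> * \<gamma>\<^sup>2 * (12 * L * r k + 6 / 5 * s k)"
    using \<delta>_pos by (intro mult_left_mono) auto
  have "\<epsilon> (Suc k) \<le> avg n (\<lambda>i. (1 - 2 * \<delta> / 3) * (LINT w|M. (norm (e i k w))\<^sup>2)
    + 3 / \<delta> * \<gamma>\<^sup>2 * (LINT w|M. (norm (gb i k w))\<^sup>2) + \<gamma>\<^sup>2 * D1i i)"
    unfolding \<epsilon> by (intro avg_mono error_step_worker)
  also have "\<dots> = (1 - 2 * \<delta> / 3) * \<epsilon> k + 3 / \<delta> * \<gamma>\<^sup>2 * avg n (\<lambda>i. LINT w|M. (norm (gb i k w))\<^sup>2) + \<gamma>\<^sup>2 * D1"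
    by (simp only: avg_add avg_mult_left \<epsilon> D1_def)
  finally show ?thesis using gb by simp
qed

section \<open>Accumulated compression error\<close>

definition W :: "nat \<Rightarrow> real" where "W K = wgt_sum \<eta> K"

definition F1 :: real where "F1 = 96 * L * \<gamma>\<^sup>2 / (\<delta>\<^sup>2 * \<alpha> * (1 - \<eta>))"

definition D3 :: real where "D3 = 6 * L * \<gamma> / \<delta> * (4 * \<alpha> * (\<omega> + 1) / \<delta> + 1) * D1"

lemma W_eq: "W K = (\<Sum>k=0..K. wgt \<eta> k)"
  by (simp add: W_def wgt_sum_def)

lemma W_ge_wgt: "wgt \<eta> K \<le> W K"
  unfolding W_eq by (rule member_le_sum) (auto intro: less_imp_le wgt_pos[OF \<eta>_less_1])

lemma W_pos: "0 < W K"
  using W_ge_wgt wgt_pos[OF \<eta>_less_1] by (rule less_le_trans[rotated])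

lemma F1_nonneg: "0 \<le> F1"
  using L_pos \<alpha>_pos \<eta>_less_1 by (simp add: F1_def)

lemma weighted_\<sigma>2_sum:
  "(\<Sum>k=0..K. wgt \<eta> k * s k) \<le> 4 / (3 * \<alpha>) * s 0 + 8 / 3 * L * (\<Sum>k=0..K. wgt \<eta> k * r k)
     + 4 / 3 * (\<alpha> * (\<omega> + 1)) * D1 * W K"
proof -
  define X where "X = (\<Sum>k=0..K. wgt \<eta> k * s k)"
  define Y where "Y = (\<Sum>k=0..K. wgt \<eta> k * r k)"
  have X: "0 \<le> X"
    unfolding X_def by (intro sum_nonneg mult_nonneg_nonneg s_nonneg less_imp_le wgt_pos \<eta>_less_1)
  have "(1 - \<eta> - (1 - \<alpha>)) * X \<le> s 0 + (\<Sum>k=0..K. wgt \<eta> k * (2 * (L * \<alpha>) * r k + \<alpha>\<^sup>2 * (\<omega> + 1) * D1))"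
    unfolding X_def
  proof (rule weighted_sum_recursion[OF \<eta>_less_1])
    show "s (Suc k) \<le> (1 - \<alpha>) * s k + (2 * (L * \<alpha>) * r k + \<alpha>\<^sup>2 * (\<omega> + 1) * D1)" for k
      by (rule s_step)
    show "0 \<le> 2 * (L * \<alpha>) * r k + \<alpha>\<^sup>2 * (\<omega> + 1) * D1" for k
      using L_pos \<alpha>_pos r_nonneg[of k] \<omega>_pos D1_nonneg by simp
  qed (use \<alpha>_less_1 s_nonneg in simp_all)
  also have "(\<Sum>k=0..K. wgt \<eta> k * (2 * (L * \<alpha>) * r k + \<alpha>\<^sup>2 * (\<omega> + 1) * D1))
      = 2 * (L * \<alpha>) * Y + \<alpha>\<^sup>2 * (\<omega> + 1) * D1 * W K"
    unfolding Y_def W_eq distrib_left sum.distrib sum_distrib_left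
    by (intro arg_cong2[where f="(+)"] sum.cong refl) (simp_all add: mult_ac)
  finally have "(\<alpha> - \<eta>) * X \<le> s 0 + 2 * (L * \<alpha>) * Y + \<alpha>\<^sup>2 * (\<omega> + 1) * D1 * W K" by simp
  moreover have "(3 * \<alpha> / 4) * X \<le> (\<alpha> - \<eta>) * X"
    using \<eta>_le_\<alpha> X by (intro mult_right_mono) auto
  ultimately have "(3 * \<alpha> / 4) * X \<le> s 0 + 2 * (L * \<alpha>) * Y + \<alpha>\<^sup>2 * (\<omega> + 1) * D1 * W K" by simp
  then have "4 / (3 * \<alpha>) * ((3 * \<alpha> / 4) * X)
      \<le> 4 / (3 * \<alpha>) * (s 0 + 2 * (L * \<alpha>) * Y + \<alpha>\<^sup>2 * (\<omega> + 1) * D1 * W K)"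
    using \<alpha>_pos by (intro mult_left_mono) auto
  also have "4 / (3 * \<alpha>) * ((3 * \<alpha> / 4) * X) = X" using \<alpha>_pos by simp
  also have "4 / (3 * \<alpha>) * (s 0 + 2 * (L * \<alpha>) * Y + \<alpha>\<^sup>2 * (\<omega> + 1) * D1 * W K)
      = 4 / (3 * \<alpha>) * s 0 + 8 / 3 * L * Y + 4 / 3 * (\<alpha> * (\<omega> + 1)) * D1 * W K"
    using \<alpha>_pos by (simp add: field_simps power2_eq_square)
  finally show ?thesis by (simp add: X_def Y_def)
qed

lemma \<epsilon>_0: "\<epsilon> 0 = 0"
proof -
  have "\<epsilon> 0 = (LINT w|M. 0)"
    unfolding \<epsilon>_def
  proof (intro Bochner_Integration.integral_cong refl)
    fix w assume "w \<in> space M"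
    then have "avg n (\<lambda>i. (norm (e i 0 w))\<^sup>2) = avg n (\<lambda>i. 0 :: real)"
      by (intro avg_cong) (simp add: e_init)
    then show "avg n (\<lambda>i. (norm (e i 0 w))\<^sup>2) = 0" by (simp add: avg_def)
  qed
  then show ?thesis by simp
qed

text \<open>Both recursions are solved for their weighted sums, and the bound for \<open>\<sigma>2\<close> is inserted into the
  one for the error. The coefficients of the gap, of \<open>s 0\<close> and of the two noise terms come out as
  \<open>72/5 * 76/5 / 1152\<close>, \<open>72/5 * 8/5\<close> (twice) and \<open>24/5\<close>, below the claimed \<open>1/4\<close>, \<open>96\<close>, \<open>24\<close> and
  \<open>6\<close>.\<close>

lemma weighted_error_sum:
  "3 * L * (\<Sum>k=0..K. wgt \<eta> k * \<epsilon> k)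
    \<le> 1 / 4 * (\<Sum>k=0..K. wgt \<eta> k * r k) + F1 * s 0 + \<gamma> * D3 * W K"
proof -
  define X where "X = (\<Sum>k=0..K. wgt \<eta> k * \<epsilon> k)"
  define Y where "Y = (\<Sum>k=0..K. wgt \<eta> k * r k)"
  define Z where "Z = (\<Sum>k=0..K. wgt \<eta> k * s k)"
  define q where "q = \<alpha> * (\<omega> + 1)"
  have q: "0 \<le> q" using \<alpha>_pos \<omega>_pos by (simp add: q_def)
  have X: "0 \<le> X" and Y: "0 \<le> Y"
    unfolding X_def Y_def
    by (intro sum_nonneg mult_nonneg_nonneg \<epsilon>_nonneg r_nonneg less_imp_le wgt_pos \<eta>_less_1)+
  have "(1 - \<eta> - (1 - 2 * \<delta> / 3)) * X \<le> \<epsilon> 0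
      + (\<Sum>k=0..K. wgt \<eta> k * (3 / \<delta> * \<gamma>\<^sup>2 * (12 * L * r k + 6 / 5 * s k) + \<gamma>\<^sup>2 * D1))"
    unfolding X_def
  proof (rule weighted_sum_recursion[OF \<eta>_less_1])
    show "\<epsilon> (Suc k) \<le> (1 - 2 * \<delta> / 3) * \<epsilon> k
        + (3 / \<delta> * \<gamma>\<^sup>2 * (12 * L * r k + 6 / 5 * s k) + \<gamma>\<^sup>2 * D1)" for k
      by (rule \<epsilon>_step)
    show "0 \<le> 3 / \<delta> * \<gamma>\<^sup>2 * (12 * L * r k + 6 / 5 * s k) + \<gamma>\<^sup>2 * D1" for k
      using L_pos \<delta>_pos r_nonneg[of k] s_nonneg[of k] D1_nonneg by simp
  qed (use \<delta>_le_1 \<epsilon>_nonneg in simp_all)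
  also have "(\<Sum>k=0..K. wgt \<eta> k * (3 / \<delta> * \<gamma>\<^sup>2 * (12 * L * r k + 6 / 5 * s k) + \<gamma>\<^sup>2 * D1))
      = 3 / \<delta> * \<gamma>\<^sup>2 * (12 * L * Y + 6 / 5 * Z) + \<gamma>\<^sup>2 * D1 * W K"
    unfolding Y_def Z_def W_eq distrib_left sum.distrib sum_distrib_left
    by (intro arg_cong2[where f="(+)"] sum.cong refl) (simp_all add: mult_ac)
  finally have "(2 * \<delta> / 3 - \<eta>) * X \<le> 3 / \<delta> * \<gamma>\<^sup>2 * (12 * L * Y + 6 / 5 * Z) + \<gamma>\<^sup>2 * D1 * W K"
    by (simp add: \<epsilon>_0)
  \<comment> \<open>\<open>\<eta> \<le> \<delta>/24\<close> and \<open>2/3 - 1/24 = 5/8\<close>.\<close>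
  moreover have "(5 * \<delta> / 8) * X \<le> (2 * \<delta> / 3 - \<eta>) * X"
    using \<eta>_le_\<delta> X by (intro mult_right_mono) auto
  ultimately have 1: "(5 * \<delta> / 8) * X \<le> 3 / \<delta> * \<gamma>\<^sup>2 * (12 * L * Y + 6 / 5 * Z) + \<gamma>\<^sup>2 * D1 * W K" by simp
  have "Z \<le> 4 / (3 * \<alpha>) * s 0 + 8 / 3 * L * Y + 4 / 3 * q * D1 * W K"
    unfolding Z_def Y_def q_def by (rule weighted_\<sigma>2_sum)
  moreover have "4 / (3 * \<alpha>) * s 0 = 4 / 3 * (s 0 / \<alpha>)" by simp
  ultimately have "12 * L * Y + 6 / 5 * Z \<le> 76 / 5 * L * Y + 8 / 5 * (s 0 / \<alpha>) + 8 / 5 * q * D1 * W K"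
    by linarith
  then have "3 / \<delta> * \<gamma>\<^sup>2 * (12 * L * Y + 6 / 5 * Z)
      \<le> 3 / \<delta> * \<gamma>\<^sup>2 * (76 / 5 * L * Y + 8 / 5 * (s 0 / \<alpha>) + 8 / 5 * q * D1 * W K)"
    using \<delta>_pos by (intro mult_left_mono) auto
  with 1 have 2: "(5 * \<delta> / 8) * X
      \<le> 3 / \<delta> * \<gamma>\<^sup>2 * (76 / 5 * L * Y + 8 / 5 * (s 0 / \<alpha>) + 8 / 5 * q * D1 * W K) + \<gamma>\<^sup>2 * D1 * W K"
    by simp
  have "24 * L / (5 * \<delta>) * ((5 * \<delta> / 8) * X)
      \<le> 24 * L / (5 * \<delta>) * (3 / \<delta> * \<gamma>\<^sup>2 * (76 / 5 * L * Y + 8 / 5 * (s 0 / \<alpha>) + 8 / 5 * q * D1 * W K) + \<gamma>\<^sup>2 * D1 * W K)"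
    using L_pos \<delta>_pos by (intro mult_left_mono 2) auto
  also have "24 * L / (5 * \<delta>) * ((5 * \<delta> / 8) * X) = 3 * L * X" using \<delta>_pos by simp
  also have "24 * L / (5 * \<delta>) * (3 / \<delta> * \<gamma>\<^sup>2 * (76 / 5 * L * Y + 8 / 5 * (s 0 / \<alpha>) + 8 / 5 * q * D1 * W K) + \<gamma>\<^sup>2 * D1 * W K)
      = 5472 / 25 * ((\<gamma> * L)\<^sup>2 / \<delta>\<^sup>2) * Y + 576 / 25 * (L * \<gamma>\<^sup>2 / \<delta>\<^sup>2 * (s 0 / \<alpha>))
        + (576 / 25 * (L * \<gamma>\<^sup>2 * q / \<delta>\<^sup>2 * D1 * W K) + 24 / 5 * (L * \<gamma>\<^sup>2 / \<delta> * D1 * W K))"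
    using \<delta>_pos \<alpha>_pos by (simp add: field_simps power2_eq_square)
  also have "\<dots> \<le> 1 / 4 * Y + F1 * s 0 + \<gamma> * D3 * W K"
  proof (intro add_mono mult_right_mono Y)
    have "(\<gamma> * L)\<^sup>2 / \<delta>\<^sup>2 \<le> 1 / 1152" using \<gamma>L_power2_le \<delta>_pos by (simp add: field_simps)
    then show "5472 / 25 * ((\<gamma> * L)\<^sup>2 / \<delta>\<^sup>2) \<le> 1 / 4" by simp
    define p where "p = L * \<gamma>\<^sup>2 / \<delta>\<^sup>2 * (s 0 / \<alpha>)"
    have p: "0 \<le> p" using L_pos \<alpha>_pos s_nonneg[of 0] by (simp add: p_def)
    have "p * (1 - \<eta>) \<le> p * 1" using p \<eta>_nonneg by (intro mult_left_mono) auto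
    then have "p \<le> p / (1 - \<eta>)" using \<eta>_less_1 by (simp add: pos_le_divide_eq)
    moreover have "F1 * s 0 = 96 * (p / (1 - \<eta>))" by (simp add: F1_def p_def)
    ultimately show "576 / 25 * p \<le> F1 * s 0" using p by simp
    define t where "t = L * \<gamma>\<^sup>2 * q / \<delta>\<^sup>2 * D1 * W K"
    define t' where "t' = L * \<gamma>\<^sup>2 / \<delta> * D1 * W K"
    have "\<gamma> * D3 * W K = 24 * t + 6 * t'"
      using \<delta>_pos by (simp add: D3_def t_def t'_def q_def field_simps power2_eq_square)
    moreover have "0 \<le> t" "0 \<le> t'"
      using L_pos q \<delta>_pos D1_nonneg W_pos[of K] by (simp_all add: t_def t'_def)
    ultimately show "576 / 25 * t + 24 / 5 * t' \<le> \<gamma> * D3 * W K"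
      by linarith
  qed
  finally show ?thesis by (simp add: X_def Y_def)
qed

definition eb :: "nat \<Rightarrow> 'w \<Rightarrow> 'a" where "eb k w = avg n (\<lambda>i. e i k w)"

lemma eb_sq: "square_integrable M (eb k)"
  unfolding eb_def[abs_def] by (intro square_integrable_avg e_sq)

lemma eb_hist: "eb k \<in> borel_measurable (hist k)"
  unfolding eb_def[abs_def] by (intro avg_measurable e_hist)

lemma eb_norm2_le: "(LINT w|M. (norm (eb k w))\<^sup>2) \<le> \<epsilon> k"
  unfolding \<epsilon>_def eb_def
  by (intro integral_mono norm2_avg_le n_pos integrable_avg square_integrable_norm2 e_sq square_integrable_avg)

lemma weighted_mean_error_sum:
  "3 * L * (\<Sum>k=0..K. wgt \<eta> k * (LINT w|M. (norm (eb k w))\<^sup>2))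
    \<le> 1 / 4 * (\<Sum>k=0..K. wgt \<eta> k * r k) + F1 * s 0 + \<gamma> * D3 * W K"
proof -
  have "3 * L * (\<Sum>k=0..K. wgt \<eta> k * (LINT w|M. (norm (eb k w))\<^sup>2)) \<le> 3 * L * (\<Sum>k=0..K. wgt \<eta> k * \<epsilon> k)"
    using L_pos by (intro mult_left_mono sum_mono eb_norm2_le less_imp_le wgt_pos \<eta>_less_1) auto
  also note weighted_error_sum
  finally show ?thesis .
qed

section \<open>The perturbed iterates\<close>

text \<open>The error \<open>eb k\<close> is what the workers have not yet transmitted; \<open>xt k\<close> is the iterate that would
  result if it were applied at once.\<close>

definition xt :: "nat \<Rightarrow> 'w \<Rightarrow> 'a" where "xt k w = x k w - eb k w"

definition A :: "nat \<Rightarrow> real" where "A k = (LINT w|M. (norm (xt k w - xs))\<^sup>2)"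

lemma xt_step:
  assumes w: "w \<in> space M"
  shows "xt (Suc k) w = xt k w - \<gamma> *\<^sub>R avg n (\<lambda>i. g i k w)"
proof -
  have "eb (Suc k) w = avg n (\<lambda>i. (e i k w + \<gamma> *\<^sub>R g i k w) - v i k w)"
    unfolding eb_def by (intro avg_cong) (simp add: e_step w)
  also have "\<dots> = eb k w + \<gamma> *\<^sub>R avg n (\<lambda>i. g i k w) - avg n (\<lambda>i. v i k w)"
    by (simp only: avg_diff avg_add avg_scaleR eb_def)
  finally show ?thesis by (simp add: xt_def x_step w)
qed

lemma xt_sq: "square_integrable M (\<lambda>w. xt k w - xs)"
  unfolding xt_def by (intro square_integrable_diff x_sq eb_sq square_integrable_const)

lemma xt_hist: "(\<lambda>w. xt k w - xs) \<in> borel_measurable (hist k)"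
  unfolding xt_def using x_hist eb_hist by (intro borel_measurable_diff) auto

text \<open>Quasi strong convexity holds at \<open>x k\<close>, whereas the distance is measured from \<open>xt k\<close>. Moving both
  the inner product and the squared distance costs \<open>2 L \<parallel>eb k\<parallel>\<^sup>2\<close> plus half of the available \<open>2 gap\<close>,
  and \<open>\<mu> \<parallel>eb k\<parallel>\<^sup>2\<close>, where \<open>\<mu> \<le> L\<close>.\<close>

lemma descent_direction:
  "gap k w + \<mu> / 2 * (norm (xt k w - xs))\<^sup>2 - 3 * L * (norm (eb k w))\<^sup>2
    \<le> 2 * ((xt k w - xs) \<bullet> grad f (x k w))"
proof -
  let ?F = "grad f (x k w)"
  have "f (x k w) + ?F \<bullet> (xs - x k w) + \<mu> / 2 * (norm (x k w - xs))\<^sup>2 \<le> f xs"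
    using quasi_convex_f by (auto simp: quasi_strongly_convex_def)
  then have 1: "gap k w + \<mu> / 2 * (norm (x k w - xs))\<^sup>2 \<le> (x k w - xs) \<bullet> ?F"
    by (simp add: gap_def inner_diff_left inner_diff_right inner_commute)
  have 2: "2 * (eb k w \<bullet> ?F) \<le> 2 * L * (norm (eb k w))\<^sup>2 + gap k w"
  proof -
    have "0 \<le> (norm ((2 * L) *\<^sub>R eb k w - ?F))\<^sup>2" by simp
    then have "2 * L * (2 * (eb k w \<bullet> ?F)) \<le> 2 * L * (2 * L * (norm (eb k w))\<^sup>2) + (norm ?F)\<^sup>2"
      by (simp add: power2_norm_diff norm_scaleR_power2 power_mult_distrib power2_eq_square[of L] mult.assoc del: norm_scaleR)
    also have "\<dots> \<le> 2 * L * (2 * L * (norm (eb k w))\<^sup>2 + gap k w)"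
      using grad_f_norm2_le[of k w] by (simp add: distrib_left)
    finally show ?thesis using L_pos by simp
  qed
  have 3: "\<mu> / 2 * (norm (xt k w - xs))\<^sup>2 \<le> \<mu> * (norm (x k w - xs))\<^sup>2 + L * (norm (eb k w))\<^sup>2"
  proof -
    have "(norm (xt k w - xs))\<^sup>2 \<le> 2 * (norm (x k w - xs))\<^sup>2 + 2 * (norm (eb k w))\<^sup>2"
      using young_norm2[of 1 "x k w - xs" "- eb k w"] by (simp add: xt_def algebra_simps)
    then have "\<mu> / 2 * (norm (xt k w - xs))\<^sup>2 \<le> \<mu> / 2 * (2 * (norm (x k w - xs))\<^sup>2 + 2 * (norm (eb k w))\<^sup>2)"
      using \<mu>_nonneg by (intro mult_left_mono) auto
    moreover have "\<mu> * (norm (eb k w))\<^sup>2 \<le> L * (norm (eb k w))\<^sup>2"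
      using \<mu>_le_L by (intro mult_right_mono) auto
    ultimately show ?thesis by (simp add: distrib_left)
  qed
  have "(xt k w - xs) \<bullet> ?F = (x k w - xs) \<bullet> ?F - eb k w \<bullet> ?F"
    by (simp add: xt_def inner_diff_left)
  then show ?thesis using 1 2 3 by simp
qed

text \<open>Of the term \<open>- \<gamma> r k\<close> one half pays for the second moment of the mean estimator, as
  \<open>2 L \<gamma>\<^sup>2 \<le> \<gamma>/2\<close>.\<close>

lemma A_step: "A (Suc k) \<le> (1 - \<eta>) * A k
    - (\<gamma> / 2 * r k - 3 * L * \<gamma> * (LINT w|M. (norm (eb k w))\<^sup>2) - \<gamma>\<^sup>2 * (D1 / real n))"
proof -
  let ?p = "\<lambda>w. xt k w - xs" and ?F = "\<lambda>w. grad f (x k w)" and ?g = "\<lambda>w. avg n (\<lambda>i. g i k w)"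
  note ints = square_integrable_norm2[OF xt_sq, of k] square_integrable_inner[OF xt_sq grad_f_sq, of k k]
    square_integrable_inner[OF xt_sq mean_noise_sq, of k k] square_integrable_norm2[OF avg_g_sq, of k]
    square_integrable_norm2[OF eb_sq, of k] gap_integrable[of k]
  have g2: "(LINT w|M. (norm (?g w))\<^sup>2) \<le> 2 * L * r k + D1 / real n"
    using avg_g_norm2_on[OF space_in_past, of k] ints
    by (simp add: integral_indicator_space r_def prob_space)
  have orth: "(LINT w|M. ?p w \<bullet> mean_noise k w) = 0"
    using mean_noise_orthogonal_on[OF xt_hist xt_sq space_in_past, of k] by (simp add: integral_indicator_space)
  have F: "r k + \<mu> / 2 * A k - 3 * L * (LINT w|M. (norm (eb k w))\<^sup>2) \<le> 2 * (LINT w|M. ?p w \<bullet> ?F w)"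
  proof -
    have "(LINT w|M. gap k w + \<mu> / 2 * (norm (?p w))\<^sup>2 - 3 * L * (norm (eb k w))\<^sup>2)
        \<le> (LINT w|M. 2 * (?p w \<bullet> ?F w))"
      using ints by (intro integral_mono descent_direction) auto
    then show ?thesis using ints by (simp add: r_def A_def)
  qed
  have "A (Suc k) = (LINT w|M. (norm (?p w))\<^sup>2 - 2 * \<gamma> * (?p w \<bullet> ?F w) - 2 * \<gamma> * (?p w \<bullet> mean_noise k w)
      + \<gamma>\<^sup>2 * (norm (?g w))\<^sup>2)"
    unfolding A_def
  proof (intro Bochner_Integration.integral_cong refl)
    fix w assume w: "w \<in> space M"
    have "(norm (xt (Suc k) w - xs))\<^sup>2 = (norm (?p w - \<gamma> *\<^sub>R ?g w))\<^sup>2"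
      by (simp add: xt_step[OF w] algebra_simps)
    also have "\<dots> = (norm (?p w))\<^sup>2 - 2 * (?p w \<bullet> (\<gamma> *\<^sub>R ?g w)) + \<gamma>\<^sup>2 * (norm (?g w))\<^sup>2"
      by (simp only: power2_norm_diff norm_scaleR_power2)
    also have "?p w \<bullet> (\<gamma> *\<^sub>R ?g w) = \<gamma> * (?p w \<bullet> ?F w) + \<gamma> * (?p w \<bullet> mean_noise k w)"
      by (simp add: avg_g[OF w] inner_add_right distrib_left)
    finally show "(norm (xt (Suc k) w - xs))\<^sup>2 = (norm (?p w))\<^sup>2 - 2 * \<gamma> * (?p w \<bullet> ?F w)
        - 2 * \<gamma> * (?p w \<bullet> mean_noise k w) + \<gamma>\<^sup>2 * (norm (?g w))\<^sup>2"
      by (simp add: distrib_left)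
  qed
  also have "\<dots> = A k - \<gamma> * (2 * (LINT w|M. ?p w \<bullet> ?F w)) + \<gamma>\<^sup>2 * (LINT w|M. (norm (?g w))\<^sup>2)"
    using ints orth by (simp add: A_def)
  also have "\<dots> \<le> A k - \<gamma> * (r k + \<mu> / 2 * A k - 3 * L * (LINT w|M. (norm (eb k w))\<^sup>2))
      + \<gamma>\<^sup>2 * (2 * L * r k + D1 / real n)"
    using \<gamma>_pos F g2 by (intro add_mono diff_mono mult_left_mono) auto
  also have "\<dots> = (1 - \<gamma> * \<mu> / 2) * A k - \<gamma> * r k + \<gamma> * (2 * (\<gamma> * L)) * r k
      + 3 * L * \<gamma> * (LINT w|M. (norm (eb k w))\<^sup>2) + \<gamma>\<^sup>2 * (D1 / real n)"
    by (simp add: algebra_simps power2_eq_square)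
  also have "\<dots> \<le> (1 - \<eta>) * A k - \<gamma> * r k + \<gamma> * (1 / 2) * r k
      + 3 * L * \<gamma> * (LINT w|M. (norm (eb k w))\<^sup>2) + \<gamma>\<^sup>2 * (D1 / real n)"
  proof (intro add_mono diff_mono mult_right_mono mult_left_mono order_refl)
    show "0 \<le> A k" by (simp add: A_def)
  qed (use \<eta>_le_\<mu> \<gamma>L_le_quarter \<gamma>_pos L_pos D1_nonneg r_nonneg in auto)
  finally show ?thesis by simp
qed

lemma A_0: "A 0 = (norm (x0 - xs))\<^sup>2"
proof -
  have "A 0 = (LINT w|M. (norm (x0 - xs))\<^sup>2)"
    unfolding A_def
  proof (intro Bochner_Integration.integral_cong refl)
    fix w assume w: "w \<in> space M"
    have "eb 0 w = avg n (\<lambda>i. 0)" unfolding eb_def by (intro avg_cong) (simp add: e_init w)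
    then show "(norm (xt 0 w - xs))\<^sup>2 = (norm (x0 - xs))\<^sup>2"
      by (simp add: xt_def x_init w avg_def)
  qed
  then show ?thesis by (simp add: prob_space)
qed

definition \<sigma>0 :: real where "\<sigma>0 = avg n (\<lambda>i. (norm (h0 i - hs i))\<^sup>2)"

lemma \<sigma>2_0: "w \<in> space M \<Longrightarrow> \<sigma>2 0 w = \<sigma>0"
  unfolding \<sigma>2_def \<sigma>0_def by (intro avg_cong) (simp add: h_init)

lemma s_0: "s 0 = \<sigma>0"
proof -
  have "s 0 = (LINT w|M. \<sigma>0)" unfolding s_def by (intro Bochner_Integration.integral_cong refl \<sigma>2_0)
  then show ?thesis by (simp add: prob_space)
qed

lemma \<sigma>0_nonneg: "0 \<le> \<sigma>0"
  using s_nonneg[of 0] by (simp add: s_0)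

lemma weighted_gap_sum:
  "(\<Sum>k=0..K. wgt \<eta> k * r k) / W K
    \<le> 4 * ((norm (x0 - xs))\<^sup>2 + \<gamma> * F1 * \<sigma>0) / (\<gamma> * W K) + 4 * \<gamma> * (D1 / real n + D3)"
proof -
  define Y where "Y = (\<Sum>k=0..K. wgt \<eta> k * r k)"
  define X where "X = (\<Sum>k=0..K. wgt \<eta> k * (LINT w|M. (norm (eb k w))\<^sup>2))"
  define N where "N = (norm (x0 - xs))\<^sup>2 + \<gamma> * F1 * \<sigma>0"
  have "(\<Sum>k=0..K. wgt \<eta> k * (\<gamma> / 2 * r k - 3 * L * \<gamma> * (LINT w|M. (norm (eb k w))\<^sup>2) - \<gamma>\<^sup>2 * (D1 / real n))) \<le> A 0"
  proof (rule weighted_telescope[where A=A, OF \<eta>_less_1])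
    show "A (Suc k) \<le> (1 - \<eta>) * A k
        - (\<gamma> / 2 * r k - 3 * L * \<gamma> * (LINT w|M. (norm (eb k w))\<^sup>2) - \<gamma>\<^sup>2 * (D1 / real n))" for k
      by (rule A_step)
  qed (simp add: A_def)
  also have "(\<Sum>k=0..K. wgt \<eta> k * (\<gamma> / 2 * r k - 3 * L * \<gamma> * (LINT w|M. (norm (eb k w))\<^sup>2) - \<gamma>\<^sup>2 * (D1 / real n)))
      = \<gamma> / 2 * Y - \<gamma> * (3 * L * X) - \<gamma>\<^sup>2 * (D1 / real n) * W K"
    unfolding Y_def X_def W_eq right_diff_distrib sum_subtractf sum_distrib_left
    by (intro arg_cong2[where f="(-)"] sum.cong refl) (simp_all add: mult_ac)
  finally have "\<gamma> / 2 * Y \<le> (norm (x0 - xs))\<^sup>2 + \<gamma> * (3 * L * X) + \<gamma>\<^sup>2 * (D1 / real n) * W K"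
    by (simp add: A_0)
  moreover have "\<gamma> * (3 * L * X) \<le> \<gamma> * (1 / 4 * Y + F1 * \<sigma>0 + \<gamma> * D3 * W K)"
    using \<gamma>_pos weighted_mean_error_sum[of K] by (intro mult_left_mono) (auto simp: X_def Y_def s_0)
  moreover have "\<gamma> * (1 / 4 * Y + F1 * \<sigma>0 + \<gamma> * D3 * W K) = \<gamma> / 4 * Y + \<gamma> * F1 * \<sigma>0 + \<gamma>\<^sup>2 * D3 * W K"
    by (simp add: algebra_simps power2_eq_square)
  moreover have "\<gamma>\<^sup>2 * (D1 / real n + D3) * W K = \<gamma>\<^sup>2 * (D1 / real n) * W K + \<gamma>\<^sup>2 * D3 * W K"
    by (simp only: distrib_left distrib_right)
  moreover have "\<gamma> / 2 * Y = 2 * (\<gamma> / 4 * Y)" by simp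
  ultimately have "\<gamma> / 4 * Y \<le> N + \<gamma>\<^sup>2 * (D1 / real n + D3) * W K"
    unfolding N_def by linarith
  then have "4 / (\<gamma> * W K) * (\<gamma> / 4 * Y) \<le> 4 / (\<gamma> * W K) * (N + \<gamma>\<^sup>2 * (D1 / real n + D3) * W K)"
    using \<gamma>_pos W_pos[of K] by (intro mult_left_mono) auto
  also have "4 / (\<gamma> * W K) * (\<gamma> / 4 * Y) = Y / W K" using \<gamma>_pos by simp
  also have "4 / (\<gamma> * W K) * (N + \<gamma>\<^sup>2 * (D1 / real n + D3) * W K)
      = 4 * N / (\<gamma> * W K) + 4 * \<gamma> * (D1 / real n + D3)"
  proof -
    have "4 / (\<gamma> * W K) * (\<gamma>\<^sup>2 * E * W K) = 4 * \<gamma> * E" for E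
      using \<gamma>_pos W_pos[of K] by (simp add: power2_eq_square)
    then show ?thesis by (simp only: distrib_left[of "4 / (\<gamma> * W K)"]) simp
  qed
  finally show ?thesis by (simp add: Y_def N_def)
qed

section \<open>The weighted average of the iterates\<close>

abbreviation xbar :: "nat \<Rightarrow> 'w \<Rightarrow> 'a" where "xbar \<equiv> wgt_avg \<eta> x"

lemma xbar_sq: "square_integrable M (xbar K)"
  unfolding wgt_avg_def[abs_def] by (intro square_integrable_scaleR square_integrable_sum x_sq)

lemma xbar_gap_integrable: "integrable M (\<lambda>w. f (xbar K w) - f xs)"
  by (rule integrable_f_gap[OF xbar_sq])

lemma xbar_gap_le:
  "(LINT w|M. f (xbar K w) - f xs)
    \<le> 4 * ((norm (x0 - xs))\<^sup>2 + \<gamma> * F1 * \<sigma>0) / (\<gamma> * W K) + 4 * \<gamma> * (D1 / real n + D3)"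
proof -
  have sum1: "(\<Sum>k=0..K. wgt \<eta> k / W K) = 1"
    using W_pos[of K] by (simp add: W_eq flip: sum_divide_distrib)
  have jensen: "f (xbar K w) - f xs \<le> (\<Sum>k=0..K. wgt \<eta> k / W K * gap k w)" for w
  proof -
    have "xbar K w = (\<Sum>k=0..K. (wgt \<eta> k / W K) *\<^sub>R x k w)"
      by (simp add: wgt_avg_def W_def scaleR_sum_right)
    then have "f (xbar K w) \<le> (\<Sum>k=0..K. wgt \<eta> k / W K * f (x k w))"
      using convex_on_sum[OF _ _ convex_f sum1, of "\<lambda>k. x k w"] W_pos[of K] wgt_pos[OF \<eta>_less_1]
      by (simp add: less_imp_le)
    moreover have "(\<Sum>k=0..K. wgt \<eta> k / W K * gap k w)
        = (\<Sum>k=0..K. wgt \<eta> k / W K * f (x k w)) - (\<Sum>k=0..K. wgt \<eta> k / W K) * f xs"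
      by (simp add: gap_def right_diff_distrib sum_subtractf sum_distrib_right)
    ultimately show ?thesis by (simp add: sum1)
  qed
  have "(LINT w|M. f (xbar K w) - f xs) \<le> (LINT w|M. (\<Sum>k=0..K. wgt \<eta> k / W K * gap k w))"
    using gap_integrable by (intro integral_mono xbar_gap_integrable jensen Bochner_Integration.integrable_sum) auto
  also have "\<dots> = (\<Sum>k=0..K. wgt \<eta> k / W K * r k)"
    using gap_integrable by (simp add: r_def)
  also have "\<dots> = (\<Sum>k=0..K. wgt \<eta> k * r k) / W K"
    by (simp add: sum_divide_distrib)
  also note weighted_gap_sum
  finally show ?thesis .
qed

text \<open>The last weight alone already gives the linear rate.\<close>

lemma inverse_W_le: "1 / W K \<le> (1 - \<eta>) ^ K"
proof -
  have "1 / W K \<le> 1 / wgt \<eta> K"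
    using W_ge_wgt[of K] wgt_pos[OF \<eta>_less_1, of K] by (intro divide_left_mono) auto
  also have "\<dots> = (1 - \<eta>) * (1 - \<eta>) ^ K" by (simp add: wgt_def)
  also have "\<dots> \<le> 1 * (1 - \<eta>) ^ K"
    using \<eta>_nonneg \<eta>_less_1 by (intro mult_right_mono) auto
  finally show ?thesis by simp
qed

lemma linear_convergence:
  "(LINT w|M. f (xbar K w) - f xs)
    \<le> (1 - \<eta>) ^ K * (4 * ((norm (x0 - xs))\<^sup>2 + \<gamma> * F1 * \<sigma>0) / \<gamma>) + 4 * \<gamma> * (D1 / real n + D3)"
proof -
  let ?N = "4 * ((norm (x0 - xs))\<^sup>2 + \<gamma> * F1 * \<sigma>0) / \<gamma>"
  have "0 \<le> ?N" using \<gamma>_pos F1_nonneg \<sigma>0_nonneg by simp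
  then have "1 / W K * ?N \<le> (1 - \<eta>) ^ K * ?N" by (intro mult_right_mono inverse_W_le)
  moreover have "4 * ((norm (x0 - xs))\<^sup>2 + \<gamma> * F1 * \<sigma>0) / (\<gamma> * W K) = 1 / W K * ?N" by simp
  ultimately show ?thesis using xbar_gap_le[of K] by linarith
qed

lemma sublinear_convergence:
  assumes \<mu>: "\<mu> = 0" and K: "0 < K"
  shows "(LINT w|M. f (xbar K w) - f xs)
    \<le> 4 * ((norm (x0 - xs))\<^sup>2 + \<gamma> * F1 * \<sigma>0) / (\<gamma> * real K) + 4 * \<gamma> * (D1 / real n + D3)"
proof -
  have "\<eta> = 0" unfolding \<eta>_def using \<alpha>_pos \<mu> by simp
  then have "W K = real K + 1" by (simp add: W_eq wgt_def)
  then have "4 * ((norm (x0 - xs))\<^sup>2 + \<gamma> * F1 * \<sigma>0) / (\<gamma> * W K)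
      \<le> 4 * ((norm (x0 - xs))\<^sup>2 + \<gamma> * F1 * \<sigma>0) / (\<gamma> * real K)"
    using \<gamma>_pos F1_nonneg \<sigma>0_nonneg K by (intro divide_left_mono mult_left_mono) auto
  then show ?thesis using xbar_gap_le[of K] by linarith
qed

section \<open>The parametric assumption\<close>

definition params :: ec_params where
  "params = \<lparr> par_A = 2 * L, par_At = 0, par_A' = L,
     par_B1 = 2, par_B1t = 0, par_B1' = 0,
     par_B2 = 0, par_B2t = 0, par_B2' = 0,
     par_C1 = L * \<alpha>, par_C2 = 0,
     par_D1 = 0, par_D1t = D1, par_D1' = D1 / real n,
     par_D2 = \<alpha>\<^sup>2 * (\<omega> + 1) * D1, par_D3 = D3,
     par_F1 = F1, par_F2 = 0, par_G = 0,
     par_rho1 = \<alpha>, par_rho2 = 1 \<rparr>"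

lemma rate_eq: "rate \<gamma> \<mu> \<alpha> 1 = \<eta>"
  using \<alpha>_less_1 by (simp add: rate_def \<eta>_def min_def)

lemma satisfies_parametric_assumption:
  "parametric_assumption M hist n f xs L \<mu> \<gamma> x g e \<sigma>2 (\<lambda>_ _. 0) params"
proof -
  have gap: "gap k = (\<lambda>w. f (x k w) - f xs)" for k by (simp add: gap_def[abs_def])
  have eb: "eb k = (\<lambda>w. avg n (\<lambda>i. e i k w))" for k by (simp add: eb_def[abs_def])
  show ?thesis
    unfolding parametric_assumption_def Let_def params_def ec_params.select_convs rate_eq
    unfolding gap[symmetric] eb[symmetric, THEN fun_cong] gap_def[symmetric]
  proof (intro conjI allI ballI)
    fix k
    show "integrable M (gap k)" by (rule gap_integrable)
    show "integrable M (\<sigma>2 k)" by (rule \<sigma>2_integrable)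
    show "integrable M (\<lambda>_. 0 :: real)" by simp
    show "integrable M (\<lambda>w. (norm (eb k w))\<^sup>2)" by (rule square_integrable_norm2[OF eb_sq])
  next
    fix k i assume i: "i \<in> {1..n}"
    show "integrable M (g i k)" by (rule square_integrable_integrable[OF g_sq[OF i]])
    show "integrable M (\<lambda>w. (norm (g i k w - vec_cond_exp M (hist k) (g i k) w))\<^sup>2)"
      by (rule g_deviation(1)[OF i])
  next
    fix k
    show "AE w in M. vec_cond_exp M (hist k) (\<lambda>w. avg n (\<lambda>i. g i k w)) w = grad f (x k w)"
      by (rule vec_cond_exp_avg_g)
  next
    fix k
    have "AE w in M. \<forall>i\<in>{1..n}. vec_cond_exp M (hist k) (g i k) w = gb i k w"
      by (intro AE_finite_allI vec_cond_exp_g) simp_all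
    then show "AE w in M. avg n (\<lambda>i. (norm (vec_cond_exp M (hist k) (g i k) w))\<^sup>2)
        \<le> 2 * (2 * L) * gap k w + 2 * \<sigma>2 k w + 0 * 0 + 0"
    proof eventually_elim
      case (elim w)
      have "avg n (\<lambda>i. (norm (vec_cond_exp M (hist k) (g i k) w))\<^sup>2) = avg n (\<lambda>i. (norm (gb i k w))\<^sup>2)"
        using elim by (intro avg_cong) simp
      then show ?case using avg_gb_norm2_le[of 1 k w] by simp
    qed
  next
    fix k
    have "AE w in M. \<forall>i\<in>{1..n}. real_cond_exp M (hist k)
        (\<lambda>w. (norm (g i k w - vec_cond_exp M (hist k) (g i k) w))\<^sup>2) w \<le> D1i i"
      by (intro AE_finite_allI g_deviation(2)) simp_all
    then show "AE w in M. avg n (\<lambda>i. real_cond_exp M (hist k)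
        (\<lambda>w. (norm (g i k w - vec_cond_exp M (hist k) (g i k) w))\<^sup>2) w)
        \<le> 2 * 0 * gap k w + 0 * \<sigma>2 k w + 0 * 0 + D1"
    proof eventually_elim
      case (elim w)
      have "avg n (\<lambda>i. real_cond_exp M (hist k)
          (\<lambda>w. (norm (g i k w - vec_cond_exp M (hist k) (g i k) w))\<^sup>2) w) \<le> D1"
        unfolding D1_def using elim by (intro avg_mono) blast
      then show ?case by simp
    qed
  next
    fix k
    have "cond_exp_le M (hist k) (\<lambda>w. (norm (avg n (\<lambda>i. g i k w)))\<^sup>2) (\<lambda>w. 2 * L * gap k w + D1 / real n)"
      using gap_hist[of k] gap_integrable[of k]
      by (intro cond_exp_leI[OF subalgebra_past] avg_g_norm2_on square_integrable_norm2[OF avg_g_sq]) auto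
    then show "cond_exp_le M (hist k) (\<lambda>w. (norm (avg n (\<lambda>i. g i k w)))\<^sup>2)
        (\<lambda>w. 2 * L * gap k w + 0 * \<sigma>2 k w + 0 * 0 + D1 / real n)"
      by simp
  next
    fix k
    have "cond_exp_le M (hist k) (\<sigma>2 (Suc k))
        (\<lambda>w. (1 - \<alpha>) * \<sigma>2 k w + 2 * (L * \<alpha>) * gap k w + \<alpha>\<^sup>2 * (\<omega> + 1) * D1)"
      using gap_hist[of k] gap_integrable[of k] \<sigma>2_hist[of k] \<sigma>2_integrable[of k]
      by (intro cond_exp_leI[OF subalgebra_past] \<sigma>2_step_on \<sigma>2_integrable) auto
    then show "cond_exp_le M (hist k) (\<sigma>2 (k + 1))
        (\<lambda>w. (1 - \<alpha>) * \<sigma>2 k w + 2 * (L * \<alpha>) * gap k w + 0 * \<alpha> * 0 + \<alpha>\<^sup>2 * (\<omega> + 1) * D1)"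
      by simp
  next
    fix k
    have "cond_exp_le M (hist k) (\<lambda>_. 0) (\<lambda>_. 0)"
      by (rule cond_exp_leI[OF subalgebra_past]) auto
    then show "cond_exp_le M (hist k) (\<lambda>_. 0) (\<lambda>w. (1 - 1) * 0 + 2 * 0 * gap k w)" by simp
  next
    fix K
    show "AE w in M. 3 * L * (\<Sum>k=0..K. wgt \<eta> k * (LINT w|M. (norm (eb k w))\<^sup>2))
        \<le> 1 / 4 * (\<Sum>k=0..K. wgt \<eta> k * (LINT w|M. gap k w))
           + F1 * \<sigma>2 0 w + 0 * 0 + \<gamma> * D3 * wgt_sum \<eta> K"
      using weighted_mean_error_sum[of K]
      by (intro AE_I2) (simp add: \<sigma>2_0 s_0 r_def W_def)
  qed
qed

end

theorem theoremJ4: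
  fixes M :: "'w measure"
    and n :: nat
    and fi :: "nat \<Rightarrow> 'a::euclidean_space \<Rightarrow> real"
    and xs x0 :: 'a
    and L \<mu> \<gamma> \<alpha> \<delta> \<omega> :: real
    and D1i :: "nat \<Rightarrow> real"
    and S :: "'s measure" and C :: "'s \<Rightarrow> 'a \<Rightarrow> 'a" and sC :: "nat \<Rightarrow> nat \<Rightarrow> 'w \<Rightarrow> 's"
    and R :: "'r measure" and Q :: "'r \<Rightarrow> 'a \<Rightarrow> 'a" and sQ :: "nat \<Rightarrow> nat \<Rightarrow> 'w \<Rightarrow> 'r"
    and h0 :: "nat \<Rightarrow> 'a"
    and gh :: "nat \<Rightarrow> nat \<Rightarrow> 'w \<Rightarrow> 'a"
    and x :: "nat \<Rightarrow> 'w \<Rightarrow> 'a"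
    and e h g v :: "nat \<Rightarrow> nat \<Rightarrow> 'w \<Rightarrow> 'a"
  assumes "1 \<le> n" and "0 < L" and "0 \<le> \<mu>"
    and "\<And>i. i \<in> {1..n} \<Longrightarrow> convex_on UNIV (fi i)"
    and "\<And>i. i \<in> {1..n} \<Longrightarrow> smooth L (fi i)"
    and "quasi_strongly_convex \<mu> (\<lambda>y. avg n (\<lambda>i. fi i y)) xs"
    and "compression_operator S \<delta> C"
    and "quantization_operator R \<omega> Q"
    and "ec_sgd_diana M n fi \<gamma> \<alpha> D1i S C sC R Q sQ x0 h0 gh x e h g v"
    and "0 < \<gamma>"
    and "\<gamma> \<le> min (1 / (4 * L)) (\<delta> * sqrt (1 - \<alpha>) / (8 * L * sqrt (6 * (3 - \<alpha>))))"
    and "0 < \<alpha>" and "\<alpha> \<le> 1 / (\<omega> + 1)"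
  shows "let f = (\<lambda>y. avg n (\<lambda>i. fi i y));
             D1t = avg n D1i;
             s1 = (\<lambda>k w. avg n (\<lambda>i. (norm (h i k w - grad (fi i) xs))\<^sup>2));
             \<sigma>0sq = avg n (\<lambda>i. (norm (h0 i - grad (fi i) xs))\<^sup>2);
             \<eta> = min (\<gamma> * \<mu> / 2) (\<alpha> / 4);
             D1' = D1t / real n;
             F1 = 96 * L * \<gamma>\<^sup>2 / (\<delta>\<^sup>2 * \<alpha> * (1 - \<eta>));
             D3 = 6 * L * \<gamma> / \<delta> * (4 * \<alpha> * (\<omega> + 1) / \<delta> + 1) * D1t;
             P = \<lparr> par_A = 2 * L, par_At = 0, par_A' = L,
                   par_B1 = 2, par_B1t = 0, par_B1' = 0,
                   par_B2 = 0, par_B2t = 0, par_B2' = 0,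
                   par_C1 = L * \<alpha>, par_C2 = 0,
                   par_D1 = 0, par_D1t = D1t, par_D1' = D1',
                   par_D2 = \<alpha>\<^sup>2 * (\<omega> + 1) * D1t, par_D3 = D3,
                   par_F1 = F1, par_F2 = 0, par_G = 0,
                   par_rho1 = \<alpha>, par_rho2 = 1 \<rparr>;
             xbar = wgt_avg (rate \<gamma> \<mu> (par_rho1 P) (par_rho2 P)) x
         in
           parametric_assumption M (history M n gh S sC R sQ) n f xs L \<mu> \<gamma> x g e s1 (\<lambda>_ _. 0) P \<and>
           (\<forall>K. integrable M (\<lambda>w. f (xbar K w) - f xs)) \<and>
           (\<mu> > 0 \<longrightarrow> (\<forall>K.
              (LINT w|M. f (xbar K w) - f xs)
              \<le> (1 - \<eta>) ^ K * (4 * ((norm (x0 - xs))\<^sup>2 + \<gamma> * F1 * \<sigma>0sq) / \<gamma>)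
                 + 4 * \<gamma> * (D1' + D3))) \<and>
           (\<mu> = 0 \<longrightarrow> (\<forall>K>0.
              (LINT w|M. f (xbar K w) - f xs)
              \<le> 4 * ((norm (x0 - xs))\<^sup>2 + \<gamma> * F1 * \<sigma>0sq) / (\<gamma> * real K)
                 + 4 * \<gamma> * (D1' + D3)))"
proof -
  interpret ec_sgd_diana_convex M n fi \<gamma> \<alpha> D1i S C sC R Q sQ x0 h0 gh x e h g v xs L \<mu> \<delta> \<omega>
    using assms by (intro ec_sgd_diana_convex.intro ec_sgd_diana_convex_axioms.intro)
  have \<sigma>2: "(\<lambda>k w. avg n (\<lambda>i. (norm (h i k w - grad (fi i) xs))\<^sup>2)) = \<sigma>2"
    by (simp add: \<sigma>2_def[abs_def] hs_def)
  have \<sigma>0: "avg n (\<lambda>i. (norm (h0 i - grad (fi i) xs))\<^sup>2) = \<sigma>0"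
    by (simp add: \<sigma>0_def hs_def)
  show ?thesis
    unfolding Let_def ec_params.select_convs rate_eq
    unfolding f_def[symmetric] \<sigma>2 \<sigma>0 D1_def[symmetric] \<eta>_def[symmetric] F1_def[symmetric] D3_def[symmetric] params_def[symmetric]
  proof (intro conjI allI impI)
    show "parametric_assumption M hist n f xs L \<mu> \<gamma> x g e \<sigma>2 (\<lambda>_ _. 0) params"
      by (rule satisfies_parametric_assumption)
    show "integrable M (\<lambda>w. f (xbar K w) - f xs)" for K by (rule xbar_gap_integrable)
    show "(LINT w|M. f (xbar K w) - f xs)
      \<le> (1 - \<eta>) ^ K * (4 * ((norm (x0 - xs))\<^sup>2 + \<gamma> * F1 * \<sigma>0) / \<gamma>) + 4 * \<gamma> * (D1 / real n + D3)" for K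
      by (rule linear_convergence)
    show "(LINT w|M. f (xbar K w) - f xs)
      \<le> 4 * ((norm (x0 - xs))\<^sup>2 + \<gamma> * F1 * \<sigma>0) / (\<gamma> * real K) + 4 * \<gamma> * (D1 / real n + D3)"
      if "\<mu> = 0" "0 < K" for K
      using that by (rule sublinear_convergence)
  qed
qed

end
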